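(* Consider the conservative Hermite method of degree $m$ with arbitrary temporal order parameter $q\ge1$, described in the context, for the $2\pi$-periodic dissipation-free dispersive Maxwell system ($\Gamma_V=\Gamma_W=0$). Then the following two quantities are constant (independent of $n$): $$|V(\cdot,t_n)|_m^2+\frac14\,|W(\cdot,t_{n+1/2})+W(\cdot,t_{n-1/2})|_m^2-\frac14\,|\mathcal I_m\mathcal B^{*}V(\cdot,t_n)|_m^2,$$ $$|W(\cdot,t_{n+1/2})|_m^2+\frac14\,|V(\cdot,t_{n+1})+V(\cdot,t_{n})|_m^2-\frac14\,|\mathcal I_m\mathcal B\,W(\cdot,t_{n+1/2})|_m^2.$$
   Context: **Equations.** Let $\epsilon,\mu>0$ and $\omega_{e,j},\Omega_{e,j}$ ($1\le j\le N_e$), $\omega_{m,j},\Omega_{m,j}$ ($1\le j\le N_m$) be real constants, $c=(\epsilon\mu)^{-1/2}$. The system is $$\frac{\partial V}{\partial t}=\sum_kA_k\frac{\partial W}{\partial x_k}+MW,\qquad \frac{\partial W}{\partial t}=\sum_kA_k^T\frac{\partial V}{\partial x_k}-M^TV,$$ for periodic functions on $\mathbb T$ ($2\pi$-periodic in each of three variables). Here $V=(V_1,V_2,V_3)$ and $W=(W_1,W_2,W_3)$ are in block form: $V_1,W_1$ are 3-vectors, $V_2$ and $W_3$ each consist of $N_e$ 3-vectors, and $V_3$ and $W_2$ each consist of $N_m$ 3-vectors. (They arise as $V=(\sqrt\epsilon E,\sqrt\epsilon\omega_{e,j}\Omega_{e,j}L_j,\sqrt\mu\omega_{m,j}R_j)$,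 $W=(\sqrt\mu H,\sqrt\mu\omega_{m,j}\Omega_{m,j}S_j,\sqrt\epsilon\omega_{e,j}K_j)$ from the Sellmeier model $E_t=\epsilon^{-1}\nabla\times H-\sum_j\omega_{e,j}^2K_j$, $\partial_tK_j=-\Omega_{e,j}^2L_j+E$, $\partial_tL_j=K_j$, $H_t=-\mu^{-1}\nabla\times E-\sum_j\omega_{m,j}^2R_j$, $\partial_tR_j=-\Omega_{m,j}^2S_j+H$, $\partial_tS_j=R_j$.) The skew-symmetric matrices $A_k$ are such that $\sum_kA_k\partial_{x_k}W=(c\nabla\times W_1,0,0)$, and $M$ is defined by $$(MW)_1=-\sum_j\omega_{e,j}W_{3,j},\quad (MW)_{2,j}=\Omega_{e,j}W_{3,j},\quad (MW)_{3,j}=\omega_{m,j}W_1-\Omega_{m,j}W_{2,j}.$$ $\Gamma_V=\Gamma_W=0$ means that no dissipation terms are present. **Grids and interpolation.** The primal grid is a uniform periodic Cartesian grid with vertices $\mathbf x_j=(x_{1,j_1},x_{2,j_2},x_{3,j_3})$ and spacings $\Delta x_k$ (integer fractions of $2\pi$); the dual grid has as vertices the centers $\mathbf x_{j+1/2}$ of the primal cells. Fix $m\ge0$. The Hermite-Birkhoff interpolant $\mathcal I_m f$ on a grid is the function which on each cell of that grid is the unique tensor-product polynomial of degree at most $2m+1$ in each variable with $D^\alpha(\mathcal I_mf)=D^\alpha f$ for all $0\le\alpha_1,\alpha_2,\alpha_3\le m$ at the 8 cell vertices; it depends only on the data $D^\alpha f$ at the grid vertices, so it is defined whenever $f$ is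 smooth near the vertices. The same symbol $\mathcal I_m$ is used for the primal and the dual grid. **Method.** $t_n=n\Delta t$, $t_{n+1/2}=(n+1/2)\Delta t$. In the claim $V(\cdot,t_n)$ denotes the discrete solution, a Hermite-Birkhoff interpolant on the primal grid, and $W(\cdot,t_{n+1/2})$ the discrete solution, a Hermite-Birkhoff interpolant on the dual grid. For an interpolant $W$ on the dual grid, $\mathcal B W$ is defined near each primal vertex (the center of a dual cell) from the polynomial $\tilde W$ of that dual cell by $$\mathcal BW=2\sum_{\ell=1}^q\frac{(\Delta t/2)^{2\ell-1}}{(2\ell-1)!}V^\ell,\quad V^1=\Big(\sum_kA_k\partial_{x_k}+M\Big)\tilde W,\quad V^\ell=\Big(\sum_kA_k\partial_{x_k}+M\Big)\Big(\sum_kA_k^T\partial_{x_k}-M^T\Big)V^{\ell-1}.$$ For an interpolant $V$ on the primal grid, $\mathcal B^{*}V$ is defined near each dual vertex from the polynomial $\tilde V$ of the primal cell centered there by $$-\mathcal B^*V=2\sum_{\ell=1}^q\frac{(\Delta t/2)^{2\ell-1}}{(2\ell-1)!}W^\ell,\quad W^1=\Big(\sum_kA_k^T\partial_{x_k}-M^T\Big)\tilde V,\quad W^\ell=\Big(\sum_kA_k^T\partial_{x_k}-M^T\Big)\Big(\sum_kA_k\partial_{x_k}+M\Big)W^{\ell-1}.$$ (The notation reflects that $\mathcal I_m\mathcal B^*\mathcal I_m$ is regarded as the adjoint of $\mathcal I_m\mathcal B\mathcal I_m$ in the semi-inner product below.) The discrete evolution is $$V(\mathbf x,t_{n+1})-V(\mathbf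 x,t_n)=\mathcal I_m\mathcal B\mathcal I_mW(\mathbf x,t_{n+1/2}),\qquad W(\mathbf x,t_{n+1/2})-W(\mathbf x,t_{n-1/2})=-\mathcal I_m\mathcal B^*\mathcal I_mV(\mathbf x,t_n).$$ **HB seminorm.** $\langle f,g\rangle_m=\Big\langle\frac{\partial^{3m+3}f}{\partial x_1^{m+1}\partial x_2^{m+1}\partial x_3^{m+1}},\frac{\partial^{3m+3}g}{\partial x_1^{m+1}\partial x_2^{m+1}\partial x_3^{m+1}}\Big\rangle_{L^2(\mathbb T)}$ (summed over components), $|f|_m^2=\langle f,f\rangle_m$. *)

theory Defs
  imports "HOL-Analysis.Analysis"
begin

definition pd :: "3 \<Rightarrow> (real^3 \<Rightarrow> 'a) \<Rightarrow> real^3 \<Rightarrow> 'a::real_normed_vector" where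
  "pd k f x = vector_derivative (\<lambda>s. f (x + s *\<^sub>R axis k 1)) (at 0)"

definition mpd :: "nat \<Rightarrow> nat \<Rightarrow> nat \<Rightarrow> (real^3 \<Rightarrow> 'a) \<Rightarrow> real^3 \<Rightarrow> 'a::real_normed_vector" where
  "mpd a b c f = (pd 1 ^^ a) ((pd 2 ^^ b) ((pd 3 ^^ c) f))"

definition periodic :: "(real^3 \<Rightarrow> 'a) \<Rightarrow> bool" where
  "periodic f \<longleftrightarrow> (\<forall>x k. f (x + (2 * pi) *\<^sub>R axis k 1) = f x)"

text \<open>The torus is represented by \<open>2\<pi>\<close>-periodic functions on the whole space, so a grid is
  infinite: it is given by the position \<open>p\<close> of one vertex and the numbers \<open>N\<close> of cells per period.\<close>

definition spacing :: "nat^3 \<Rightarrow> real^3" where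
  "spacing N = (\<chi> k. 2 * pi / real (N $ k))"

definition vertex :: "real^3 \<Rightarrow> nat^3 \<Rightarrow> int^3 \<Rightarrow> real^3" where
  "vertex p N j = (\<chi> k. p $ k + of_int (j $ k) * spacing N $ k)"

definition cell :: "real^3 \<Rightarrow> nat^3 \<Rightarrow> int^3 \<Rightarrow> (real^3) set" where
  "cell p N j = cbox (vertex p N j) (vertex p N (\<chi> k. j $ k + 1))"

definition corners :: "int^3 \<Rightarrow> (int^3) set" where
  "corners j = {i. \<forall>k. i $ k = j $ k \<or> i $ k = j $ k + 1}"

definition dual :: "real^3 \<Rightarrow> nat^3 \<Rightarrow> real^3" where
  "dual p N = p + (1/2) *\<^sub>R spacing N"

definition tensor_poly :: "nat \<Rightarrow> (real^3 \<Rightarrow> 'a::real_normed_vector) \<Rightarrow> bool" where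
  "tensor_poly d f \<longleftrightarrow> (\<exists>c. \<forall>x. f x =
     (\<Sum>i\<le>d. \<Sum>j\<le>d. \<Sum>k\<le>d. (x $ 1 ^ i * x $ 2 ^ j * x $ 3 ^ k) *\<^sub>R c i j k))"

text \<open>The cells are closed, so uniqueness of \<open>g\<close> is clear and existence includes
  the agreement of neighbouring polynomials on common faces. Only the values of the derivatives of
  \<open>f\<close> at the vertices enter.\<close>

definition interpolates ::
  "nat \<Rightarrow> real^3 \<Rightarrow> nat^3 \<Rightarrow> (real^3 \<Rightarrow> 'a) \<Rightarrow> (real^3 \<Rightarrow> 'a::real_normed_vector) \<Rightarrow> bool" where
  "interpolates m p N f g \<longleftrightarrow> (\<forall>j. \<exists>u. tensor_poly (2 * m + 1) u
     \<and> (\<forall>x\<in>cell p N j. g x = u x)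
     \<and> (\<forall>i\<in>corners j. \<forall>a\<le>m. \<forall>b\<le>m. \<forall>c\<le>m.
           mpd a b c u (vertex p N i) = mpd a b c f (vertex p N i)))"

definition HB ::
  "nat \<Rightarrow> real^3 \<Rightarrow> nat^3 \<Rightarrow> (real^3 \<Rightarrow> 'a) \<Rightarrow> real^3 \<Rightarrow> 'a::real_normed_vector" where
  "HB m p N f = (THE g. interpolates m p N f g)"

definition HB_space ::
  "nat \<Rightarrow> real^3 \<Rightarrow> nat^3 \<Rightarrow> (real^3 \<Rightarrow> 'a::real_normed_vector) set" where
  "HB_space m p N = HB m p N ` {f. periodic f}"

record sellmeier =
  permittivity :: real
  permeability :: real
  Ne :: nat
  Nm :: nat
  \<omega>e :: "nat \<Rightarrow> real"
  \<Omega>e :: "nat \<Rightarrow> real"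
  \<omega>m :: "nat \<Rightarrow> real"
  \<Omega>m :: "nat \<Rightarrow> real"

definition light_speed :: "sellmeier \<Rightarrow> real" where
  "light_speed P = (permittivity P * permeability P) powr (-1/2)"

text \<open>Labels of the 3-vectors making up a state. The ranges of the indices differ for \<open>V\<close> and \<open>W\<close>.\<close>

datatype block = B1 | B2 nat | B3 nat

type_synonym field = "block \<Rightarrow> real^3 \<Rightarrow> real^3"

definition V_blocks :: "sellmeier \<Rightarrow> block set" where
  "V_blocks P = {B1} \<union> B2 ` {1..Ne P} \<union> B3 ` {1..Nm P}"

definition W_blocks :: "sellmeier \<Rightarrow> block set" where
  "W_blocks P = {B1} \<union> B2 ` {1..Nm P} \<union> B3 ` {1..Ne P}"

text \<open>Matrices from \<open>W\<close>-states to \<open>V\<close>-states are given by their 3 by 3 blocks, the first label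
  being the row. The curl is \<open>\<Sum>\<^sub>k e\<^sub>k \<times> \<partial>\<^sub>k\<close>.\<close>

definition A_mat :: "sellmeier \<Rightarrow> 3 \<Rightarrow> block \<Rightarrow> block \<Rightarrow> real^3^3" where
  "A_mat P k a b =
     (if a = B1 \<and> b = B1 then light_speed P *\<^sub>R matrix (cross3 (axis k 1)) else 0)"

fun M_coef :: "sellmeier \<Rightarrow> block \<Rightarrow> block \<Rightarrow> real" where
  "M_coef P B1 (B3 j) = - \<omega>e P j"
| "M_coef P (B2 i) (B3 j) = (if i = j then \<Omega>e P j else 0)"
| "M_coef P (B3 i) B1 = \<omega>m P i"
| "M_coef P (B3 i) (B2 j) = (if i = j then - \<Omega>m P j else 0)"
| "M_coef P _ _ = 0"

definition M_mat :: "sellmeier \<Rightarrow> block \<Rightarrow> block \<Rightarrow> real^3^3" where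
  "M_mat P a b = mat (M_coef P a b)"

text \<open>\<open>op_W\<close> is \<open>\<Sum>\<^sub>k A\<^sub>k \<partial>\<^sub>k + M\<close> and \<open>op_V\<close> is \<open>\<Sum>\<^sub>k A\<^sub>k\<^sup>T \<partial>\<^sub>k - M\<^sup>T\<close>.\<close>

definition op_W :: "sellmeier \<Rightarrow> field \<Rightarrow> field" where
  "op_W P w a x = (\<Sum>b\<in>W_blocks P.
     (\<Sum>k\<in>UNIV. A_mat P k a b *v pd k (w b) x) + M_mat P a b *v w b x)"

definition op_V :: "sellmeier \<Rightarrow> field \<Rightarrow> field" where
  "op_V P v b x = (\<Sum>a\<in>V_blocks P.
     (\<Sum>k\<in>UNIV. transpose (A_mat P k a b) *v pd k (v a) x) - transpose (M_mat P a b) *v v a x)"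

definition curl :: "(real^3 \<Rightarrow> real^3) \<Rightarrow> real^3 \<Rightarrow> real^3" where
  "curl f x = vector [pd 2 f x $ 3 - pd 3 f x $ 2, pd 3 f x $ 1 - pd 1 f x $ 3,
                      pd 1 f x $ 2 - pd 2 f x $ 1]"

lemma transpose_A_mat: "transpose (A_mat P k a b) = - A_mat P k a b"
  by (simp add: A_mat_def vec_eq_iff transpose_def matrix_def forall_3 cross3_simps axis_def)

lemma A_mat_curl:
  "(\<Sum>k\<in>UNIV. A_mat P k B1 B1 *v pd k f x) = light_speed P *\<^sub>R curl f x"
  by (simp add: A_mat_def curl_def vec_eq_iff matrix_def matrix_vector_mult_def forall_3 sum_3
      cross3_simps axis_def algebra_simps)

lemma mat_vector_mult: "mat r *v (x::real^3) = r *\<^sub>R x"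
  by (simp add: vec_eq_iff forall_3 mat_def matrix_vector_mult_def sum_3)

lemma matrix_vector_mult_minus: "(- A) *v (x::real^3) = - (A *v x)" for A :: "real^3^3"
  by (simp add: vec_eq_iff matrix_vector_mult_def sum_negf)

lemma transpose_M_mat: "transpose (M_mat P a b) = M_mat P a b"
  by (simp add: M_mat_def)

lemma sum_W_blocks:
  "(\<Sum>b\<in>W_blocks P. g b) = g B1 + (\<Sum>j=1..Nm P. g (B2 j)) + (\<Sum>j=1..Ne P. g (B3 j))"
  for g :: "block \<Rightarrow> 'a::comm_monoid_add"
proof -
  have "sum g (W_blocks P) = sum g ({B1} \<union> B2 ` {1..Nm P}) + sum g (B3 ` {1..Ne P})"
    unfolding W_blocks_def by (rule sum.union_disjoint) auto
  also have "sum g ({B1} \<union> B2 ` {1..Nm P}) = sum g {B1} + sum g (B2 ` {1..Nm P})"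
    by (rule sum.union_disjoint) auto
  finally show ?thesis by (simp add: sum.reindex inj_on_def)
qed

lemma sum_V_blocks:
  "(\<Sum>a\<in>V_blocks P. g a) = g B1 + (\<Sum>j=1..Ne P. g (B2 j)) + (\<Sum>j=1..Nm P. g (B3 j))"
  for g :: "block \<Rightarrow> 'a::comm_monoid_add"
proof -
  have "sum g (V_blocks P) = sum g ({B1} \<union> B2 ` {1..Ne P}) + sum g (B3 ` {1..Nm P})"
    unfolding V_blocks_def by (rule sum.union_disjoint) auto
  also have "sum g ({B1} \<union> B2 ` {1..Ne P}) = sum g {B1} + sum g (B2 ` {1..Ne P})"
    by (rule sum.union_disjoint) auto
  finally show ?thesis by (simp add: sum.reindex inj_on_def)
qed

lemma op_W_blocks:
  "op_W P w B1 x = light_speed P *\<^sub>R curl (w B1) x - (\<Sum>j=1..Ne P. \<omega>e P j *\<^sub>R w (B3 j) x)"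
  "j \<in> {1..Ne P} \<Longrightarrow> op_W P w (B2 j) x = \<Omega>e P j *\<^sub>R w (B3 j) x"
  "j \<in> {1..Nm P} \<Longrightarrow> op_W P w (B3 j) x = \<omega>m P j *\<^sub>R w B1 x - \<Omega>m P j *\<^sub>R w (B2 j) x"
  unfolding op_W_def sum_W_blocks
  by (simp_all add: A_mat_curl)
     (simp_all add: A_mat_def M_mat_def mat_vector_mult sum_negf if_distribR if_distrib[of "\<lambda>r. r *\<^sub>R _"]
       sum.delta' cong: if_cong)

lemma op_V_blocks:
  "op_V P v B1 x = - (light_speed P *\<^sub>R curl (v B1) x) - (\<Sum>j=1..Nm P. \<omega>m P j *\<^sub>R v (B3 j) x)"
  "j \<in> {1..Nm P} \<Longrightarrow> op_V P v (B2 j) x = \<Omega>m P j *\<^sub>R v (B3 j) x"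
  "j \<in> {1..Ne P} \<Longrightarrow> op_V P v (B3 j) x = \<omega>e P j *\<^sub>R v B1 x - \<Omega>e P j *\<^sub>R v (B2 j) x"
  unfolding op_V_def sum_V_blocks transpose_A_mat transpose_M_mat
  by (simp_all add: matrix_vector_mult_minus sum_negf A_mat_curl)
     (simp_all add: A_mat_def M_mat_def mat_vector_mult sum_negf if_distribR
       if_distrib[of "\<lambda>r. r *\<^sub>R _"] cong: if_cong)

definition HB_field :: "nat \<Rightarrow> real^3 \<Rightarrow> nat^3 \<Rightarrow> field \<Rightarrow> field" where
  "HB_field m p N F = (\<lambda>a. HB m p N (F a))"

text \<open>The scheme applies these operators to the polynomial of a dual (primal) cell, near the centre
  of that cell. Here the piecewise polynomial itself is differentiated, which is the same
  in the interior of the cells; the values on the cell boundaries are never used.\<close>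

definition evol_B :: "sellmeier \<Rightarrow> real \<Rightarrow> nat \<Rightarrow> field \<Rightarrow> field" where
  "evol_B P dt q W = (\<lambda>a x. 2 *\<^sub>R (\<Sum>l=1..q. ((dt/2) ^ (2*l-1) / fact (2*l-1)) *\<^sub>R
      ((\<lambda>F. op_W P (op_V P F)) ^^ (l-1)) (op_W P W) a x))"

definition evol_Bstar :: "sellmeier \<Rightarrow> real \<Rightarrow> nat \<Rightarrow> field \<Rightarrow> field" where
  "evol_Bstar P dt q V = (\<lambda>b x. - (2 *\<^sub>R (\<Sum>l=1..q. ((dt/2) ^ (2*l-1) / fact (2*l-1)) *\<^sub>R
      ((\<lambda>F. op_V P (op_W P F)) ^^ (l-1)) (op_V P V) b x)))"

text \<open>The mixed derivative of an interpolant may fail to exist on the faces of the cells. This is a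
  null set, which is immaterial for the completed Lebesgue measure.\<close>

definition HB_inner :: "nat \<Rightarrow> block set \<Rightarrow> field \<Rightarrow> field \<Rightarrow> real" where
  "HB_inner m S F G = (\<Sum>a\<in>S. LINT x : cbox 0 (vec (2 * pi)) | lebesgue.
      mpd (m+1) (m+1) (m+1) (F a) x \<bullet> mpd (m+1) (m+1) (m+1) (G a) x)"

definition HB_norm :: "nat \<Rightarrow> block set \<Rightarrow> field \<Rightarrow> real" where
  "HB_norm m S F = sqrt (HB_inner m S F F)"

end

theory Submission
  imports Defs
begin


text \<open>Write \<open>\<langle>\<cdot>,\<cdot>\<rangle>\<close> for the semi-inner product of order \<open>m\<close>, \<open>S\<close> for Taylor evolution followed by interpolation
  on the primal grid, and \<open>T\<close> for its counterpart on the dual grid. The scheme is the leapfrog iteration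
  \<open>V\<^sub>n\<^sub>+\<^sub>1 - V\<^sub>n = S W\<^sub>n\<^sub>+\<^sub>1\<close>, \<open>W\<^sub>n\<^sub>+\<^sub>1 - W\<^sub>n = - T V\<^sub>n\<close>, where \<open>W\<^sub>n\<close> stands at time \<open>(n - 1/2) dt\<close>.
  If \<open>T\<close> is adjoint to \<open>S\<close>, then \<open>|V\<^sub>n|\<^sup>2 + \<langle>W\<^sub>n\<^sub>+\<^sub>1, W\<^sub>n\<rangle>\<close> and \<open>|W\<^sub>n\<^sub>+\<^sub>1|\<^sup>2 + \<langle>V\<^sub>n, V\<^sub>n\<^sub>+\<^sub>1\<rangle>\<close> do not change
  with \<open>n\<close>, and polarization (\<open>HB_norm_polarize\<close>) turns them into the two quantities of the theorem.
  So everything rests on the adjointness \<open>\<langle>V, S W\<rangle> = \<langle>T V, W\<rangle>\<close>, which is \<open>HB_inner_adjoint\<close>.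

  The reason for adjointness is already visible in one variable. For polynomials of degree at most
  \<open>n = 2m+1\<close> the expression \<open>\<Sum>k\<le>n. (-1)^k p\<^bsup>(k)\<^esup> q\<^bsup>(n-k)\<^esup>\<close> has derivative zero (\<open>pderiv_concomitant\<close>), so it is
  a bilinear form that does not depend on the point, and differentiation is skew with respect to it.
  Integrating by parts on the cells, \<open>\<langle>V, F\<rangle>\<close> becomes a sum over vertices of products of the jumps of the
  derivatives of \<open>V\<close> of order above \<open>m\<close> with the derivatives of \<open>F\<close> of order at most \<open>m\<close>. Since the
  derivatives of \<open>V\<close> up to order \<open>m\<close> do not jump, this sum is, up to sign, the invariant form applied to
  the jump of the polynomials of \<open>V\<close> and to any polynomial with the vertex data of \<open>F\<close>
  (\<open>period_inner_HB\<close>). For \<open>F = S W\<close> such a polynomial is the evolution operator applied to the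
  polynomial of \<open>W\<close> on the dual cell around the vertex. The skewness of differentiation moves the
  operator to \<open>V\<close> (\<open>concomitant3_evol\<close>), and summation by parts over the periodic grid moves the jump to
  \<open>W\<close>. The result is the same expression for \<open>\<langle>T V, W\<rangle>\<close>.

  In three variables the form is the tensor product of the one-dimensional ones, and bilinear
  identities are checked on products of univariate polynomials. It also has to be known that
  interpolants exist, are unique, and reproduce themselves under interpolation (\<open>HB_idem\<close>). The last point
  holds because neighbouring cell polynomials agree on the common face together with their normal
  derivatives up to order \<open>m\<close> and all tangential derivatives of these (\<open>mderiv_cell_poly_neighbour\<close>);
  the same fact makes the low derivatives free of jumps.\<close>

section \<open>Hermite interpolation in one variable\<close>

text \<open>Each differentiation lowers the multiplicity of the root by one.\<close>

lemma higher_pderiv_root_power: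
  fixes a :: real
  assumes "i \<le> n"
  shows "poly ((pderiv ^^ i) ([:- a, 1:] ^ n * r)) a = (if i = n then fact n * poly r a else 0)"
  using assms
proof (induction i arbitrary: n r)
  case 0
  then show ?case by (cases n) (auto simp: poly_mult poly_power)
next
  case (Suc i)
  then obtain n' where n: "n = Suc n'" and "i \<le> n'" by (cases n) auto
  have "pderiv ([:- a, 1:] ^ n * r) = [:- a, 1:] ^ n' * (smult (of_nat n) r + [:- a, 1:] * pderiv r)"
  proof -
    define X where "X = [:- a, 1:]"
    have "pderiv X = 1" by (simp add: X_def pderiv_pCons)
    then have "pderiv (X ^ n * r) = X ^ n' * (smult (of_nat n) r + X * pderiv r)"
      by (simp add: n pderiv_mult pderiv_power_Suc algebra_simps del: of_nat_Suc power_Suc)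
         (simp add: algebra_simps)
    then show ?thesis by (simp add: X_def)
  qed
  then have "(pderiv ^^ Suc i) ([:- a, 1:] ^ n * r)
      = (pderiv ^^ i) ([:- a, 1:] ^ n' * (smult (of_nat n) r + [:- a, 1:] * pderiv r))"
    by (simp only: funpow_Suc_right o_apply)
  then show ?case using Suc.IH[OF \<open>i \<le> n'\<close>, of "smult (of_nat n) r + [:- a, 1:] * pderiv r"]
    by (auto simp: n)
qed

lemma order_gt_of_higher_pderiv_zero:
  fixes p :: "real poly"
  assumes "p \<noteq> 0" "\<And>j. j \<le> m \<Longrightarrow> poly ((pderiv ^^ j) p) a = 0"
  shows "m < order a p"
  using assms
proof (induction m arbitrary: p)
  case 0
  then show ?case using order_root[of p a] by auto
next
  case (Suc m)
  have root: "poly p a = 0" using Suc.prems(2)[of 0] by simp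
  have "pderiv p \<noteq> 0"
  proof
    assume "pderiv p = 0"
    then obtain c where "p = [:c:]" by (metis degree_eq_zeroE pderiv_eq_0_iff)
    with root Suc.prems(1) show False by simp
  qed
  moreover have "poly ((pderiv ^^ j) (pderiv p)) a = 0" if "j \<le> m" for j
    using Suc.prems(2)[of "Suc j"] that by (simp only: funpow_Suc_right o_apply)
  ultimately have "m < order a (pderiv p)" using Suc.IH by blast
  moreover have "order a p = Suc (order a (pderiv p))"
    using order_pderiv2[OF \<open>pderiv p \<noteq> 0\<close>] root Suc.prems(1) by (metis order_root)
  ultimately show ?case by simp
qed

text \<open>The two zeros would have total multiplicity \<open>2 * m + 2\<close>, which exceeds the degree.\<close>

lemma hermite_interpolation_unique:
  fixes p :: "real poly"
  assumes "a \<noteq> b" "degree p \<le> 2 * m + 1"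
    and "\<And>j. j \<le> m \<Longrightarrow> poly ((pderiv ^^ j) p) a = 0"
    and "\<And>j. j \<le> m \<Longrightarrow> poly ((pderiv ^^ j) p) b = 0"
  shows "p = 0"
proof (rule ccontr)
  assume p: "p \<noteq> 0"
  have oa: "m < order a p" "m < order b p"
    using order_gt_of_higher_pderiv_zero[OF p] assms(3,4) by blast+
  have "poly p a = 0" "poly p b = 0" using assms(3)[of 0] assms(4)[of 0] by auto
  then have "(\<Sum>x\<in>{a, b}. order x p) \<le> (\<Sum>x\<in>{x. poly p x = 0}. order x p)"
    by (intro sum_mono2) (auto simp: poly_roots_finite[OF p])
  also have "\<dots> \<le> degree p" using sum_order_le_degree[OF p] .
  finally show False using oa assms(1,2) by simp
qed

text \<open>Newton's triangular scheme: a multiple of \<open>(x - a)^k\<close>, and after these of \<open>(x - a)^(m+1) (x - b)^l\<close>,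
  adjusts one more derivative without disturbing those already prescribed.\<close>

lemma hermite_interpolation_exists:
  fixes a b :: real
  assumes "a \<noteq> b"
  shows "\<exists>p. degree p \<le> 2 * m + 1
    \<and> (\<forall>j\<le>m. poly ((pderiv ^^ j) p) a = \<alpha> j) \<and> (\<forall>j\<le>m. poly ((pderiv ^^ j) p) b = \<beta> j)"
proof -
  have A: "\<exists>p. degree p \<le> k - 1 \<and> (\<forall>j<k. poly ((pderiv ^^ j) p) a = \<alpha> j)" for k
  proof (induction k)
    case 0
    show ?case by (rule exI[of _ 0]) auto
  next
    case (Suc k)
    then obtain p where p: "degree p \<le> k - 1" "\<forall>j<k. poly ((pderiv ^^ j) p) a = \<alpha> j" by blast
    define r where "r = p + smult ((\<alpha> k - poly ((pderiv ^^ k) p) a) / fact k) ([:- a, 1:] ^ k)"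
    have "degree r \<le> Suc k - 1"
      unfolding r_def using p(1)
      by (intro degree_add_le order_trans[OF degree_smult_le]) (auto simp: degree_linear_power)
    moreover have "poly ((pderiv ^^ j) r) a = \<alpha> j" if "j < Suc k" for j
      using higher_pderiv_root_power[of j k a 1] that p(2)
      by (auto simp: r_def higher_pderiv_add higher_pderiv_smult)
    ultimately show ?case by blast
  qed
  \<comment> \<open>The data at \<open>a\<close> are complete; now those at \<open>b\<close> are added one by one.\<close>
  have "\<exists>p. degree p \<le> m + l \<and> (\<forall>j\<le>m. poly ((pderiv ^^ j) p) a = \<alpha> j)
        \<and> (\<forall>j<l. poly ((pderiv ^^ j) p) b = \<beta> j)" for l
  proof (induction l)
    case 0
    show ?case using A[of "Suc m"] by (auto simp: less_Suc_eq_le)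
  next
    case (Suc l)
    then obtain p where p: "degree p \<le> m + l" "\<forall>j\<le>m. poly ((pderiv ^^ j) p) a = \<alpha> j"
      "\<forall>j<l. poly ((pderiv ^^ j) p) b = \<beta> j" by blast
    define c where "c = (\<beta> l - poly ((pderiv ^^ l) p) b) / (fact l * (b - a) ^ Suc m)"
    define r where "r = p + smult c ([:- a, 1:] ^ Suc m * [:- b, 1:] ^ l)"
    have "degree r \<le> m + Suc l"
      unfolding r_def using p(1)
      by (intro degree_add_le order_trans[OF degree_smult_le] order_trans[OF degree_mult_le])
         (auto simp: degree_linear_power simp del: power_Suc)
    moreover have "poly ((pderiv ^^ j) r) a = \<alpha> j" if "j \<le> m" for j
      using higher_pderiv_root_power[of j "Suc m" a "[:- b, 1:] ^ l"] that p(2)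
      by (auto simp: r_def higher_pderiv_add higher_pderiv_smult simp del: power_Suc)
    moreover have "poly ((pderiv ^^ j) r) b = \<beta> j" if "j < Suc l" for j
      using higher_pderiv_root_power[of j l b "[:- a, 1:] ^ Suc m"] that p(3) assms
      by (auto simp: r_def c_def higher_pderiv_add higher_pderiv_smult mult.commute[of "[:- a, 1:] ^ Suc m"] poly_power
          simp del: power_Suc)
    ultimately show ?case by blast
  qed
  from this[of "Suc m"] show ?thesis by (simp add: less_Suc_eq_le mult_2)
qed

text \<open>The basis function that carries the \<open>k\<close>-th derivative at the endpoint \<open>a\<close>; exchanging \<open>a\<close> and \<open>b\<close> gives
  those of the other endpoint.\<close>

definition hermite_basis :: "nat \<Rightarrow> real \<Rightarrow> real \<Rightarrow> nat \<Rightarrow> real poly" where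
  "hermite_basis m a b k = (SOME p. degree p \<le> 2 * m + 1
     \<and> (\<forall>j\<le>m. poly ((pderiv ^^ j) p) a = of_bool (j = k)) \<and> (\<forall>j\<le>m. poly ((pderiv ^^ j) p) b = 0))"

lemma
  assumes "a \<noteq> b"
  shows degree_hermite_basis: "degree (hermite_basis m a b k) \<le> 2 * m + 1"
    and hermite_basis_near: "j \<le> m \<Longrightarrow> poly ((pderiv ^^ j) (hermite_basis m a b k)) a = of_bool (j = k)"
    and hermite_basis_far: "j \<le> m \<Longrightarrow> poly ((pderiv ^^ j) (hermite_basis m a b k)) b = 0"
  using someI_ex[OF hermite_interpolation_exists[OF assms, of m "\<lambda>j. of_bool (j = k)" "\<lambda>_. 0"]]
  unfolding hermite_basis_def[symmetric] by blast+

lemma higher_pderiv_diff: "(pderiv ^^ n) (p - q) = (pderiv ^^ n) p - (pderiv ^^ n) q"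
  for p q :: "real poly"
  by (induction n arbitrary: p q) (simp_all del: funpow.simps add: funpow_Suc_right pderiv_diff)

lemma hermite_basis_reproduces:
  fixes p :: "real poly"
  assumes "a \<noteq> b" "degree p \<le> 2 * m + 1"
  shows "p = (\<Sum>k\<le>m. smult (poly ((pderiv ^^ k) p) a) (hermite_basis m a b k))
           + (\<Sum>k\<le>m. smult (poly ((pderiv ^^ k) p) b) (hermite_basis m b a k))" (is "p = ?q")
proof -
  have "p - ?q = 0"
  proof (rule hermite_interpolation_unique[OF assms(1)])
    show "degree (p - ?q) \<le> 2 * m + 1"
      using assms
      by (intro degree_diff_le degree_add_le degree_sum_le order_trans[OF degree_smult_le])
         (use degree_hermite_basis[of a b] degree_hermite_basis[of b a] in auto)
  qed (use assms(1) in \<open>auto simp: higher_pderiv_add higher_pderiv_diff higher_pderiv_sum higher_pderiv_smult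
        poly_sum hermite_basis_near hermite_basis_far of_bool_def if_distrib sum.delta cong: if_cong\<close>)
  then show ?thesis by simp
qed


section \<open>The bilinear concomitant\<close>

text \<open>The boundary terms of repeated integration by parts. Two instances matter: for \<open>a = m + 1\<close> and \<open>n = m\<close>
  it is an antiderivative of the product of the \<open>(m+1)\<close>-st derivatives, and for \<open>a = 0\<close> and \<open>n = 2 * m + 1\<close>
  it is constant, both for polynomials of degree at most \<open>2 * m + 1\<close>. The first has the summands of the second with
  \<open>k > m\<close>, up to sign.\<close>

definition concomitant :: "nat \<Rightarrow> nat \<Rightarrow> real poly \<Rightarrow> real poly \<Rightarrow> real poly" where
  "concomitant a n p q = (\<Sum>k\<le>n. smult ((-1) ^ k) ((pderiv ^^ (a + k)) p * (pderiv ^^ (n - k)) q))"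

lemma pderiv_concomitant_expand:
  "pderiv (concomitant a n p q) = concomitant a n (pderiv p) q + concomitant a n p (pderiv q)"
  unfolding concomitant_def higher_pderiv_sum[of 1, simplified] sum.distrib[symmetric]
  by (intro sum.cong refl) (simp add: pderiv_smult pderiv_mult funpow_swap1 smult_add_right add.commute mult.commute)

text \<open>By the Leibniz rule each summand contributes two neighbouring terms of a telescoping sum.\<close>

lemma pderiv_concomitant:
  "pderiv (concomitant a n p q)
   = (pderiv ^^ a) p * (pderiv ^^ Suc n) q - smult ((-1) ^ Suc n) ((pderiv ^^ (a + Suc n)) p * q)"
proof -
  define T where "T k = smult ((-1) ^ k) ((pderiv ^^ (a + k)) p * (pderiv ^^ (Suc n - k)) q)" for k
  have "pderiv (concomitant a n p q)
      = (\<Sum>k\<le>n. pderiv (smult ((-1) ^ k) ((pderiv ^^ (a + k)) p * (pderiv ^^ (n - k)) q)))"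
    unfolding concomitant_def higher_pderiv_sum[of 1, simplified] ..
  also have "\<dots> = (\<Sum>k\<le>n. T k - T (Suc k))"
    by (intro sum.cong refl)
       (simp add: T_def pderiv_smult pderiv_mult Suc_diff_le smult_add_right mult.commute)
  also have "\<dots> = T 0 - T (Suc n)" by (rule sum_telescope)
  finally show ?thesis by (simp add: T_def)
qed

lemma higher_pderiv_eq_0: "degree p < n \<Longrightarrow> (pderiv ^^ n) p = 0" for p :: "real poly"
proof (induction n arbitrary: p)
  case (Suc n)
  show ?case
  proof (cases "degree p = 0")
    case True
    then have "pderiv p = 0" by (simp add: pderiv_eq_0_iff)
    then show ?thesis by (simp add: funpow_Suc_right del: funpow.simps)
  next
    case False
    then show ?thesis using Suc by (simp add: funpow_Suc_right degree_pderiv del: funpow.simps)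
  qed
qed simp

text \<open>Both end terms of the telescoping sum contain a derivative of order \<open>n + 1\<close>, hence vanish.\<close>

lemma concomitant_const:
  assumes "degree p \<le> n" "degree q \<le> n"
  shows "poly (concomitant 0 n p q) s = poly (concomitant 0 n p q) t"
proof -
  have "pderiv (concomitant 0 n p q) = 0"
    using assms by (simp add: pderiv_concomitant higher_pderiv_eq_0 del: funpow.simps)
  then obtain c where "concomitant 0 n p q = [:c:]" by (metis degree_eq_zeroE pderiv_eq_0_iff)
  then show ?thesis by simp
qed

text \<open>Expand the vanishing derivative of the concomitant by the Leibniz rule.\<close>

lemma concomitant_pderiv:
  assumes "degree p \<le> n" "degree q \<le> n"
  shows "concomitant 0 n (pderiv p) q = - concomitant 0 n p (pderiv q)"
  using pderiv_concomitant[of 0 n p q] pderiv_concomitant_expand[of 0 n p q] assms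
  by (simp add: higher_pderiv_eq_0 add_eq_0_iff2 del: funpow.simps)

text \<open>The second end term contains the derivative of \<open>p\<close> of order \<open>2 * m + 2\<close>, which vanishes.\<close>

lemma integral_higher_pderiv:
  fixes p q :: "real poly"
  assumes "degree p \<le> 2 * m + 1" "a \<le> b"
  shows "integral {a..b} (\<lambda>t. poly ((pderiv ^^ (m + 1)) p) t * poly ((pderiv ^^ (m + 1)) q) t)
       = poly (concomitant (m + 1) m p q) b - poly (concomitant (m + 1) m p q) a"
proof (rule integral_unique, rule fundamental_theorem_of_calculus[OF assms(2)])
  fix t
  have "pderiv (concomitant (m + 1) m p q) = (pderiv ^^ (m + 1)) p * (pderiv ^^ (m + 1)) q"
    using assms(1) by (simp add: pderiv_concomitant higher_pderiv_eq_0 del: funpow.simps)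
  then show "(poly (concomitant (m + 1) m p q) has_vector_derivative
      poly ((pderiv ^^ (m + 1)) p) t * poly ((pderiv ^^ (m + 1)) q) t) (at t within {a..b})"
    using poly_DERIV[of "concomitant (m + 1) m p q" t]
    by (auto simp: has_real_derivative_iff_has_vector_derivative
        intro: has_vector_derivative_at_within simp del: funpow.simps)
qed


section \<open>Tensor-product polynomials and their derivatives\<close>

lemma axis_nth_if: "axis k (1::real) $ l = (if l = k then 1 else 0)"
  unfolding axis_def by simp

lemma prod_3: "(\<Prod>k\<in>UNIV. f k) = f 1 * (f 2 * f 3)" for f :: "3 \<Rightarrow> real"
  unfolding UNIV_3 by simp

text \<open>Products of univariate polynomials span the tensor-product polynomials, and mixed derivatives and
  bilinear forms factor on them into one-dimensional ones.\<close>

definition tensor :: "(3 \<Rightarrow> real poly) \<Rightarrow> 'a \<Rightarrow> real^3 \<Rightarrow> 'a::real_normed_vector" where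
  "tensor p c x = (\<Prod>k\<in>UNIV. poly (p k) (x $ k)) *\<^sub>R c"

text \<open>The orders are collected in one multi-index, so that the three directions can be treated alike.\<close>

definition mderiv :: "(3 \<Rightarrow> nat) \<Rightarrow> (real^3 \<Rightarrow> 'a) \<Rightarrow> real^3 \<Rightarrow> 'a::real_normed_vector" where
  "mderiv \<alpha> f = mpd (\<alpha> 1) (\<alpha> 2) (\<alpha> 3) f"

lemma tensor_has_vector_derivative:
  "((\<lambda>s. tensor p c (x + s *\<^sub>R axis k 1)) has_vector_derivative tensor (p(k := pderiv (p k))) c x) (at 0)"
proof -
  define R where "R = (\<Prod>l\<in>UNIV - {k}. poly (p l) (x $ l))"
  have prod: "(\<Prod>l\<in>UNIV. f l) = f k * (\<Prod>l\<in>UNIV - {k}. f l)" for f :: "3 \<Rightarrow> real"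
    by (subst prod.remove[of UNIV k]) auto
  have "tensor p c (x + s *\<^sub>R axis k 1) = (poly (p k) (x $ k + s) * R) *\<^sub>R c" for s
    unfolding tensor_def R_def by (subst prod) (auto simp: axis_nth_if intro!: arg_cong2[of _ _ _ _ scaleR] prod.cong)
  moreover have "tensor (p(k := pderiv (p k))) c x = (poly (pderiv (p k)) (x $ k) * R) *\<^sub>R c"
    unfolding tensor_def R_def by (subst prod) (auto intro!: arg_cong2[of _ _ _ _ scaleR] prod.cong)
  moreover have "((\<lambda>s. (poly (p k) (x $ k + s) * R) *\<^sub>R c) has_vector_derivative
      (poly (pderiv (p k)) (x $ k) * R) *\<^sub>R c) (at 0)"
    by (auto intro!: derivative_eq_intros has_vector_derivative_scaleR)
  ultimately show ?thesis by simp
qed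

lemma pd_tensor: "pd k (tensor p c) = tensor (p(k := pderiv (p k))) c"
proof
  fix x
  show "pd k (tensor p c) x = tensor (p(k := pderiv (p k))) c x"
    unfolding pd_def using tensor_has_vector_derivative[of p c x k] by (rule vector_derivative_at)
qed

lemma pd_pow_tensor: "(pd k ^^ n) (tensor p c) = tensor (p(k := (pderiv ^^ n) (p k))) c"
  by (induction n) (simp_all add: pd_tensor fun_upd_def cong: if_cong)

lemma mderiv_tensor: "mderiv \<alpha> (tensor p c) = tensor (\<lambda>k. (pderiv ^^ \<alpha> k) (p k)) c"
proof -
  have "mderiv \<alpha> (tensor p c) = tensor (p(3 := (pderiv ^^ \<alpha> 3) (p 3), 2 := (pderiv ^^ \<alpha> 2) (p 2),
      1 := (pderiv ^^ \<alpha> 1) (p 1))) c"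
    by (simp add: mderiv_def mpd_def pd_pow_tensor)
  moreover have "p(3 := (pderiv ^^ \<alpha> 3) (p 3), 2 := (pderiv ^^ \<alpha> 2) (p 2),
      1 := (pderiv ^^ \<alpha> 1) (p 1)) = (\<lambda>k. (pderiv ^^ \<alpha> k) (p k))"
    by (simp add: fun_eq_iff forall_3)
  ultimately show ?thesis by simp
qed

lemma tensor_poly_zero: "tensor_poly d (\<lambda>x. 0)"
  unfolding tensor_poly_def by (rule exI[of _ "\<lambda>_ _ _. 0"]) simp

lemma tensor_poly_add: "tensor_poly d f \<Longrightarrow> tensor_poly d g \<Longrightarrow> tensor_poly d (\<lambda>x. f x + g x)"
proof -
  assume "tensor_poly d f" "tensor_poly d g"
  then obtain c c' where
    "\<And>x. f x = (\<Sum>i\<le>d. \<Sum>j\<le>d. \<Sum>k\<le>d. (x $ 1 ^ i * x $ 2 ^ j * x $ 3 ^ k) *\<^sub>R c i j k)"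
    "\<And>x. g x = (\<Sum>i\<le>d. \<Sum>j\<le>d. \<Sum>k\<le>d. (x $ 1 ^ i * x $ 2 ^ j * x $ 3 ^ k) *\<^sub>R c' i j k)"
    unfolding tensor_poly_def by blast
  then show ?thesis unfolding tensor_poly_def
    by (intro exI[of _ "\<lambda>i j k. c i j k + c' i j k"]) (simp add: sum.distrib scaleR_right_distrib)
qed

lemma tensor_poly_sum: "(\<And>i. i \<in> I \<Longrightarrow> tensor_poly d (f i)) \<Longrightarrow> tensor_poly d (\<lambda>x. \<Sum>i\<in>I. f i x)"
  by (induction I rule: infinite_finite_induct) (auto intro: tensor_poly_zero tensor_poly_add)

lemma tensor_poly_bounded_linear:
  assumes "bounded_linear h" "tensor_poly d f"
  shows "tensor_poly d (\<lambda>x. h (f x))"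
proof -
  interpret bounded_linear h by fact
  obtain c where
    "\<And>x. f x = (\<Sum>i\<le>d. \<Sum>j\<le>d. \<Sum>k\<le>d. (x $ 1 ^ i * x $ 2 ^ j * x $ 3 ^ k) *\<^sub>R c i j k)"
    using assms(2) unfolding tensor_poly_def by blast
  then show ?thesis unfolding tensor_poly_def
    by (intro exI[of _ "\<lambda>i j k. h (c i j k)"]) (simp add: sum scaleR)
qed

lemma tensor_poly_tensor:
  assumes "\<And>k. degree (p k) \<le> d"
  shows "tensor_poly d (tensor p c)"
proof -
  have poly: "poly (p k) t = (\<Sum>i\<le>d. coeff (p k) i * t ^ i)" for k t
  proof -
    have "(\<Sum>i\<le>degree (p k). coeff (p k) i * t ^ i) = (\<Sum>i\<le>d. coeff (p k) i * t ^ i)"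
      by (rule sum.mono_neutral_left) (use assms in \<open>auto simp: coeff_eq_0 not_le\<close>)
    then show ?thesis by (simp add: poly_altdef)
  qed
  have triple: "(\<Sum>i\<le>d. f i) * ((\<Sum>j\<le>d. g j) * (\<Sum>k\<le>d. h k)) = (\<Sum>i\<le>d. \<Sum>j\<le>d. \<Sum>k\<le>d. f i * (g j * h k))"
    for f g h :: "nat \<Rightarrow> real"
    unfolding sum_distrib_right[of f] unfolding sum_distrib_right[of g] unfolding sum_distrib_left ..
  have eq: "tensor p c x = ((\<Sum>i\<le>d. coeff (p 1) i * x $ 1 ^ i) * ((\<Sum>j\<le>d. coeff (p 2) j * x $ 2 ^ j)
      * (\<Sum>k\<le>d. coeff (p 3) k * x $ 3 ^ k))) *\<^sub>R c" for x
    unfolding tensor_def prod_3 by (simp only: poly)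
  show ?thesis
    unfolding tensor_poly_def eq triple scaleR_sum_left
    by (intro exI[of _ "\<lambda>i j k. (coeff (p 1) i * coeff (p 2) j * coeff (p 3) k) *\<^sub>R c"] allI sum.cong refl)
       (simp only: scaleR_scaleR mult_ac)
qed

text \<open>Additive statements about tensor-product polynomials need to be checked on products of univariate
  polynomials only, because the monomials are such products.\<close>

lemma tensor_poly_induct [consumes 1, case_names add tensor]:
  assumes "tensor_poly d f"
    and add: "\<And>f g. tensor_poly d f \<Longrightarrow> tensor_poly d g \<Longrightarrow> P f \<Longrightarrow> P g \<Longrightarrow> P (\<lambda>x. f x + g x)"
    and tensor: "\<And>p c. (\<And>k. degree (p k) \<le> d) \<Longrightarrow> P (tensor p c)"
  shows "P f"
proof -
  obtain c where c:
    "\<And>x. f x = (\<Sum>i\<le>d. \<Sum>j\<le>d. \<Sum>k\<le>d. (x $ 1 ^ i * x $ 2 ^ j * x $ 3 ^ k) *\<^sub>R c i j k)"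
    using assms(1) unfolding tensor_poly_def by blast
  define p where "p i j k = (\<lambda>l::3. monom (1::real) (if l = 1 then i else if l = 2 then j else k))" for i j k
  have tensor_p: "(x $ 1 ^ i * x $ 2 ^ j * x $ 3 ^ k) *\<^sub>R c i j k = tensor (p i j k) (c i j k) x" for x i j k
    unfolding tensor_def prod_3 p_def by (simp add: poly_monom)
  let ?Q = "\<lambda>g. tensor_poly d g \<and> P g"
  have zero: "?Q (\<lambda>x. 0)"
    using tensor[of "\<lambda>_. 0" 0] tensor_poly_zero[of d] by (simp add: tensor_def[abs_def])
  have sum: "?Q (\<lambda>x. \<Sum>i\<in>I. g i x)" if "finite I" "\<And>i. i \<in> I \<Longrightarrow> ?Q (g i)" for I :: "nat set" and g
    using that
  proof (induction I rule: finite_induct)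
    case (insert i I)
    then have "?Q (g i)" "?Q (\<lambda>x. \<Sum>i\<in>I. g i x)" by blast+
    then have "?Q (\<lambda>x. g i x + (\<Sum>i\<in>I. g i x))" using add tensor_poly_add by blast
    then show ?case using insert.hyps by simp
  qed (use zero in simp)
  have "?Q (\<lambda>x. \<Sum>i\<le>d. \<Sum>j\<le>d. \<Sum>k\<le>d. tensor (p i j k) (c i j k) x)"
  proof (intro sum finite_atMost)
    fix i j k assume "i \<in> {..d}" "j \<in> {..d}" "k \<in> {..d}"
    then have "degree (p i j k l) \<le> d" for l by (auto simp: p_def intro: order_trans[OF degree_monom_le])
    then show "?Q (\<lambda>x. tensor (p i j k) (c i j k) x)" using tensor tensor_poly_tensor[of "p i j k"] by blast
  qed
  moreover have "f = (\<lambda>x. \<Sum>i\<le>d. \<Sum>j\<le>d. \<Sum>k\<le>d. tensor (p i j k) (c i j k) x)"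
    using c tensor_p by (simp add: fun_eq_iff)
  ultimately show ?thesis by simp
qed

lemma tensor_poly_has_vector_derivative:
  assumes "tensor_poly d f"
  shows "((\<lambda>s. f (x + s *\<^sub>R axis k 1)) has_vector_derivative pd k f x) (at 0)"
proof -
  have "\<exists>D. ((\<lambda>s. f (x + s *\<^sub>R axis k 1)) has_vector_derivative D) (at 0)"
    using assms
  proof (induction rule: tensor_poly_induct)
    case (add f g)
    then show ?case by (auto intro: has_vector_derivative_add)
  qed (use tensor_has_vector_derivative in blast)
  then show ?thesis unfolding pd_def by (metis vector_derivative_at)
qed

lemma pd_add:
  assumes "tensor_poly d f" "tensor_poly d g"
  shows "pd k (\<lambda>x. f x + g x) = (\<lambda>x. pd k f x + pd k g x)"
  unfolding pd_def[of _ "\<lambda>x. f x + g x"]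
  by (rule ext, rule vector_derivative_at, rule has_vector_derivative_add)
     (use assms tensor_poly_has_vector_derivative in blast)+

lemma pd_bounded_linear:
  assumes "bounded_linear h" "tensor_poly d f"
  shows "pd k (\<lambda>x. h (f x)) = (\<lambda>x. h (pd k f x))"
  unfolding pd_def[of _ "\<lambda>x. h (f x)"]
  by (rule ext, rule vector_derivative_at, rule bounded_linear.has_vector_derivative[OF assms(1)])
     (use assms(2) tensor_poly_has_vector_derivative in blast)

lemma tensor_poly_pd: "tensor_poly d f \<Longrightarrow> tensor_poly d (pd k f)"
proof (induction rule: tensor_poly_induct)
  case (add f g)
  then show ?case by (simp add: pd_add tensor_poly_add)
next
  case (tensor p c)
  then have "degree ((p(k := pderiv (p k))) l) \<le> d" for l
    by (auto simp: degree_pderiv intro: order_trans[OF diff_le_self])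
  then show ?case unfolding pd_tensor by (rule tensor_poly_tensor)
qed

lemma tensor_poly_pd_pow: "tensor_poly d f \<Longrightarrow> tensor_poly d ((pd k ^^ n) f)"
  by (induction n) (auto intro: tensor_poly_pd)

lemma tensor_poly_mderiv: "tensor_poly d f \<Longrightarrow> tensor_poly d (mderiv \<alpha> f)"
  by (simp add: mderiv_def mpd_def tensor_poly_pd_pow)

lemma pd_pow_add:
  assumes "tensor_poly d f" "tensor_poly d g"
  shows "(pd k ^^ n) (\<lambda>x. f x + g x) = (\<lambda>x. (pd k ^^ n) f x + (pd k ^^ n) g x)"
  by (induction n) (simp_all add: pd_add[OF tensor_poly_pd_pow tensor_poly_pd_pow, OF assms])

lemma mderiv_add:
  assumes "tensor_poly d f" "tensor_poly d g"
  shows "mderiv \<alpha> (\<lambda>x. f x + g x) = (\<lambda>x. mderiv \<alpha> f x + mderiv \<alpha> g x)"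
  using assms by (simp add: mderiv_def mpd_def pd_pow_add[where d = d] tensor_poly_pd_pow)

lemma pd_pow_bounded_linear:
  assumes "bounded_linear h" "tensor_poly d f"
  shows "(pd k ^^ n) (\<lambda>x. h (f x)) = (\<lambda>x. h ((pd k ^^ n) f x))"
  by (induction n) (simp_all add: pd_bounded_linear[OF assms(1) tensor_poly_pd_pow[OF assms(2)]])

lemma mderiv_bounded_linear:
  assumes "bounded_linear h" "tensor_poly d f"
  shows "mderiv \<alpha> (\<lambda>x. h (f x)) = (\<lambda>x. h (mderiv \<alpha> f x))"
  using assms by (simp add: mderiv_def mpd_def pd_pow_bounded_linear[OF assms(1), where d = d] tensor_poly_pd_pow)

lemma mderiv_zero: "mderiv \<alpha> (\<lambda>x. 0) = (\<lambda>x. 0 :: 'a::real_normed_vector)"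
proof -
  have "tensor (\<lambda>_. 0) (0::'a) = (\<lambda>x. 0)" by (simp add: tensor_def fun_eq_iff)
  then show ?thesis using mderiv_tensor[of \<alpha> "\<lambda>_. 0" "0::'a"] by (simp add: tensor_def[abs_def])
qed

lemma mderiv_sum:
  assumes "\<And>i. i \<in> I \<Longrightarrow> tensor_poly d (f i)"
  shows "mderiv \<alpha> (\<lambda>x. \<Sum>i\<in>I. f i x) = (\<lambda>x. \<Sum>i\<in>I. mderiv \<alpha> (f i) x)"
  using assms
proof (induction I rule: infinite_finite_induct)
  case (insert i I)
  then show ?case
    using mderiv_add[of d "f i" "\<lambda>x. \<Sum>i\<in>I. f i x" \<alpha>] tensor_poly_sum[of I d f] by simp
qed (simp_all add: mderiv_zero)

lemma pd_shift: "pd k (\<lambda>x. f (x + a)) = (\<lambda>x. pd k f (x + a))"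
  unfolding pd_def by (simp only: add_ac)

lemma pd_pow_shift: "(pd k ^^ n) (\<lambda>x. f (x + a)) = (\<lambda>x. (pd k ^^ n) f (x + a))"
  by (induction n) (simp_all add: pd_shift)

lemma mderiv_shift: "mderiv \<alpha> (\<lambda>x. f (x + a)) = (\<lambda>x. mderiv \<alpha> f (x + a))"
  by (simp add: mderiv_def mpd_def pd_pow_shift)

lemma tensor_poly_shift: "tensor_poly d f \<Longrightarrow> tensor_poly d (\<lambda>x. f (x + a))"
proof (induction rule: tensor_poly_induct)
  case (tensor p c)
  have "(\<lambda>x. tensor p c (x + a)) = tensor (\<lambda>k. pcompose (p k) [:a $ k, 1:]) c"
    by (simp add: tensor_def fun_eq_iff poly_pcompose add.commute)
  moreover have "degree (pcompose (p k) [:a $ k, 1:]) \<le> d" for k using tensor by (simp add: degree_pcompose)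
  ultimately show ?case using tensor_poly_tensor[of "\<lambda>k. pcompose (p k) [:a $ k, 1:]" d c] by (simp del: degree_pcompose)
qed (simp add: tensor_poly_add)

lemma continuous_on_tensor_poly: "tensor_poly d f \<Longrightarrow> continuous_on S f"
proof (induction rule: tensor_poly_induct)
  case (tensor p c)
  show ?case unfolding tensor_def[abs_def] by (intro continuous_intros)
qed (auto intro: continuous_on_add)

text \<open>Only values near \<open>x\<close> enter. This is how a piecewise polynomial is replaced by the polynomial of one cell
  in the interior of that cell.\<close>

lemma pd_local:
  assumes "open S" "\<And>x. x \<in> S \<Longrightarrow> f x = g x" "x \<in> S"
  shows "pd k f x = pd k g x"
proof -
  have "((\<lambda>s::real. x + s *\<^sub>R axis k 1) \<longlongrightarrow> x + 0 *\<^sub>R axis k 1) (nhds 0)"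
    by (intro tendsto_intros filterlim_ident)
  then have "eventually (\<lambda>s::real. x + s *\<^sub>R axis k 1 \<in> S) (nhds 0)"
    using assms(1,3) by (simp add: topological_tendstoD)
  then have "eventually (\<lambda>s::real. f (x + s *\<^sub>R axis k 1) = g (x + s *\<^sub>R axis k 1)) (nhds 0)"
    by (rule eventually_mono) (use assms(2) in auto)
  then show ?thesis unfolding pd_def by (intro vector_derivative_cong_eq) auto
qed

lemma pd_pow_local:
  assumes "open S" "\<And>x. x \<in> S \<Longrightarrow> f x = g x" "x \<in> S"
  shows "(pd k ^^ n) f x = (pd k ^^ n) g x"
  using assms(3) by (induction n arbitrary: x) (auto intro: assms(2) pd_local[OF assms(1)])

lemma mderiv_local:
  assumes "open S" "\<And>x. x \<in> S \<Longrightarrow> f x = g x" "x \<in> S"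
  shows "mderiv \<alpha> f x = mderiv \<alpha> g x"
  unfolding mderiv_def mpd_def
  by (intro pd_pow_local[OF assms(1)] assms)


section \<open>The concomitant in three variables\<close>

definition multi_indices :: "nat \<Rightarrow> (3 \<Rightarrow> nat) set" where
  "multi_indices n = {\<kappa>. \<forall>k. \<kappa> k \<le> n}"

lemma multi_indices_PiE: "multi_indices n = PiE UNIV (\<lambda>_. {..n})"
  by (auto simp: multi_indices_def PiE_def)

lemma finite_multi_indices: "finite (multi_indices n)"
  unfolding multi_indices_PiE by (rule finite_PiE) auto

lemma prod_sum_multi_indices:
  "(\<Prod>k\<in>UNIV. \<Sum>i\<le>n. f k i) = (\<Sum>\<kappa>\<in>multi_indices n. \<Prod>k\<in>UNIV. f k (\<kappa> k))" for f :: "3 \<Rightarrow> nat \<Rightarrow> real"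
  unfolding multi_indices_PiE by (rule prod_sum_PiE) auto

lemma bij_betw_vec_PiE: "bij_betw vec_lambda (PiE UNIV B) {i. \<forall>k. i $ k \<in> B k}"
  by (rule bij_betwI[where g = vec_nth]) auto

lemma finite_vec: "(\<And>k. finite (B k)) \<Longrightarrow> finite {i :: 'a^'n. \<forall>k. i $ k \<in> B k}"
  using bij_betw_finite[OF bij_betw_vec_PiE[of B]] finite_PiE[of UNIV B] by simp

lemma prod_sum_vec:
  fixes f :: "'n::finite \<Rightarrow> 'b \<Rightarrow> real"
  assumes "\<And>k. finite (B k)"
  shows "(\<Prod>k\<in>UNIV. \<Sum>y\<in>B k. f k y) = (\<Sum>i\<in>{i. \<forall>k. i $ k \<in> B k}. \<Prod>k\<in>UNIV. f k (i $ k))"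
proof -
  have "(\<Prod>k\<in>UNIV. \<Sum>y\<in>B k. f k y) = (\<Sum>g\<in>PiE UNIV B. \<Prod>k\<in>UNIV. f k (g k))"
    using assms by (intro prod_sum_PiE) auto
  also have "\<dots> = (\<Sum>i\<in>{i. \<forall>k. i $ k \<in> B k}. \<Prod>k\<in>UNIV. f k (i $ k))"
    using sum.reindex_bij_betw[OF bij_betw_vec_PiE[of B], of "\<lambda>i. \<Prod>k\<in>UNIV. f k (i $ k)"] by simp
  finally show ?thesis .
qed

lemma corners_eq: "corners j = {i. \<forall>k. i $ k \<in> {j $ k, j $ k + 1}}"
  by (auto simp: corners_def)

lemma finite_corners: "finite (corners j)"
  unfolding corners_eq by (rule finite_vec) auto

lemma prod_sum_corners:
  "(\<Prod>k\<in>UNIV. \<Sum>i\<in>{j $ k, j $ k + 1}. f k i) = (\<Sum>i\<in>corners j. \<Prod>k\<in>UNIV. f k (i $ k))"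
  for f :: "3 \<Rightarrow> int \<Rightarrow> real"
  unfolding corners_eq by (rule prod_sum_vec) auto

text \<open>By bilinearity it suffices to compare the two forms on products of univariate polynomials.\<close>

lemma tensor_poly_bilinear_eq:
  assumes "tensor_poly d v" "tensor_poly e w"
    and "\<And>f g h. tensor_poly d f \<Longrightarrow> tensor_poly d g \<Longrightarrow> tensor_poly e h \<Longrightarrow>
           S (\<lambda>x. f x + g x) h = S f h + (S g h :: real)"
    and "\<And>f g h. tensor_poly d f \<Longrightarrow> tensor_poly d g \<Longrightarrow> tensor_poly e h \<Longrightarrow>
           T (\<lambda>x. f x + g x) h = T f h + (T g h :: real)"
    and "\<And>f g h. tensor_poly d f \<Longrightarrow> tensor_poly e g \<Longrightarrow> tensor_poly e h \<Longrightarrow>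
           S f (\<lambda>x. g x + h x) = S f g + S f h"
    and "\<And>f g h. tensor_poly d f \<Longrightarrow> tensor_poly e g \<Longrightarrow> tensor_poly e h \<Longrightarrow>
           T f (\<lambda>x. g x + h x) = T f g + T f h"
    and "\<And>p q a b. (\<And>k. degree (p k) \<le> d) \<Longrightarrow> (\<And>k. degree (q k) \<le> e) \<Longrightarrow>
           S (tensor p a) (tensor q b) = T (tensor p a) (tensor q b)"
  shows "S v w = T v w"
  using assms(1)
proof (induction rule: tensor_poly_induct)
  case (add f g)
  then show ?case using assms(2) by (simp add: assms(3,4))
next
  case (tensor p a)
  then have p: "tensor_poly d (tensor p a)" by (rule tensor_poly_tensor)
  show ?case using assms(2)
  proof (induction rule: tensor_poly_induct)
    case (add f g)
    then show ?case using p by (simp add: assms(5,6))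
  next
    case (tensor q b)
    then show ?case using \<open>\<And>k. degree (p k) \<le> d\<close> by (simp add: assms(7))
  qed
qed

text \<open>The tensor product of three one-dimensional concomitants (see \<open>concomitant3_tensor\<close>), which explains the
  signs.\<close>

definition concomitant3 :: "nat \<Rightarrow> nat \<Rightarrow> real^3
    \<Rightarrow> (real^3 \<Rightarrow> 'a::euclidean_space) \<Rightarrow> (real^3 \<Rightarrow> 'a) \<Rightarrow> real" where
  "concomitant3 a n x v w = (\<Sum>\<kappa>\<in>multi_indices n. (\<Prod>k\<in>UNIV. (-1) ^ \<kappa> k)
     * (mderiv (\<lambda>k. a + \<kappa> k) v x \<bullet> mderiv (\<lambda>k. n - \<kappa> k) w x))"

lemma concomitant3_add_left:
  "tensor_poly d u \<Longrightarrow> tensor_poly d v \<Longrightarrow> concomitant3 a n x (\<lambda>x. u x + v x) w = concomitant3 a n x u w + concomitant3 a n x v w"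
  by (simp add: concomitant3_def mderiv_add inner_add_left distrib_left sum.distrib)

lemma concomitant3_add_right:
  "tensor_poly d v \<Longrightarrow> tensor_poly d w \<Longrightarrow> concomitant3 a n x u (\<lambda>x. v x + w x) = concomitant3 a n x u v + concomitant3 a n x u w"
  by (simp add: concomitant3_def mderiv_add inner_add_right distrib_left sum.distrib)

lemma concomitant3_zero: "concomitant3 a n x (\<lambda>x. 0) w = 0" "concomitant3 a n x w (\<lambda>x. 0) = 0"
  by (simp_all add: concomitant3_def mderiv_zero)

lemma concomitant3_sum_left:
  "(\<And>i. i \<in> I \<Longrightarrow> tensor_poly d (v i)) \<Longrightarrow> concomitant3 a n x (\<lambda>x. \<Sum>i\<in>I. v i x) w = (\<Sum>i\<in>I. concomitant3 a n x (v i) w)"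
proof (induction I rule: infinite_finite_induct)
  case (insert i I)
  then show ?case
    using concomitant3_add_left[of d "v i" "\<lambda>x. \<Sum>i\<in>I. v i x" a n x w] tensor_poly_sum[of I d v] by simp
qed (simp_all add: concomitant3_zero)

lemma concomitant3_sum_right:
  "(\<And>i. i \<in> I \<Longrightarrow> tensor_poly d (v i)) \<Longrightarrow> concomitant3 a n x w (\<lambda>x. \<Sum>i\<in>I. v i x) = (\<Sum>i\<in>I. concomitant3 a n x w (v i))"
proof (induction I rule: infinite_finite_induct)
  case (insert i I)
  then show ?case
    using concomitant3_add_right[of d "v i" "\<lambda>x. \<Sum>i\<in>I. v i x" a n x w] tensor_poly_sum[of I d v] by simp
qed (simp_all add: concomitant3_zero)

lemma concomitant3_adjoint:
  assumes "bounded_linear h" "bounded_linear h'" "\<And>x y. h x \<bullet> y = x \<bullet> h' y"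
    and "tensor_poly d v" "tensor_poly d w"
  shows "concomitant3 a n x (\<lambda>x. h (v x)) w = concomitant3 a n x v (\<lambda>x. h' (w x))"
  unfolding concomitant3_def mderiv_bounded_linear[OF assms(1,4)] mderiv_bounded_linear[OF assms(2,5)] assms(3) ..

lemma concomitant3_scale:
  assumes "tensor_poly d v" "tensor_poly d w"
  shows "concomitant3 a n x (\<lambda>x. r *\<^sub>R v x) w = r * concomitant3 a n x v w"
    and "concomitant3 a n x v (\<lambda>x. r *\<^sub>R w x) = r * concomitant3 a n x v w"
  unfolding concomitant3_def mderiv_bounded_linear[OF bounded_linear_scaleR_right assms(1)]
    mderiv_bounded_linear[OF bounded_linear_scaleR_right assms(2)] sum_distrib_left
  by (simp_all add: mult.left_commute)

text \<open>Expanding the product of the three one-dimensional sums gives the sum over all multi-indices.\<close>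

lemma concomitant3_tensor:
  "concomitant3 a n x (tensor p c) (tensor q d)
   = (\<Prod>k\<in>UNIV. poly (concomitant a n (p k) (q k)) (x $ k)) * (c \<bullet> d)"
proof -
  have "(\<Prod>k\<in>UNIV. poly (concomitant a n (p k) (q k)) (x $ k))
     = (\<Sum>\<kappa>\<in>multi_indices n. \<Prod>k\<in>UNIV. (-1) ^ \<kappa> k * (poly ((pderiv ^^ (a + \<kappa> k)) (p k)) (x $ k)
          * poly ((pderiv ^^ (n - \<kappa> k)) (q k)) (x $ k)))"
    unfolding concomitant_def poly_sum poly_smult poly_mult prod_sum_multi_indices ..
  then show ?thesis
    unfolding concomitant3_def mderiv_tensor tensor_def
    by (simp add: sum_distrib_left prod.distrib mult_ac)
qed

lemma concomitant3_const:
  assumes "tensor_poly n v" "tensor_poly n w"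
  shows "concomitant3 0 n x v w = concomitant3 0 n y v w"
  by (rule tensor_poly_bilinear_eq[OF assms])
     (auto simp: concomitant3_add_left concomitant3_add_right concomitant3_tensor intro!: prod.cong concomitant_const)

text \<open>Only the factor of direction \<open>k\<close> changes, so the skewness is that of one variable.\<close>

lemma concomitant3_pd:
  assumes "tensor_poly n v" "tensor_poly n w"
  shows "concomitant3 0 n x (pd k v) w = - concomitant3 0 n x v (pd k w)"
proof (rule tensor_poly_bilinear_eq[OF assms, where T = "\<lambda>v w. - concomitant3 0 n x v (pd k w)"])
  fix p q :: "3 \<Rightarrow> real poly" and a b :: 'a
  assume deg: "\<And>k. degree (p k) \<le> n" "\<And>k. degree (q k) \<le> n"
  have prod: "(\<Prod>l\<in>UNIV. f l) = f k * (\<Prod>l\<in>UNIV - {k}. f l)" for f :: "3 \<Rightarrow> real"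
    by (subst prod.remove[of UNIV k]) auto
  show "concomitant3 0 n x (pd k (tensor p a)) (tensor q b) = - concomitant3 0 n x (tensor p a) (pd k (tensor q b))"
    unfolding pd_tensor concomitant3_tensor prod
    by (simp add: concomitant_pderiv[OF deg])
qed (simp_all add: pd_add concomitant3_add_left[OF tensor_poly_pd tensor_poly_pd]
       concomitant3_add_right[OF tensor_poly_pd tensor_poly_pd] concomitant3_add_left concomitant3_add_right)

text \<open>The reflection \<open>\<kappa> \<mapsto> n - \<kappa>\<close> exchanges the arguments and costs a sign \<open>(-1)^n\<close> in each of the three directions.
  For \<open>n = 2 * m + 1\<close> the form is therefore skew.\<close>

lemma concomitant3_commute: "concomitant3 0 n x w v = (-1) ^ (3 * n) * concomitant3 0 n x v w"
proof -
  have "concomitant3 0 n x w v = (\<Sum>\<kappa>\<in>multi_indices n. (\<Prod>k\<in>UNIV. (-1) ^ (n - \<kappa> k))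
     * (mderiv (\<lambda>k. n - \<kappa> k) w x \<bullet> mderiv (\<lambda>k. n - (n - \<kappa> k)) v x))"
    unfolding concomitant3_def add_0
    by (rule sum.reindex_bij_witness[where i = "\<lambda>\<kappa> k. n - \<kappa> k" and j = "\<lambda>\<kappa> k. n - \<kappa> k"])
       (auto simp: multi_indices_def)
  also have "\<dots> = (\<Sum>\<kappa>\<in>multi_indices n. (-1) ^ (3 * n) * ((\<Prod>k\<in>UNIV. (-1) ^ \<kappa> k)
     * (mderiv (\<lambda>k. \<kappa> k) v x \<bullet> mderiv (\<lambda>k. n - \<kappa> k) w x)))"
  proof (rule sum.cong[OF refl])
    fix \<kappa> assume \<kappa>: "\<kappa> \<in> multi_indices n"
    have "(-1::real) ^ (n - \<kappa> k) = (-1) ^ n * (-1) ^ \<kappa> k" for k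
      using \<kappa> by (auto simp: multi_indices_def uminus_power_if not_less)
    then have "(\<Prod>k\<in>UNIV. (-1::real) ^ (n - \<kappa> k)) = (-1) ^ (3 * n) * (\<Prod>k\<in>UNIV. (-1) ^ \<kappa> k)"
      by (simp add: prod.distrib power_mult[symmetric] mult.commute)
    moreover have "(\<lambda>k. n - (n - \<kappa> k)) = \<kappa>" using \<kappa> by (auto simp: multi_indices_def)
    ultimately show "(\<Prod>k\<in>UNIV. (-1) ^ (n - \<kappa> k)) * (mderiv (\<lambda>k. n - \<kappa> k) w x \<bullet> mderiv (\<lambda>k. n - (n - \<kappa> k)) v x)
      = (-1) ^ (3 * n) * ((\<Prod>k\<in>UNIV. (-1) ^ \<kappa> k) * (mderiv (\<lambda>k. \<kappa> k) v x \<bullet> mderiv (\<lambda>k. n - \<kappa> k) w x))"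
      by (simp add: inner_commute)
  qed
  finally show ?thesis by (simp add: concomitant3_def sum_distrib_left)
qed

section \<open>Integration by parts on a cell\<close>

text \<open>Lebesgue measure on the space is the product of the one-dimensional ones, so Fubini applies.\<close>

lemma integral_prod_cbox:
  fixes f :: "'n::finite \<Rightarrow> real \<Rightarrow> real" and a b :: "real^'n"
  assumes cont: "\<And>k. continuous_on UNIV (f k)"
  shows "integral (cbox a b) (\<lambda>x. \<Prod>k\<in>UNIV. f k (x $ k)) = (\<Prod>k\<in>UNIV. integral {a $ k..b $ k} (f k))"
proof -
  interpret product_sigma_finite "\<lambda>_ :: real^'n. lborel :: real measure" ..
  define g where "g = (\<lambda>b'::real^'n. f (THE k. b' = axis k 1))"
  define h where "h b' t = indicator {a \<bullet> b'..b \<bullet> b'} t *\<^sub>R g b' t" for b' :: "real^'n" and t :: real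
  have g_axis: "g (axis k 1) = f k" for k
    unfolding g_def by (rule arg_cong[of _ _ f]) (auto simp: axis_eq_axis)
  have Basis: "(\<Prod>b'\<in>Basis. F b') = (\<Prod>k\<in>UNIV. F (axis k 1))" for F :: "real^'n \<Rightarrow> real"
  proof -
    have inj: "inj (\<lambda>k::'n. axis k (1::real))" by (auto simp: inj_def axis_eq_axis)
    moreover have "(Basis :: (real^'n) set) = range (\<lambda>k. axis k 1)"
      by (auto simp: Basis_vec_def)
    ultimately show ?thesis using prod.reindex[OF inj, of F] by (simp only: o_def)
  qed
  have h_axis: "h (axis k 1) t = indicator {a $ k..b $ k} t *\<^sub>R f k t" for k t
    by (simp add: h_def g_axis inner_axis)
  have h_axis': "h (axis k 1) = (\<lambda>t. indicator {a $ k..b $ k} t *\<^sub>R f k t)" for k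
    using h_axis by (rule ext)
  have hint: "integrable lborel (h b')" if b': "b' \<in> Basis" for b'
  proof -
    obtain k where "b' = axis k 1" using b' by (auto simp: Basis_vec_def)
    then show ?thesis unfolding h_def g_axis
      using borel_integrable_compact[of "{a \<bullet> b'..b \<bullet> b'}" "f k"] continuous_on_subset[OF cont[of k]]
      by (simp add: g_axis)
  qed
  have cont3: "continuous_on (cbox a b) (\<lambda>x. \<Prod>k\<in>UNIV. f k (x $ k))"
    by (intro continuous_on_prod continuous_on_compose2[OF cont] continuous_on_component continuous_on_id) auto
  have "set_integrable lborel (cbox a b) (\<lambda>x. \<Prod>k\<in>UNIV. f k (x $ k))"
    unfolding set_integrable_def by (intro borel_integrable_compact compact_cbox cont3)
  then have "integral (cbox a b) (\<lambda>x. \<Prod>k\<in>UNIV. f k (x $ k)) = (LINT x:cbox a b|lborel. (\<Prod>k\<in>UNIV. f k (x $ k)))"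
    by (simp add: set_borel_integral_eq_integral)
  also have "\<dots> = (LINT x|lborel. (\<Prod>b'\<in>Basis. h b' (x \<bullet> b')))"
  proof -
    have "indicator (cbox a b) x *\<^sub>R (\<Prod>k\<in>UNIV. f k (x $ k)) = (\<Prod>b'\<in>Basis. h b' (x \<bullet> b'))" for x
    proof (cases "x \<in> cbox a b")
      case True
      then show ?thesis by (simp add: Basis h_axis inner_axis mem_box_cart)
    next
      case False
      then obtain k where "x $ k \<notin> {a $ k..b $ k}" by (auto simp: mem_box_cart)
      then have "(\<Prod>k\<in>UNIV. h (axis k 1) (x \<bullet> axis k 1)) = 0"
        by (intro prod_zero) (auto simp: h_axis inner_axis intro!: exI[of _ k])
      then show ?thesis using False by (simp add: Basis)
    qed
    then show ?thesis by (simp add: set_lebesgue_integral_def)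
  qed
  also have "\<dots> = (LINT y|(\<Pi>\<^sub>M b'\<in>Basis. lborel). (\<Prod>b'\<in>Basis. h b' ((\<Sum>b\<in>Basis. y b *\<^sub>R b) \<bullet> b')))"
    unfolding lborel_eq[where 'a = "real^'n"]
  proof (rule integral_distr)
    show "(\<lambda>x. \<Prod>b'\<in>Basis. h b' (x \<bullet> b')) \<in> borel_measurable (borel :: (real^'n) measure)"
    proof (rule borel_measurable_prod)
      fix b' :: "real^'n" assume "b' \<in> Basis"
      then have "h b' \<in> borel_measurable borel"
        using borel_measurable_integrable[OF hint] by simp
      then show "(\<lambda>x. h b' (x \<bullet> b')) \<in> borel_measurable borel"
        by (rule measurable_compose[rotated]) simp
    qed
  qed simp
  also have "\<dots> = (LINT y|(\<Pi>\<^sub>M b'\<in>Basis. lborel). (\<Prod>b'\<in>Basis. h b' (y b')))"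
    by (intro Bochner_Integration.integral_cong refl prod.cong) (simp add: inner_sum_left_Basis)
  also have "\<dots> = (\<Prod>b'\<in>Basis. LINT t|lborel. h b' t)"
    by (rule product_integral_prod) (auto intro: hint)
  also have "\<dots> = (\<Prod>k\<in>UNIV. LINT t:{a $ k..b $ k}|lborel. f k t)"
    unfolding Basis h_axis' set_lebesgue_integral_def ..
  also have "\<dots> = (\<Prod>k\<in>UNIV. integral {a $ k..b $ k} (f k))"
  proof (rule prod.cong[OF refl])
    fix k
    have "set_integrable lborel {a $ k..b $ k} (f k)"
      unfolding set_integrable_def
      by (rule borel_integrable_compact) (auto intro: continuous_on_subset[OF cont])
    then show "(LINT t:{a $ k..b $ k}|lborel. f k t) = integral {a $ k..b $ k} (f k)"
      by (rule set_borel_integral_eq_integral)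
  qed
  finally show ?thesis .
qed


text \<open>A corner is an upper or a lower endpoint of the cell in each direction, and every lower endpoint enters
  the boundary terms with a minus sign. The argument is the position of the corner relative to the
  lowest one.\<close>

definition corner_sign :: "int^3 \<Rightarrow> real" where
  "corner_sign \<sigma> = (\<Prod>k\<in>UNIV. if \<sigma> $ k = 0 then -1 else 1)"

lemma vertex_nth: "vertex p N i $ k = p $ k + of_int (i $ k) * spacing N $ k"
  by (simp add: vertex_def)

lemma spacing_pos: "(\<And>k. N $ k > 0) \<Longrightarrow> spacing N $ k > 0"
  by (simp add: spacing_def)

text \<open>On products of univariate polynomials the integral factors, and each factor is a difference of two
  endpoint values; multiplying out gives a signed sum over the eight corners.\<close>

lemma integral_cell:
  fixes v w :: "real^3 \<Rightarrow> 'a::euclidean_space"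
  assumes N: "\<And>k. N $ k > 0" and v: "tensor_poly (2 * m + 1) v" and w: "tensor_poly (2 * m + 1) w"
  shows "integral (cell p N j) (\<lambda>x. mderiv (\<lambda>_. m + 1) v x \<bullet> mderiv (\<lambda>_. m + 1) w x)
       = (\<Sum>i\<in>corners j. corner_sign (i - j) * concomitant3 (m + 1) m (vertex p N i) v w)"
proof (rule tensor_poly_bilinear_eq[OF v w])
  fix p' q' :: "3 \<Rightarrow> real poly" and c d :: 'a
  assume deg: "\<And>k. degree (p' k) \<le> 2 * m + 1" "\<And>k. degree (q' k) \<le> 2 * m + 1"
  define z where "z k i = p $ k + of_int i * spacing N $ k" for k i
  define F where "F k = (\<lambda>t. poly ((pderiv ^^ (m + 1)) (p' k)) t * poly ((pderiv ^^ (m + 1)) (q' k)) t)" for k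
  define G where "G k = poly (concomitant (m + 1) m (p' k) (q' k))" for k
  have "integral (cell p N j) (\<lambda>x. mderiv (\<lambda>_. m + 1) (tensor p' c) x \<bullet> mderiv (\<lambda>_. m + 1) (tensor q' d) x)
      = integral (cell p N j) (\<lambda>x. (\<Prod>k\<in>UNIV. F k (x $ k)) * (c \<bullet> d))"
    by (simp add: mderiv_tensor tensor_def F_def prod.distrib mult_ac del: funpow.simps)
  also have "\<dots> = integral (cell p N j) (\<lambda>x. \<Prod>k\<in>UNIV. F k (x $ k)) * (c \<bullet> d)"
    by (rule integral_mult_left)
  also have "integral (cell p N j) (\<lambda>x. \<Prod>k\<in>UNIV. F k (x $ k))
      = (\<Prod>k\<in>UNIV. integral {z k (j $ k)..z k (j $ k + 1)} (F k))"
    unfolding cell_def F_def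
    by (subst integral_prod_cbox) (auto simp: vertex_nth z_def intro!: continuous_intros)
  also have "\<dots> = (\<Prod>k\<in>UNIV. \<Sum>i\<in>{j $ k, j $ k + 1}. (if i - j $ k = 0 then - 1 else 1) * G k (z k i))"
  proof (rule prod.cong[OF refl])
    fix k
    have "z k (j $ k) \<le> z k (j $ k + 1)"
      using spacing_pos[of N k] N by (simp add: z_def algebra_simps)
    from integral_higher_pderiv[OF deg(1)[of k] this, of "q' k"]
    show "integral {z k (j $ k)..z k (j $ k + 1)} (F k)
        = (\<Sum>i\<in>{j $ k, j $ k + 1}. (if i - j $ k = 0 then - 1 else 1) * G k (z k i))"
      by (simp add: F_def G_def)
  qed
  also have "\<dots> = (\<Sum>i\<in>corners j. corner_sign (i - j) * (\<Prod>k\<in>UNIV. G k (vertex p N i $ k)))"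
    unfolding prod_sum_corners corner_sign_def
    by (simp add: prod.distrib vertex_nth z_def)
  finally show "integral (cell p N j) (\<lambda>x. mderiv (\<lambda>_. m + 1) (tensor p' c) x \<bullet> mderiv (\<lambda>_. m + 1) (tensor q' d) x)
      = (\<Sum>i\<in>corners j. corner_sign (i - j) * concomitant3 (m + 1) m (vertex p N i) (tensor p' c) (tensor q' d))"
    by (simp add: concomitant3_tensor G_def sum_distrib_right mult.assoc)
next
  have int: "(\<lambda>x. mderiv \<alpha> f x \<bullet> mderiv \<alpha> g x) integrable_on cell p N j"
    if "tensor_poly (2 * m + 1) f" "tensor_poly (2 * m + 1) g" for \<alpha> and f g :: "real^3 \<Rightarrow> 'a"
    unfolding cell_def using that
    by (intro integrable_continuous continuous_on_inner continuous_on_tensor_poly[OF tensor_poly_mderiv])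
  fix f g h :: "real^3 \<Rightarrow> 'a"
  assume f: "tensor_poly (2 * m + 1) f" and g: "tensor_poly (2 * m + 1) g" and h: "tensor_poly (2 * m + 1) h"
  let ?D = "mderiv (\<lambda>_. m + 1)"
  show "integral (cell p N j) (\<lambda>x. ?D (\<lambda>x. f x + g x) x \<bullet> ?D h x)
      = integral (cell p N j) (\<lambda>x. ?D f x \<bullet> ?D h x) + integral (cell p N j) (\<lambda>x. ?D g x \<bullet> ?D h x)"
    unfolding mderiv_add[OF f g] inner_add_left by (rule integral_add[OF int[OF f h] int[OF g h]])
  show "integral (cell p N j) (\<lambda>x. ?D f x \<bullet> ?D (\<lambda>x. g x + h x) x)
      = integral (cell p N j) (\<lambda>x. ?D f x \<bullet> ?D g x) + integral (cell p N j) (\<lambda>x. ?D f x \<bullet> ?D h x)"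
    unfolding mderiv_add[OF g h] inner_add_right by (rule integral_add[OF int[OF f g] int[OF f h]])
qed (simp_all add: concomitant3_add_left concomitant3_add_right distrib_left sum.distrib)


section \<open>Hermite-Birkhoff interpolation on a grid\<close>

definition node :: "real^3 \<Rightarrow> nat^3 \<Rightarrow> 3 \<Rightarrow> int \<Rightarrow> real" where
  "node p N k i = p $ k + of_int i * spacing N $ k"

lemma vertex_node: "vertex p N i $ k = node p N k (i $ k)"
  by (simp add: vertex_def node_def)

lemma node_less_iff:
  assumes "\<And>k. N $ k > 0"
  shows "node p N k i < node p N k i' \<longleftrightarrow> i < i'"
  using spacing_pos[of N k] assms by (simp add: node_def)

lemma node_le_iff:
  assumes "\<And>k. N $ k > 0"
  shows "node p N k i \<le> node p N k i' \<longleftrightarrow> i \<le> i'"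
  using spacing_pos[of N k] assms by (simp add: node_def)

lemma node_eq_iff:
  assumes "\<And>k. N $ k > 0"
  shows "node p N k i = node p N k i' \<longleftrightarrow> i = i'"
  using spacing_pos[of N k] assms by (simp add: node_def)

lemma mem_cell: "x \<in> cell p N j \<longleftrightarrow> (\<forall>k. node p N k (j $ k) \<le> x $ k \<and> x $ k \<le> node p N k (j $ k + 1))"
  by (simp add: cell_def mem_box_cart vertex_node)

text \<open>The one-dimensional factors of the basis function on cell \<open>j\<close> that belongs to the corner \<open>i\<close>. In direction
  \<open>k\<close> the cell has the endpoints \<open>j $ k\<close> and \<open>j $ k + 1\<close>; if \<open>i $ k\<close> is one of them, then
  \<open>2 * j $ k + 1 - i $ k\<close> is the other one.\<close>

definition node_basis :: "nat \<Rightarrow> real^3 \<Rightarrow> nat^3 \<Rightarrow> int^3 \<Rightarrow> int^3 \<Rightarrow> (3 \<Rightarrow> nat) \<Rightarrow> 3 \<Rightarrow> real poly" where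
  "node_basis m p N j i \<beta> k
   = hermite_basis m (node p N k (i $ k)) (node p N k (2 * j $ k + 1 - i $ k)) (\<beta> k)"

text \<open>The data \<open>D\<close> are arbitrary: derivatives of different orders, and data at different vertices, need not
  come from one function.\<close>

definition cell_poly :: "nat \<Rightarrow> real^3 \<Rightarrow> nat^3 \<Rightarrow> (int^3 \<Rightarrow> (3 \<Rightarrow> nat) \<Rightarrow> 'a) \<Rightarrow> int^3 \<Rightarrow> real^3
    \<Rightarrow> 'a::real_normed_vector" where
  "cell_poly m p N D j x = (\<Sum>i\<in>corners j. \<Sum>\<beta>\<in>multi_indices m. tensor (node_basis m p N j i \<beta>) (D i \<beta>) x)"

definition cell_index :: "real^3 \<Rightarrow> nat^3 \<Rightarrow> real^3 \<Rightarrow> int^3" where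
  "cell_index p N x = (\<chi> k. \<lfloor>(x $ k - p $ k) / spacing N $ k\<rfloor>)"

definition vertex_data :: "real^3 \<Rightarrow> nat^3 \<Rightarrow> (real^3 \<Rightarrow> 'a::real_normed_vector) \<Rightarrow> int^3 \<Rightarrow> (3 \<Rightarrow> nat) \<Rightarrow> 'a" where
  "vertex_data p N f i \<beta> = mderiv \<beta> f (vertex p N i)"

context
  fixes N :: "nat^3" and p :: "real^3" and m :: nat
  assumes N: "\<And>k. N $ k > 0"
begin

lemma tensor_poly_tensor_node_basis:
  assumes "i \<in> corners j"
  shows "tensor_poly (2 * m + 1) (tensor (node_basis m p N j i \<beta>) c)"
proof (rule tensor_poly_tensor)
  fix k
  have "i $ k = j $ k \<or> i $ k = j $ k + 1" using assms by (simp add: corners_def)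
  then have "i $ k \<noteq> 2 * j $ k + 1 - i $ k" by auto
  then show "degree (node_basis m p N j i \<beta> k) \<le> 2 * m + 1"
    unfolding node_basis_def by (intro degree_hermite_basis) (simp add: node_eq_iff[OF N])
qed

lemma tensor_poly_cell_poly: "tensor_poly (2 * m + 1) (cell_poly m p N D j)"
  unfolding cell_poly_def[abs_def]
  by (intro tensor_poly_sum tensor_poly_tensor_node_basis)

lemma node_basis_at_node:
  assumes "i \<in> corners j" "n = j $ k \<or> n = j $ k + 1" "a \<le> m"
  shows "poly ((pderiv ^^ a) (node_basis m p N j i \<beta> k)) (node p N k n) = of_bool (i $ k = n \<and> \<beta> k = a)"
proof -
  have i: "i $ k = j $ k \<or> i $ k = j $ k + 1" using assms(1) by (simp add: corners_def)
  then have ne: "node p N k (i $ k) \<noteq> node p N k (2 * j $ k + 1 - i $ k)"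
    unfolding node_eq_iff[OF N] by auto
  show ?thesis
  proof (cases "i $ k = n")
    case True
    then show ?thesis unfolding node_basis_def
      using hermite_basis_near[OF ne assms(3), of "\<beta> k"] by (auto simp: of_bool_def)
  next
    case False
    then have "n = 2 * j $ k + 1 - i $ k" using i assms(2) by auto
    then show ?thesis unfolding node_basis_def
      using hermite_basis_far[OF ne assms(3), of "\<beta> k"] False by simp
  qed
qed

lemma mderiv_cell_poly:
  "mderiv \<alpha> (cell_poly m p N D j) x = (\<Sum>i\<in>corners j. \<Sum>\<beta>\<in>multi_indices m.
     (\<Prod>k\<in>UNIV. poly ((pderiv ^^ \<alpha> k) (node_basis m p N j i \<beta> k)) (x $ k)) *\<^sub>R D i \<beta>)"
proof -
  have "mderiv \<alpha> (cell_poly m p N D j)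
      = (\<lambda>x. \<Sum>i\<in>corners j. mderiv \<alpha> (\<lambda>x. \<Sum>\<beta>\<in>multi_indices m. tensor (node_basis m p N j i \<beta>) (D i \<beta>) x) x)"
    unfolding cell_poly_def[abs_def]
    by (rule mderiv_sum[where d = "2 * m + 1"]) (intro tensor_poly_sum tensor_poly_tensor_node_basis)
  then have "mderiv \<alpha> (cell_poly m p N D j) x
      = (\<Sum>i\<in>corners j. mderiv \<alpha> (\<lambda>x. \<Sum>\<beta>\<in>multi_indices m. tensor (node_basis m p N j i \<beta>) (D i \<beta>) x) x)"
    by (rule fun_cong)
  also have "\<dots> = (\<Sum>i\<in>corners j. \<Sum>\<beta>\<in>multi_indices m. mderiv \<alpha> (tensor (node_basis m p N j i \<beta>) (D i \<beta>)) x)"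
  proof (rule sum.cong[OF refl])
    fix i assume i: "i \<in> corners j"
    have "mderiv \<alpha> (\<lambda>x. \<Sum>\<beta>\<in>multi_indices m. tensor (node_basis m p N j i \<beta>) (D i \<beta>) x)
        = (\<lambda>x. \<Sum>\<beta>\<in>multi_indices m. mderiv \<alpha> (tensor (node_basis m p N j i \<beta>) (D i \<beta>)) x)"
      by (rule mderiv_sum[where d = "2 * m + 1"]) (rule tensor_poly_tensor_node_basis[OF i])
    then show "mderiv \<alpha> (\<lambda>x. \<Sum>\<beta>\<in>multi_indices m. tensor (node_basis m p N j i \<beta>) (D i \<beta>) x) x
        = (\<Sum>\<beta>\<in>multi_indices m. mderiv \<alpha> (tensor (node_basis m p N j i \<beta>) (D i \<beta>)) x)" by (rule fun_cong)
  qed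
  finally show ?thesis by (simp add: mderiv_tensor tensor_def)
qed

lemma mderiv_cell_poly_vertex:
  assumes "i \<in> corners j" "\<beta> \<in> multi_indices m"
  shows "mderiv \<beta> (cell_poly m p N D j) (vertex p N i) = D i \<beta>"
proof -
  have "(\<Prod>k\<in>UNIV. poly ((pderiv ^^ \<beta> k) (node_basis m p N j i' \<beta>' k)) (vertex p N i $ k))
      = of_bool (i' = i \<and> \<beta>' = \<beta>)" if "i' \<in> corners j" for i' \<beta>'
  proof -
    have "poly ((pderiv ^^ \<beta> k) (node_basis m p N j i' \<beta>' k)) (vertex p N i $ k)
        = of_bool (i' $ k = i $ k \<and> \<beta>' k = \<beta> k)" for k
      unfolding vertex_node using assms
      by (intro node_basis_at_node that) (auto simp: corners_def multi_indices_def)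
    moreover have "(\<Prod>k\<in>UNIV. of_bool (i' $ k = i $ k \<and> \<beta>' k = \<beta> k) :: real) = of_bool (i' = i \<and> \<beta>' = \<beta>)"
    proof (cases "i' = i \<and> \<beta>' = \<beta>")
      case False
      then obtain k where "\<not> (i' $ k = i $ k \<and> \<beta>' k = \<beta> k)" by (auto simp: vec_eq_iff fun_eq_iff)
      then have "(\<Prod>k\<in>UNIV. of_bool (i' $ k = i $ k \<and> \<beta>' k = \<beta> k) :: real) = 0"
        by (intro prod_zero) (auto intro!: exI[of _ k])
      then show ?thesis using False by simp
    qed simp
    ultimately show ?thesis by simp
  qed
  then have "mderiv \<beta> (cell_poly m p N D j) (vertex p N i)
      = (\<Sum>i'\<in>corners j. \<Sum>\<beta>'\<in>multi_indices m. of_bool (i' = i \<and> \<beta>' = \<beta>) *\<^sub>R D i' \<beta>')"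
    unfolding mderiv_cell_poly by simp
  also have "\<dots> = (\<Sum>i'\<in>corners j. if i' = i then (\<Sum>\<beta>'\<in>multi_indices m. if \<beta>' = \<beta> then D i' \<beta>' else 0) else 0)"
    by (intro sum.cong refl) (auto intro!: sum.cong)
  also have "\<dots> = D i \<beta>"
    using assms by (simp add: sum.delta finite_corners finite_multi_indices)
  finally show ?thesis .
qed

lemma cell_poly_add: "cell_poly m p N (\<lambda>i \<beta>. D i \<beta> + D' i \<beta>) j x = cell_poly m p N D j x + cell_poly m p N D' j x"
  by (simp add: cell_poly_def tensor_def scaleR_right_distrib sum.distrib)

text \<open>The reproduction formulas in the three variables are multiplied; the product of the sums over endpoints
  and orders is the sum over corners and multi-indices.\<close>

lemma cell_poly_reproduces:
  "tensor_poly (2 * m + 1) u \<Longrightarrow> cell_poly m p N (\<lambda>i \<beta>. mderiv \<beta> u (vertex p N i)) j = u"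
proof (induction rule: tensor_poly_induct)
  case (add f g)
  then show ?case by (simp add: mderiv_add cell_poly_add fun_eq_iff)
next
  case (tensor q c)
  show ?case
  proof
    fix x
    let ?b = "\<lambda>k n a. poly (hermite_basis m (node p N k n) (node p N k (2 * j $ k + 1 - n)) a) (x $ k)
       * poly ((pderiv ^^ a) (q k)) (node p N k n)"
    have eq: "poly (q k) (x $ k) = (\<Sum>n\<in>{j $ k, j $ k + 1}. \<Sum>a\<le>m. ?b k n a)" for k
    proof -
      have "node p N k (j $ k) \<noteq> node p N k (j $ k + 1)" by (simp add: node_eq_iff[OF N])
      from arg_cong[OF hermite_basis_reproduces[OF this tensor[of k]], of "\<lambda>q. poly q (x $ k)"]
      show ?thesis by (simp add: poly_sum mult.commute algebra_simps)
    qed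
    have "tensor q c x = (\<Sum>i\<in>corners j. \<Sum>\<beta>\<in>multi_indices m. \<Prod>k\<in>UNIV. ?b k (i $ k) (\<beta> k)) *\<^sub>R c"
      unfolding tensor_def eq prod_sum_corners prod_sum_multi_indices ..
    then show "cell_poly m p N (\<lambda>i \<beta>. mderiv \<beta> (tensor q c) (vertex p N i)) j x = tensor q c x"
      by (simp add: cell_poly_def mderiv_tensor tensor_def scaleR_sum_left node_basis_def vertex_node prod.distrib)
  qed
qed

lemma cell_poly_unique:
  assumes "tensor_poly (2 * m + 1) u" "\<And>i \<beta>. i \<in> corners j \<Longrightarrow> \<beta> \<in> multi_indices m \<Longrightarrow> mderiv \<beta> u (vertex p N i) = D i \<beta>"
  shows "u = cell_poly m p N D j"
proof -
  have "cell_poly m p N D j = cell_poly m p N (\<lambda>i \<beta>. mderiv \<beta> u (vertex p N i)) j"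
    unfolding cell_poly_def[abs_def] using assms(2) by simp
  then show ?thesis using cell_poly_reproduces[OF assms(1)] by simp
qed

text \<open>In a direction in which the cells differ, \<open>x\<close> lies on their common node. There the one-dimensional basis
  functions take the values 0 and 1 that are prescribed for the derivative of order \<open>\<alpha> k \<le> m\<close>, and only
  corners on the common face survive. In the other directions, which are tangential to the face, the two
  cells have the same basis, so the derivatives agree to every order.\<close>

lemma mderiv_cell_poly_neighbour:
  assumes "\<And>k. j' $ k = j $ k \<or> (j' $ k = j $ k + 1 \<and> x $ k = node p N k (j $ k + 1) \<and> \<alpha> k \<le> m)"
  shows "mderiv \<alpha> (cell_poly m p N D j) x = mderiv \<alpha> (cell_poly m p N D j') x"
proof -
  define K where "K = corners j \<inter> corners j'"
  have on_face: "poly ((pderiv ^^ \<alpha> k) (node_basis m p N l i \<beta> k)) (x $ k) = of_bool (i $ k = j $ k + 1 \<and> \<beta> k = \<alpha> k)"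
    if "j' $ k \<noteq> j $ k" "l = j \<or> l = j'" "i \<in> corners l" for k l i \<beta>
  proof -
    have k: "j' $ k = j $ k + 1" "x $ k = node p N k (j $ k + 1)" "\<alpha> k \<le> m"
      using assms[of k] that(1) by auto
    show ?thesis unfolding k(2)
      by (rule node_basis_at_node[OF that(3) _ k(3)]) (use that(2) k(1) in auto)
  qed
  \<comment> \<open>Corners off the common face do not contribute.\<close>
  have restrict: "mderiv \<alpha> (cell_poly m p N D l) x = (\<Sum>i\<in>K. \<Sum>\<beta>\<in>multi_indices m.
     (\<Prod>k\<in>UNIV. poly ((pderiv ^^ \<alpha> k) (node_basis m p N l i \<beta> k)) (x $ k)) *\<^sub>R D i \<beta>)"
    if l: "l = j \<or> l = j'" for l
    unfolding mderiv_cell_poly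
  proof (rule sum.mono_neutral_right[OF finite_corners])
    show "K \<subseteq> corners l" using l by (auto simp: K_def)
    show "\<forall>i\<in>corners l - K. (\<Sum>\<beta>\<in>multi_indices m.
       (\<Prod>k\<in>UNIV. poly ((pderiv ^^ \<alpha> k) (node_basis m p N l i \<beta> k)) (x $ k)) *\<^sub>R D i \<beta>) = 0"
    proof
      fix i assume i: "i \<in> corners l - K"
      have "\<exists>k. j' $ k \<noteq> j $ k \<and> i $ k \<noteq> j $ k + 1"
      proof (rule ccontr)
        assume none: "\<not> (\<exists>k. j' $ k \<noteq> j $ k \<and> i $ k \<noteq> j $ k + 1)"
        have "(i $ k = j $ k \<or> i $ k = j $ k + 1) \<and> (i $ k = j' $ k \<or> i $ k = j' $ k + 1)" for k
          using none assms[of k] i l by (auto simp: corners_def) metis+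
        then have "i \<in> K" by (auto simp: K_def corners_def)
        then show False using i by simp
      qed
      then obtain k where k: "j' $ k \<noteq> j $ k" "i $ k \<noteq> j $ k + 1" by blast
      have "(\<Prod>k\<in>UNIV. poly ((pderiv ^^ \<alpha> k) (node_basis m p N l i \<beta> k)) (x $ k)) = 0" for \<beta>
        using on_face[OF k(1) l, of i \<beta>] i k(2) by (intro prod_zero) auto
      then show "(\<Sum>\<beta>\<in>multi_indices m.
       (\<Prod>k\<in>UNIV. poly ((pderiv ^^ \<alpha> k) (node_basis m p N l i \<beta> k)) (x $ k)) *\<^sub>R D i \<beta>) = 0"
        by (intro sum.neutral ballI) (simp only: scaleR_zero_left)
    qed
  qed
  have "poly ((pderiv ^^ \<alpha> k) (node_basis m p N j i \<beta> k)) (x $ k)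
      = poly ((pderiv ^^ \<alpha> k) (node_basis m p N j' i \<beta> k)) (x $ k)" if "i \<in> K" for k i \<beta>
  proof (cases "j' $ k = j $ k")
    case True
    then show ?thesis by (simp add: node_basis_def)
  next
    case False
    then show ?thesis using on_face[OF False, of j i \<beta>] on_face[OF False, of j' i \<beta>] that by (simp add: K_def)
  qed
  then show ?thesis using restrict[of j] restrict[of j'] by simp
qed


lemma cell_index_bounds:
  "node p N k (cell_index p N x $ k) \<le> x $ k" "x $ k < node p N k (cell_index p N x $ k + 1)"
proof -
  have h: "spacing N $ k > 0" by (rule spacing_pos) (rule N)
  have "of_int (cell_index p N x $ k) \<le> (x $ k - p $ k) / spacing N $ k"
    "(x $ k - p $ k) / spacing N $ k < of_int (cell_index p N x $ k) + 1"
    by (simp_all add: cell_index_def)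
  then show "node p N k (cell_index p N x $ k) \<le> x $ k" "x $ k < node p N k (cell_index p N x $ k + 1)"
    using h by (simp_all add: node_def field_simps)
qed

lemma mem_cell_cell_index: "x \<in> cell p N (cell_index p N x)"
  using cell_index_bounds[where x = x] by (auto simp: mem_cell intro: less_imp_le)

lemma mem_cell_cases:
  assumes "x \<in> cell p N j"
  shows "cell_index p N x $ k = j $ k \<or> (cell_index p N x $ k = j $ k + 1 \<and> x $ k = node p N k (j $ k + 1))"
proof -
  have x: "node p N k (j $ k) \<le> x $ k" "x $ k \<le> node p N k (j $ k + 1)"
    using assms by (auto simp: mem_cell)
  have "j $ k < cell_index p N x $ k + 1"
    using x(1) cell_index_bounds(2)[of x k] node_less_iff[OF N] by (meson le_less_trans)
  moreover have "cell_index p N x $ k \<le> j $ k + 1"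
    using x(2) cell_index_bounds(1)[of k x] node_less_iff[OF N, of p k "j $ k + 1" "cell_index p N x $ k"]
    by linarith
  moreover have "x $ k = node p N k (j $ k + 1)" if "cell_index p N x $ k = j $ k + 1"
    using x(2) cell_index_bounds(1)[of k x] that by simp
  ultimately show ?thesis by linarith
qed

text \<open>The one-sided derivatives along direction \<open>k\<close> are those of the polynomials of the cells on the two sides
  of \<open>x\<close>, and these cells are equal or neighbours in direction \<open>k\<close>.\<close>

lemma pd_piecewise:
  assumes u: "\<And>j. tensor_poly d (u j)"
    and F: "\<And>j x. x \<in> cell p N j \<Longrightarrow> F x = u j x"
    and match: "\<And>j x. x $ k = node p N k (j $ k + 1) \<Longrightarrow> pd k (u j) x = pd k (u (j + axis k 1)) x"
    and x: "x \<in> cell p N j"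
  shows "pd k F x = pd k (u j) x"
proof -
  define D where "D = pd k (u j) x"
  let ?e = "\<lambda>s. x + s *\<^sub>R axis k 1"
  let ?z = "node p N k"
  have xk: "?z (j $ k) \<le> x $ k" "x $ k \<le> ?z (j $ k + 1)" using x by (auto simp: mem_cell)
  have move: "?e s \<in> cell p N i"
    if "\<And>l. l \<noteq> k \<Longrightarrow> i $ l = j $ l" "?z (i $ k) \<le> x $ k + s" "x $ k + s \<le> ?z (i $ k + 1)" for s i
    unfolding mem_cell
  proof
    fix l
    show "node p N l (i $ l) \<le> ?e s $ l \<and> ?e s $ l \<le> node p N l (i $ l + 1)"
      using that x by (cases "l = k") (auto simp: axis_nth_if mem_cell)
  qed
  \<comment> \<open>The cell \<open>i\<close> contains the part of the line through \<open>x\<close> on the side \<open>T\<close>, near \<open>x\<close>.\<close>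
  have one_sided: "((\<lambda>s. F (?e s)) has_vector_derivative D) (at 0 within T)"
    if "pd k (u i) x = D" "0 \<in> T" "\<delta> > 0" "\<And>s. s \<in> T \<Longrightarrow> \<bar>s\<bar> < \<delta> \<Longrightarrow> ?e s \<in> cell p N i" for i T \<delta>
  proof -
    have "((\<lambda>s. u i (?e s)) has_vector_derivative D) (at 0 within T)"
      using tensor_poly_has_vector_derivative[OF u[of i], of x k] that(1)
      by (auto intro: has_vector_derivative_at_within)
    moreover have "eventually (\<lambda>s. s \<in> T \<longrightarrow> ?e s \<in> cell p N i) (nhds 0)"
      unfolding eventually_nhds_metric using that(3,4) by (auto simp: dist_norm intro!: exI[of _ \<delta>])
    moreover have "F x = u i x" using that(2,3) that(4)[of 0] F by simp
    ultimately show ?thesis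
      using that(2)
      by (subst has_vector_derivative_cong_ev[where g = "\<lambda>s. u i (?e s)"])
         (auto elim!: eventually_mono simp: F)
  qed
  have right: "((\<lambda>s. F (?e s)) has_vector_derivative D) (at 0 within {0..})"
  proof (cases "x $ k < ?z (j $ k + 1)")
    case True
    show ?thesis
    proof (rule one_sided[of j _ "?z (j $ k + 1) - x $ k"])
      fix s assume "s \<in> {0::real..}" "\<bar>s\<bar> < ?z (j $ k + 1) - x $ k"
      then show "?e s \<in> cell p N j" using xk by (intro move) auto
    qed (use True in \<open>auto simp: D_def\<close>)
  next
    case False
    then have xz: "x $ k = ?z (j $ k + 1)" using xk by simp
    have pos: "?z (j $ k + 2) > ?z (j $ k + 1)" by (simp add: node_less_iff[OF N])
    show ?thesis
    proof (rule one_sided[of "j + axis k 1" _ "?z (j $ k + 2) - ?z (j $ k + 1)"])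
      show "pd k (u (j + axis k 1)) x = D" using match[OF xz] by (simp add: D_def)
      fix s assume "s \<in> {0::real..}" "\<bar>s\<bar> < ?z (j $ k + 2) - ?z (j $ k + 1)"
      then show "?e s \<in> cell p N (j + axis k 1)"
        using xz by (intro move) (auto simp: axis_def add.assoc)
    qed (use pos in auto)
  qed
  have left: "((\<lambda>s. F (?e s)) has_vector_derivative D) (at 0 within {..0})"
  proof (cases "?z (j $ k) < x $ k")
    case True
    show ?thesis
    proof (rule one_sided[of j _ "x $ k - ?z (j $ k)"])
      fix s assume "s \<in> {..0::real}" "\<bar>s\<bar> < x $ k - ?z (j $ k)"
      then show "?e s \<in> cell p N j" using xk by (intro move) auto
    qed (use True in \<open>auto simp: D_def\<close>)
  next
    case False
    then have xz: "x $ k = ?z (j $ k)" using xk by simp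
    have pos: "?z (j $ k - 1) < ?z (j $ k)" by (simp add: node_less_iff[OF N])
    show ?thesis
    proof (rule one_sided[of "j - axis k 1" _ "?z (j $ k) - ?z (j $ k - 1)"])
      show "pd k (u (j - axis k 1)) x = D"
        using match[of x "j - axis k 1"] xz by (simp add: D_def axis_def)
      fix s assume "s \<in> {..0::real}" "\<bar>s\<bar> < ?z (j $ k) - ?z (j $ k - 1)"
      then show "?e s \<in> cell p N (j - axis k 1)"
        using xz by (intro move) (auto simp: axis_def)
    qed (use pos in auto)
  qed
  have "((\<lambda>s. F (?e s)) has_vector_derivative D) (at 0 within ({0..} \<union> {..0}))"
    using right left unfolding has_vector_derivative_def has_derivative_within Lim_within_Un by blast
  moreover have "{0..} \<union> {..0::real} = UNIV" by auto
  ultimately show ?thesis unfolding pd_def[of k F] D_def[symmetric] by (simp add: vector_derivative_at)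
qed

lemma pd_pow_piecewise:
  assumes u: "\<And>j. tensor_poly d (u j)"
    and F: "\<And>j x. x \<in> cell p N j \<Longrightarrow> F x = u j x"
    and match: "\<And>n' j x. n' \<le> n \<Longrightarrow> x $ k = node p N k (j $ k + 1)
                 \<Longrightarrow> (pd k ^^ n') (u j) x = (pd k ^^ n') (u (j + axis k 1)) x"
  shows "x \<in> cell p N j \<Longrightarrow> (pd k ^^ n) F x = (pd k ^^ n) (u j) x"
  using match
proof (induction n arbitrary: x j)
  case (Suc n)
  have "pd k ((pd k ^^ n) F) x = pd k ((pd k ^^ n) (u j)) x"
  proof (rule pd_piecewise[where d = d and u = "\<lambda>j. (pd k ^^ n) (u j)"])
    show "(pd k ^^ n) F x = (pd k ^^ n) (u j) x" if "x \<in> cell p N j" for j x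
      using that Suc.prems(2) by (intro Suc.IH) auto
    show "pd k ((pd k ^^ n) (u j)) x = pd k ((pd k ^^ n) (u (j + axis k 1))) x"
      if "x $ k = node p N k (j $ k + 1)" for j x
      using Suc.prems(2)[OF order_refl that] by simp
  qed (use u Suc.prems(1) in \<open>auto intro: tensor_poly_pd_pow\<close>)
  then show ?case by simp
qed (simp add: F)

lemma mpd_eq_mderiv: "mpd a b c f = mderiv (\<lambda>k. if k = 1 then a else if k = 2 then b else c) f"
  by (simp add: mderiv_def)

text \<open>The directions are differentiated one after the other. In each of them the order stays at most \<open>m\<close>, so the
  polynomials of neighbouring cells match; the derivatives taken before are tangential.\<close>

lemma mderiv_piecewise_cell_poly:
  assumes F: "\<And>j x. x \<in> cell p N j \<Longrightarrow> F x = cell_poly m p N D j x"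
    and x: "x \<in> cell p N j" and \<beta>: "\<beta> \<in> multi_indices m"
  shows "mderiv \<beta> F x = mderiv \<beta> (cell_poly m p N D j) x"
proof -
  let ?u = "cell_poly m p N D"
  note tp = tensor_poly_cell_poly[of D]
  have match: "mpd a b c (?u j) x = mpd a b c (?u (j + axis k 1)) x"
    if "x $ k = node p N k (j $ k + 1)" "(if k = 1 then a else if k = 2 then b else c) \<le> m" for a b c k j x
    unfolding mpd_eq_mderiv
    by (rule mderiv_cell_poly_neighbour) (use that in \<open>auto simp: axis_def\<close>)
  have \<beta>m: "\<beta> k \<le> m" for k using \<beta> by (simp add: multi_indices_def)
  have match3: "(pd 3 ^^ n) (?u j) x = (pd 3 ^^ n) (?u (j + axis 3 1)) x"
    if "n \<le> \<beta> 3" "x $ 3 = node p N 3 (j $ 3 + 1)" for n j x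
    using match[OF that(2), of 0 0 n] that(1) \<beta>m[of 3] by (simp add: mpd_def)
  have match2: "(pd 2 ^^ n) ((pd 3 ^^ \<beta> 3) (?u j)) x = (pd 2 ^^ n) ((pd 3 ^^ \<beta> 3) (?u (j + axis 2 1))) x"
    if "n \<le> \<beta> 2" "x $ 2 = node p N 2 (j $ 2 + 1)" for n j x
    using match[OF that(2), of 0 n "\<beta> 3"] that(1) \<beta>m[of 2] by (simp add: mpd_def)
  have match1: "(pd 1 ^^ n) ((pd 2 ^^ \<beta> 2) ((pd 3 ^^ \<beta> 3) (?u j))) x
      = (pd 1 ^^ n) ((pd 2 ^^ \<beta> 2) ((pd 3 ^^ \<beta> 3) (?u (j + axis 1 1)))) x"
    if "n \<le> \<beta> 1" "x $ 1 = node p N 1 (j $ 1 + 1)" for n j x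
    using match[OF that(2), of n "\<beta> 2" "\<beta> 3"] that(1) \<beta>m[of 1] by (simp add: mpd_def)
  have 3: "(pd 3 ^^ \<beta> 3) F x = (pd 3 ^^ \<beta> 3) (?u j) x" if "x \<in> cell p N j" for x j
    by (rule pd_pow_piecewise[where u = ?u]) (fact tp F match3 that)+
  have 2: "(pd 2 ^^ \<beta> 2) ((pd 3 ^^ \<beta> 3) F) x = (pd 2 ^^ \<beta> 2) ((pd 3 ^^ \<beta> 3) (?u j)) x"
    if "x \<in> cell p N j" for x j
    by (rule pd_pow_piecewise[where u = "\<lambda>j. (pd 3 ^^ \<beta> 3) (?u j)"])
       (fact tensor_poly_pd_pow[OF tp] 3 match2 that)+
  have "(pd 1 ^^ \<beta> 1) ((pd 2 ^^ \<beta> 2) ((pd 3 ^^ \<beta> 3) F)) x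
      = (pd 1 ^^ \<beta> 1) ((pd 2 ^^ \<beta> 2) ((pd 3 ^^ \<beta> 3) (?u j))) x"
    by (rule pd_pow_piecewise[where u = "\<lambda>j. (pd 2 ^^ \<beta> 2) ((pd 3 ^^ \<beta> 3) (?u j))"])
       (fact tensor_poly_pd_pow[OF tensor_poly_pd_pow[OF tp]] 2 match1 x)+
  then show ?thesis by (simp add: mderiv_def mpd_def)
qed

lemma interpolates_iff:
  "interpolates m p N f g \<longleftrightarrow> (\<forall>j. \<forall>x\<in>cell p N j. g x = cell_poly m p N (vertex_data p N f) j x)"
proof
  assume *: "interpolates m p N f g"
  show "\<forall>j. \<forall>x\<in>cell p N j. g x = cell_poly m p N (vertex_data p N f) j x"
  proof
    fix j
    obtain u where u: "tensor_poly (2 * m + 1) u" "\<forall>x\<in>cell p N j. g x = u x"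
      "\<forall>i\<in>corners j. \<forall>a\<le>m. \<forall>b\<le>m. \<forall>c\<le>m. mpd a b c u (vertex p N i) = mpd a b c f (vertex p N i)"
      using * unfolding interpolates_def by meson
    have "u = cell_poly m p N (vertex_data p N f) j"
      by (rule cell_poly_unique[OF u(1)]) (use u(3) in \<open>auto simp: vertex_data_def mderiv_def multi_indices_def\<close>)
    then show "\<forall>x\<in>cell p N j. g x = cell_poly m p N (vertex_data p N f) j x" using u(2) by simp
  qed
next
  assume *: "\<forall>j. \<forall>x\<in>cell p N j. g x = cell_poly m p N (vertex_data p N f) j x"
  show "interpolates m p N f g"
    unfolding interpolates_def
  proof (intro allI exI[of _ "cell_poly m p N (vertex_data p N f) j" for j] conjI ballI impI)
    fix j i a b c assume "i \<in> corners j" "a \<le> m" "b \<le> m" "c \<le> m"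
    then show "mpd a b c (cell_poly m p N (vertex_data p N f) j) (vertex p N i) = mpd a b c f (vertex p N i)"
      unfolding mpd_eq_mderiv by (subst mderiv_cell_poly_vertex) (auto simp: vertex_data_def multi_indices_def)
  qed (use * tensor_poly_cell_poly in auto)
qed

text \<open>The cell polynomials agree on common faces, hence glue to a function, and cell by cell there is no other
  candidate.\<close>

lemma HB_eq_cell_poly:
  assumes "x \<in> cell p N j"
  shows "HB m p N f x = cell_poly m p N (vertex_data p N f) j x"
proof -
  define g where "g x = cell_poly m p N (vertex_data p N f) (cell_index p N x) x" for x
  have "g x = cell_poly m p N (vertex_data p N f) j x" if "x \<in> cell p N j" for j x
    using mderiv_cell_poly_neighbour[of "cell_index p N x" j x "\<lambda>_. 0" "vertex_data p N f"] mem_cell_cases[OF that]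
    by (auto simp: g_def mderiv_def mpd_def)
  then have g: "interpolates m p N f g" by (simp add: interpolates_iff)
  have "HB m p N f = g"
    unfolding HB_def
  proof (rule the_equality[where P = "interpolates m p N f", OF g])
    fix h assume "interpolates m p N f h"
    then show "h = g" using g mem_cell_cell_index unfolding interpolates_iff fun_eq_iff by metis
  qed
  then show ?thesis using g assms by (simp add: interpolates_iff)
qed

lemma mderiv_HB:
  assumes "x \<in> cell p N j" "\<beta> \<in> multi_indices m"
  shows "mderiv \<beta> (HB m p N f) x = mderiv \<beta> (cell_poly m p N (vertex_data p N f) j) x"
  using assms by (intro mderiv_piecewise_cell_poly HB_eq_cell_poly)

lemma vertex_mem_cell:
  assumes "i \<in> corners j"
  shows "vertex p N i \<in> cell p N j"
  unfolding mem_cell vertex_node node_le_iff[OF N]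
proof
  fix k
  have "i $ k = j $ k \<or> i $ k = j $ k + 1" using assms by (simp add: corners_def)
  then show "j $ k \<le> i $ k \<and> i $ k \<le> j $ k + 1" by auto
qed

text \<open>Although \<open>HB m p N f\<close> is only piecewise polynomial, its derivatives of order at most \<open>m\<close> in each variable
  exist at the vertices, because they match across the faces.\<close>

lemma vertex_data_HB: "\<beta> \<in> multi_indices m \<Longrightarrow> vertex_data p N (HB m p N f) i \<beta> = vertex_data p N f i \<beta>"
proof -
  assume \<beta>: "\<beta> \<in> multi_indices m"
  have i: "i \<in> corners i" by (simp add: corners_def)
  show ?thesis
    using mderiv_HB[OF vertex_mem_cell[OF i] \<beta>, of f] mderiv_cell_poly_vertex[OF i \<beta>, of "vertex_data p N f"]
    by (simp add: vertex_data_def)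
qed

lemma HB_cong:
  assumes "\<And>i \<beta>. \<beta> \<in> multi_indices m \<Longrightarrow> vertex_data p N f i \<beta> = vertex_data p N g i \<beta>"
  shows "HB m p N f = HB m p N g"
proof
  fix x
  show "HB m p N f x = HB m p N g x"
    unfolding HB_eq_cell_poly[OF mem_cell_cell_index] cell_poly_def using assms by simp
qed

lemma HB_idem: "HB m p N (HB m p N f) = HB m p N f"
  by (rule HB_cong) (rule vertex_data_HB)

end


section \<open>Sums over a period of the grid\<close>

text \<open>Translation by \<open>z\<close> periods, first of points and then of the indices of cells and vertices.\<close>

definition lattice_shift :: "int^3 \<Rightarrow> real^3" where
  "lattice_shift z = (\<chi> k. 2 * pi * of_int (z $ k))"

definition cells_shift :: "nat^3 \<Rightarrow> int^3 \<Rightarrow> int^3" where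
  "cells_shift N z = (\<chi> k. int (N $ k) * z $ k)"

lemma periodic_lattice_shift:
  assumes "periodic F"
  shows "F (x + lattice_shift z) = F x"
proof -
  have step: "F (x + (2 * pi) *\<^sub>R axis k 1) = F x" for x k
    using assms by (simp add: periodic_def)
  have axis_shift: "F (x + (2 * pi * of_int n) *\<^sub>R axis k 1) = F x" for x k n
  proof (induction n rule: int_induct[where k = 0])
    case (step1 n)
    then show ?case
      using step[of "x + (2 * pi * of_int n) *\<^sub>R axis k 1" k] by (simp add: algebra_simps)
  next
    case (step2 n)
    then show ?case
      using step[of "x + (2 * pi * of_int (n - 1)) *\<^sub>R axis k 1" k] by (simp add: algebra_simps)
  qed simp
  have "x + lattice_shift z = x + (2 * pi * of_int (z $ 1)) *\<^sub>R axis 1 1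
      + (2 * pi * of_int (z $ 2)) *\<^sub>R axis 2 1 + (2 * pi * of_int (z $ 3)) *\<^sub>R axis 3 1"
    by (simp add: vec_eq_iff forall_3 lattice_shift_def axis_def)
  then show ?thesis by (simp only: axis_shift)
qed

lemma periodicI: "(\<And>x z. F (x + lattice_shift z) = F x) \<Longrightarrow> periodic F"
proof -
  assume *: "\<And>x z. F (x + lattice_shift z) = F x"
  have "(2 * pi) *\<^sub>R axis k 1 = lattice_shift (axis k 1)" for k
    by (simp add: vec_eq_iff lattice_shift_def axis_def)
  then show ?thesis using * by (simp add: periodic_def)
qed

lemma periodic_mderiv: "periodic f \<Longrightarrow> periodic (mderiv \<alpha> f)"
proof (rule periodicI)
  fix x z assume "periodic f"
  then have "(\<lambda>x. f (x + lattice_shift z)) = f" by (simp add: periodic_lattice_shift fun_eq_iff)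
  then show "mderiv \<alpha> f (x + lattice_shift z) = mderiv \<alpha> f x" using mderiv_shift[of \<alpha> f "lattice_shift z"] by metis
qed

lemma corners_shift: "corners (j + s) = (\<lambda>i. i + s) ` corners j"
proof (intro set_eqI iffI)
  fix i assume "i \<in> corners (j + s)"
  then have "i - s \<in> corners j" by (auto simp: corners_def algebra_simps)
  then show "i \<in> (\<lambda>i. i + s) ` corners j" by (rule rev_image_eqI) simp
qed (auto simp: corners_def)

lemma sum_corners: "(\<Sum>i\<in>corners j. f i) = (\<Sum>\<sigma>\<in>corners 0. f (j + \<sigma>))"
proof -
  have "corners j = (\<lambda>i. i + j) ` corners 0" using corners_shift[of 0 j] by simp
  then show ?thesis by (simp add: sum.reindex add.commute)
qed

text \<open>Reflecting the corners reverses an odd number of signs, namely three.\<close>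

lemma sum_corners_flip:
  "(\<Sum>\<sigma>\<in>corners 0. corner_sign \<sigma> * f \<sigma>) = - (\<Sum>\<sigma>\<in>corners 0. corner_sign \<sigma> * f (1 - \<sigma>))"
proof -
  have "corner_sign (1 - \<sigma>) = - corner_sign \<sigma>" if "\<sigma> \<in> corners 0" for \<sigma>
    using that unfolding corner_sign_def prod_3 by (auto simp: corners_def forall_3)
  moreover have "(\<Sum>\<sigma>\<in>corners 0. corner_sign \<sigma> * f \<sigma>) = (\<Sum>\<sigma>\<in>corners 0. corner_sign (1 - \<sigma>) * f (1 - \<sigma>))"
    by (rule sum.reindex_bij_witness[where i = "\<lambda>\<sigma>. 1 - \<sigma>" and j = "\<lambda>\<sigma>. 1 - \<sigma>"])
       (auto simp: corners_def)
  ultimately show ?thesis by (simp add: sum_negf)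
qed

text \<open>Two corners that differ only in direction \<open>k\<close> carry opposite signs.\<close>

lemma sum_corner_sign_cancel:
  assumes "\<And>\<sigma>. \<sigma> \<in> corners 0 \<Longrightarrow> \<sigma> $ k = 0 \<Longrightarrow> f (\<sigma> + axis k 1) = f \<sigma>"
  shows "(\<Sum>\<sigma>\<in>corners 0. corner_sign \<sigma> *\<^sub>R f \<sigma>) = (0 :: 'a::real_vector)"
proof -
  define S where "S n = {\<sigma> \<in> corners 0. \<sigma> $ k = n}" for n
  have "corners 0 = S 0 \<union> S 1" by (auto simp: S_def corners_def)
  moreover have "finite (S n)" for n unfolding S_def using finite_corners by auto
  moreover have "S 0 \<inter> S 1 = {}" by (auto simp: S_def)
  ultimately have "(\<Sum>\<sigma>\<in>corners 0. corner_sign \<sigma> *\<^sub>R f \<sigma>)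
      = (\<Sum>\<sigma>\<in>S 0. corner_sign \<sigma> *\<^sub>R f \<sigma>) + (\<Sum>\<sigma>\<in>S 1. corner_sign \<sigma> *\<^sub>R f \<sigma>)"
    by (simp add: sum.union_disjoint)
  also have "(\<Sum>\<sigma>\<in>S 1. corner_sign \<sigma> *\<^sub>R f \<sigma>)
      = (\<Sum>\<sigma>\<in>S 0. corner_sign (\<sigma> + axis k 1) *\<^sub>R f (\<sigma> + axis k 1))"
    by (rule sum.reindex_bij_witness[where i = "\<lambda>\<sigma>. \<sigma> + axis k 1" and j = "\<lambda>\<sigma>. \<sigma> - axis k 1"])
       (auto simp: S_def corners_def axis_def)
  also have "\<dots> = (\<Sum>\<sigma>\<in>S 0. - (corner_sign \<sigma> *\<^sub>R f \<sigma>))"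
  proof (rule sum.cong[OF refl])
    fix \<sigma> assume \<sigma>: "\<sigma> \<in> S 0"
    have prod: "(\<Prod>l\<in>UNIV. g l) = g k * (\<Prod>l\<in>UNIV - {k}. g l)" for g :: "3 \<Rightarrow> real"
      by (subst prod.remove[of UNIV k]) auto
    have "corner_sign (\<sigma> + axis k 1) = - corner_sign \<sigma>"
      unfolding corner_sign_def prod using \<sigma> by (simp add: S_def axis_def)
    then show "corner_sign (\<sigma> + axis k 1) *\<^sub>R f (\<sigma> + axis k 1) = - (corner_sign \<sigma> *\<^sub>R f \<sigma>)"
      using assms[of \<sigma>] \<sigma> by (simp add: S_def)
  qed
  finally show ?thesis by (simp add: sum_negf)
qed

text \<open>Representatives of the cells modulo periods.\<close>

definition cells :: "nat^3 \<Rightarrow> (int^3) set" where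
  "cells N = {r. \<forall>k. r $ k \<in> {0..<int (N $ k)}}"

lemma finite_cells: "finite (cells N)"
  unfolding cells_def by (rule finite_vec) simp

text \<open>Reduction of the indices modulo the period permutes the representatives.\<close>

lemma sum_cells_shift:
  assumes N: "\<And>k. N $ k > 0" and h: "\<And>r z. h (r + cells_shift N z) = h r"
  shows "(\<Sum>r\<in>cells N. h (r + s)) = (\<Sum>r\<in>cells N. h r)"
proof -
  define red where "red r = (\<chi> k. r $ k mod int (N $ k))" for r :: "int^3"
  have red: "h (red r) = h r" for r
  proof -
    have "red r + cells_shift N (\<chi> k. r $ k div int (N $ k)) = r"
      by (simp add: vec_eq_iff red_def cells_shift_def)
    then show ?thesis using h by metis
  qed
  have red_add: "red (red r + t) = red (r + t)" for r t
    by (simp add: vec_eq_iff red_def mod_simps)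
  have red_id: "red r = r" if "r \<in> cells N" for r
    using that by (simp add: vec_eq_iff red_def cells_def)
  have red_mem: "red r \<in> cells N" for r
    using N by (simp add: red_def cells_def)
  have "(\<Sum>r\<in>cells N. h (r + s)) = (\<Sum>r\<in>cells N. h (red (r + s)))" by (simp add: red)
  also have "\<dots> = (\<Sum>r\<in>cells N. h r)"
    by (rule sum.reindex_bij_witness[where i = "\<lambda>r. red (r + - s)" and j = "\<lambda>r. red (r + s)"])
       (auto simp: red_mem red_add red_id simp del: add_uminus_conv_diff)
  finally show ?thesis .
qed

section \<open>Integrals over a period\<close>

lemma node_shift:
  assumes "\<And>k. N $ k > 0"
  shows "node p N k (i + int (N $ k) * n) = node p N k i + 2 * pi * of_int n"
proof -
  have "real (N $ k) \<noteq> 0" using assms[of k] by simp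
  then show ?thesis by (simp add: node_def spacing_def field_simps)
qed

lemma vertex_shift:
  assumes "\<And>k. N $ k > 0"
  shows "vertex p N (i + cells_shift N z) = vertex p N i + lattice_shift z"
  by (simp add: vec_eq_iff vertex_node node_shift[OF assms] cells_shift_def lattice_shift_def)

lemma cell_shift:
  assumes "\<And>k. N $ k > 0"
  shows "x + lattice_shift z \<in> cell p N (j + cells_shift N z) \<longleftrightarrow> x \<in> cell p N j"
proof -
  have "node p N k (j $ k + int (N $ k) * n + 1) = node p N k (j $ k + 1) + 2 * pi * of_int n" for k n
    using node_shift[OF assms, of p k "j $ k + 1" n] by (simp add: algebra_simps)
  then show ?thesis
    by (simp add: mem_cell node_shift[OF assms] cells_shift_def lattice_shift_def)
qed

lemma negligible_cell_Int:
  assumes N: "\<And>k. N $ k > 0" and "j \<noteq> j'"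
  shows "negligible (cell p N j \<inter> cell p N j')"
proof -
  obtain k where "j $ k \<noteq> j' $ k" using assms(2) by (auto simp: vec_eq_iff)
  moreover have "negligible (cell p N j \<inter> cell p N j')" if "j $ k < j' $ k" for j j'
  proof (rule negligible_subset)
    show "negligible {x :: real^3. x $ k = node p N k (j' $ k)}"
    proof -
      have "(axis k 1 :: real^3) \<in> Basis" by (auto simp: Basis_vec_def)
      from negligible_standard_hyperplane[OF this, of "node p N k (j' $ k)"]
      show ?thesis by (simp add: inner_axis)
    qed
    have "node p N k (j $ k + 1) \<le> node p N k (j' $ k)" using that by (simp add: node_le_iff[OF N])
    then have "x $ k = node p N k (j' $ k)" if "x \<in> cell p N j" "x \<in> cell p N j'" for x
      using that unfolding mem_cell by (meson order_antisym order_trans)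
    then show "cell p N j \<inter> cell p N j' \<subseteq> {x. x $ k = node p N k (j' $ k)}" by auto
  qed
  ultimately show ?thesis by (metis Int_commute linorder_neqE)
qed

lemma cell_Int_is_cbox: "\<exists>c d. cell p N j \<inter> cell p' N' j' = cbox c d"
  unfolding cell_def Int_interval by blast

lemma integral_split_cells:
  fixes h :: "real^3 \<Rightarrow> real"
  assumes N: "\<And>k. N $ k > 0" and J: "finite J" "cell q M i \<subseteq> (\<Union>j\<in>J. cell p N j)"
    and h: "h integrable_on cell q M i"
  shows "integral (cell q M i) h = (\<Sum>j\<in>J. integral (cell q M i \<inter> cell p N j) h)"
proof -
  have "(h has_integral (\<Sum>j\<in>J. integral (cell q M i \<inter> cell p N j) h)) (\<Union>j\<in>J. cell q M i \<inter> cell p N j)"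
  proof (rule has_integral_UN[OF J(1)])
    fix j
    obtain c d where cd: "cell q M i \<inter> cell p N j = cbox c d" using cell_Int_is_cbox by blast
    then show "(h has_integral integral (cell q M i \<inter> cell p N j) h) (cell q M i \<inter> cell p N j)"
      using integrable_on_subcbox[OF h[unfolded cell_def], of c d, folded cell_def] by (metis Int_lower1 integrable_integral)
  next
    show "pairwise (\<lambda>j j'. negligible (cell q M i \<inter> cell p N j \<inter> (cell q M i \<inter> cell p N j'))) J"
      unfolding pairwise_def by (auto intro: negligible_subset[OF negligible_cell_Int[OF N]])
  qed
  moreover have "(\<Union>j\<in>J. cell q M i \<inter> cell p N j) = cell q M i" using J(2) by blast
  ultimately show ?thesis by (simp add: integral_unique)
qed

lemma integral_translate_cbox:
  fixes h :: "real^3 \<Rightarrow> real"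
  assumes "periodic h"
  shows "integral ((\<lambda>x. x + lattice_shift z) ` cbox a b) h = integral (cbox a b) h"
proof -
  have "(\<lambda>x. x + lattice_shift z) ` cbox a b = cbox (a + lattice_shift z) (b + lattice_shift z)"
    using cbox_translation[of "lattice_shift z" a b] by (simp add: add.commute[of _ "lattice_shift z"])
  then show ?thesis
    using integral_shift_cbox_plus[of a b h "lattice_shift z"] periodic_lattice_shift[OF assms]
    by (simp add: o_def add.commute[of "lattice_shift z"])
qed

text \<open>Both cells are fundamental domains of the period lattice: cut one into its intersections with the
  translates of the other and move the pieces back. These are cells of the grid with one cell per period.\<close>

lemma integral_period_cell:
  fixes h :: "real^3 \<Rightarrow> real"
  assumes h: "periodic h" and int: "\<And>a b. h integrable_on cbox a b"
  shows "integral (cell p 1 0) h = integral (cell 0 1 0) h"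
proof -
  have one: "(1 :: nat^3) $ k > 0" for k by simp
  \<comment> \<open>Large enough that the translates in either direction cover; symmetric, so that they can be exchanged.\<close>
  define K where "K = \<lceil>norm p\<rceil> + 2"
  define Z where "Z = {z :: int^3. \<forall>k. z $ k \<in> {-K..K}}"
  have fin: "finite Z" unfolding Z_def by (rule finite_vec) simp
  have neg: "- z \<in> Z" if "z \<in> Z" for z
    unfolding Z_def
  proof (intro CollectI allI)
    fix k
    have "z $ k \<in> {- K..K}" using that by (simp add: Z_def)
    then show "(- z) $ k \<in> {- K..K}" by auto
  qed
  have cover: "cell q 1 0 \<subseteq> (\<Union>z\<in>Z. cell q' 1 z)" if "\<And>k. \<bar>q $ k - q' $ k\<bar> \<le> \<bar>p $ k\<bar>" for q q'
  proof
    fix x assume x: "x \<in> cell q 1 0"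
    have "cell_index q' 1 x $ k \<in> {-K..K}" for k
    proof -
      have "q $ k \<le> x $ k" "x $ k \<le> q $ k + 2 * pi" using x by (auto simp: mem_cell node_def spacing_def)
      then have "\<bar>x $ k - q' $ k\<bar> \<le> \<bar>p $ k\<bar> + 2 * pi" using that[of k] by linarith
      also have "\<dots> \<le> norm p + 2 * pi" using component_le_norm_cart[of p k] by simp
      also have "\<dots> \<le> 2 * pi * norm p + 2 * pi"
        using mult_right_mono[of 1 "2 * pi" "norm p"] pi_gt3 by simp
      finally have "\<bar>(x $ k - q' $ k) / (2 * pi)\<bar> \<le> norm p + 1" by (simp add: abs_divide field_simps)
      then have "(x $ k - q' $ k) / (2 * pi) \<le> of_int \<lceil>norm p\<rceil> + 1"
        "- (of_int \<lceil>norm p\<rceil> + 1) \<le> (x $ k - q' $ k) / (2 * pi)"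
        using le_of_int_ceiling[of "norm p"] by linarith+
      then have "\<lfloor>(x $ k - q' $ k) / (2 * pi)\<rfloor> \<le> \<lceil>norm p\<rceil> + 1"
         "- (\<lceil>norm p\<rceil> + 1) \<le> \<lfloor>(x $ k - q' $ k) / (2 * pi)\<rfloor>" by linarith+
      then show ?thesis by (simp add: cell_index_def spacing_def K_def)
    qed
    then have "cell_index q' 1 x \<in> Z" by (simp add: Z_def)
    then show "x \<in> (\<Union>z\<in>Z. cell q' 1 z)" using mem_cell_cell_index[OF one] by blast
  qed
  have "integral (cell p 1 0) h = (\<Sum>z\<in>Z. integral (cell p 1 0 \<inter> cell 0 1 z) h)"
    by (rule integral_split_cells[OF one fin cover int[of "vertex p 1 0" "vertex p 1 (\<chi> k. 0 $ k + 1)", folded cell_def]]) simp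
  also have "\<dots> = (\<Sum>z\<in>Z. integral (cell 0 1 0 \<inter> cell p 1 z) h)"
  proof (rule sum.reindex_bij_witness[where i = uminus and j = uminus])
    fix z
    obtain c d where cd: "cell p 1 0 \<inter> cell 0 1 z = cbox c d" using cell_Int_is_cbox by blast
    have shift: "x + lattice_shift (- z) \<in> cell q 1 (j - z) \<longleftrightarrow> x \<in> cell q 1 j" for x q j
    proof -
      have "cells_shift 1 (- z) = - z" by (simp add: vec_eq_iff cells_shift_def)
      then show ?thesis using cell_shift[OF one, of x "- z" q j] by simp
    qed
    have "(\<lambda>x. x + lattice_shift (- z)) ` (cell p 1 0 \<inter> cell 0 1 z) = cell 0 1 0 \<inter> cell p 1 (- z)"
    proof (intro set_eqI iffI)
      fix y assume "y \<in> (\<lambda>x. x + lattice_shift (- z)) ` (cell p 1 0 \<inter> cell 0 1 z)"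
      then show "y \<in> cell 0 1 0 \<inter> cell p 1 (- z)" using shift[of _ p 0] shift[of _ 0 z] by auto
    next
      fix y assume y: "y \<in> cell 0 1 0 \<inter> cell p 1 (- z)"
      then have "y - lattice_shift (- z) \<in> cell p 1 0 \<inter> cell 0 1 z"
        using shift[of "y - lattice_shift (- z)" p 0] shift[of "y - lattice_shift (- z)" 0 z] by simp
      then show "y \<in> (\<lambda>x. x + lattice_shift (- z)) ` (cell p 1 0 \<inter> cell 0 1 z)"
        by (rule rev_image_eqI) simp
    qed
    then show "integral (cell 0 1 0 \<inter> cell p 1 (- z)) h = integral (cell p 1 0 \<inter> cell 0 1 z) h"
      using integral_translate_cbox[OF h, of "- z" c d] cd by simp
  qed (auto intro: neg)
  also have "\<dots> = integral (cell 0 1 0) h"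
    by (rule integral_split_cells[OF one fin cover int[of "vertex 0 1 0" "vertex 0 1 (\<chi> k. 0 $ k + 1)", folded cell_def], symmetric]) simp
  finally show ?thesis .
qed


text \<open>The box of integration need not be aligned with the grid. By periodicity it may be replaced by the box
  that starts at the vertex \<open>p\<close>, and this one is a union of cells. The faces, where \<open>h\<close> is not controlled, are
  negligible.\<close>

lemma integral_box_piecewise:
  fixes h :: "real^3 \<Rightarrow> real"
  assumes N: "\<And>k. N $ k > 0" and h: "periodic h"
    and H: "\<And>j. continuous_on (cell p N j) (H j)"
    and hH: "\<And>j x. x \<in> interior (cell p N j) \<Longrightarrow> h x = H j x"
  shows "(LINT x:cbox 0 (vec (2 * pi))|lebesgue. h x) = (\<Sum>r\<in>cells N. integral (cell p N r) (H r))"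
proof -
  have abs: "h absolutely_integrable_on cell p N j" for j
  proof (rule absolutely_integrable_spike)
    show "H j absolutely_integrable_on cell p N j"
      using H[of j] unfolding cell_def by (rule absolutely_integrable_continuous)
    show "negligible (cell p N j - interior (cell p N j))"
      unfolding cell_def by (simp add: negligible_frontier_interval)
  qed (use hH in auto)
  have eq: "integral (cell p N j) h = integral (cell p N j) (H j)" for j
  proof (rule integral_spike)
    show "negligible (cell p N j - interior (cell p N j))"
      unfolding cell_def by (simp add: negligible_frontier_interval)
  qed (use hH in auto)
  have abs_box: "h absolutely_integrable_on cbox a b" for a b
  proof -
    define J where "J = {j. \<forall>k. j $ k \<in> {cell_index p N a $ k..cell_index p N b $ k}}"
    have "finite J" unfolding J_def by (rule finite_vec) simp
    then have "h absolutely_integrable_on (\<Union>j\<in>J. cell p N j)"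
      by (rule set_integrable_UN[OF _ abs]) (simp add: cell_def)
    moreover have "cbox a b \<subseteq> (\<Union>j\<in>J. cell p N j)"
    proof
      fix x assume x: "x \<in> cbox a b"
      have "cell_index p N y $ k \<le> cell_index p N z $ k" if "y $ k \<le> z $ k" for k y z
        unfolding cell_index_def using that spacing_pos[of N k] N
        by (auto intro!: floor_mono divide_right_mono)
      then have "cell_index p N x \<in> J" using x by (simp add: J_def mem_box_cart)
      then show "x \<in> (\<Union>j\<in>J. cell p N j)" using mem_cell_cell_index[OF N] by blast
    qed
    ultimately show ?thesis
      using set_integrable_subset[of lebesgue "\<Union>j\<in>J. cell p N j" h "cbox a b"] by simp
  qed
  then have int: "h integrable_on cbox a b" for a b
    by (rule set_lebesgue_integral_eq_integral(1))
  have one: "(1 :: nat^3) $ k > 0" for k by simp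
  have node_1: "node p 1 k 0 = p $ k" "node p 1 k 1 = p $ k + 2 * pi" for k p
    by (simp_all add: node_def spacing_def)
  have node_N: "node p N k 0 = p $ k" "node p N k (int (N $ k)) = p $ k + 2 * pi" for k
    using node_shift[OF N, of p k 0 1] by (simp_all add: node_def)
  have "cbox 0 (vec (2 * pi)) = cell 0 1 0"
    by (auto simp: set_eq_iff mem_cell mem_box_cart node_1)
  then have "(LINT x:cbox 0 (vec (2 * pi))|lebesgue. h x) = integral (cell 0 1 0) h"
    using set_lebesgue_integral_eq_integral(2)[OF abs_box[of 0 "vec (2 * pi)"]] by simp
  also have "\<dots> = integral (cell p 1 0) h"
    by (rule integral_period_cell[OF h int, symmetric])
  also have "\<dots> = (\<Sum>r\<in>cells N. integral (cell p 1 0 \<inter> cell p N r) h)"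
  proof (rule integral_split_cells[OF N finite_cells])
    show "h integrable_on cell p 1 0" unfolding cell_def by (rule int)
    show "cell p 1 0 \<subseteq> (\<Union>r\<in>cells N. cell p N r)"
    proof
      fix x assume x: "x \<in> cell p 1 0"
      \<comment> \<open>On an upper boundary of the period the index of the cell would be \<open>N $ k\<close>; the cell before it contains \<open>x\<close> as well.\<close>
      define r where "r = (\<chi> k. min (cell_index p N x $ k) (int (N $ k) - 1))"
      have xk: "node p N k 0 \<le> x $ k" "x $ k \<le> node p N k (int (N $ k))" for k
        using x by (auto simp: mem_cell node_1 node_N)
      have ix: "node p N k (cell_index p N x $ k) \<le> x $ k" "x $ k < node p N k (cell_index p N x $ k + 1)" for k
        using cell_index_bounds[where p = p and x = x and k = k, OF N] by auto
      have "0 < cell_index p N x $ k + 1" for k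
        using le_less_trans[OF xk(1) ix(2)] by (simp add: node_less_iff[OF N])
      then have "r \<in> cells N" using N by (auto simp: r_def cells_def Suc_le_eq)
      moreover have "node p N k (r $ k) \<le> x $ k \<and> x $ k \<le> node p N k (r $ k + 1)" for k
      proof (cases "cell_index p N x $ k \<le> int (N $ k) - 1")
        case True
        then show ?thesis using ix[of k] by (simp add: r_def min_absorb1)
      next
        case False
        have "node p N k (int (N $ k) - 1) \<le> node p N k (cell_index p N x $ k)"
          using False by (simp add: node_le_iff[OF N])
        then show ?thesis using ix[of k] xk[of k] False by (simp add: r_def min_absorb2)
      qed
      ultimately show "x \<in> (\<Union>r\<in>cells N. cell p N r)" by (auto simp: mem_cell)
    qed
  qed
  also have "\<dots> = (\<Sum>r\<in>cells N. integral (cell p N r) (H r))"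
  proof (rule sum.cong[OF refl])
    fix r assume r: "r \<in> cells N"
    have "p $ k \<le> node p N k (r $ k) \<and> node p N k (r $ k + 1) \<le> p $ k + 2 * pi" for k
    proof -
      have "r $ k \<in> {0..<int (N $ k)}" using r by (simp only: cells_def mem_Collect_eq)
      then have "0 \<le> r $ k" "r $ k + 1 \<le> int (N $ k)" by auto
      then have "node p N k 0 \<le> node p N k (r $ k)" "node p N k (r $ k + 1) \<le> node p N k (int (N $ k))"
        unfolding node_le_iff[OF N] by auto
      then show ?thesis by (simp add: node_N)
    qed
    then have "cell p N r \<subseteq> cell p 1 0"
      by (auto simp: mem_cell node_1) (meson order_trans)+
    then show "integral (cell p 1 0 \<inter> cell p N r) h = integral (cell p N r) (H r)"
      by (simp add: Int_absorb1 eq)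
  qed
  finally show ?thesis .
qed


section \<open>The semi-inner product with an interpolant\<close>

text \<open>The translated polynomial has the same vertex data, so uniqueness applies.\<close>

lemma cell_poly_shift:
  assumes N: "\<And>k. N $ k > 0" and f: "periodic f"
  shows "cell_poly m p N (vertex_data p N f) (j + cells_shift N z) (x + lattice_shift z)
       = cell_poly m p N (vertex_data p N f) j x"
proof -
  let ?u = "cell_poly m p N (vertex_data p N f)"
  have "(\<lambda>x. ?u (j + cells_shift N z) (x + lattice_shift z)) = ?u j"
  proof (rule cell_poly_unique[OF N])
    show "tensor_poly (2 * m + 1) (\<lambda>x. ?u (j + cells_shift N z) (x + lattice_shift z))"
      by (intro tensor_poly_shift tensor_poly_cell_poly N)
    fix i \<beta> assume i: "i \<in> corners j" and \<beta>: "\<beta> \<in> multi_indices m"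
    have "i + cells_shift N z \<in> corners (j + cells_shift N z)" using i by (simp add: corners_def)
    then have "mderiv \<beta> (?u (j + cells_shift N z)) (vertex p N (i + cells_shift N z))
        = vertex_data p N f (i + cells_shift N z) \<beta>"
      by (intro mderiv_cell_poly_vertex N \<beta>)
    then show "mderiv \<beta> (\<lambda>x. ?u (j + cells_shift N z) (x + lattice_shift z)) (vertex p N i) = vertex_data p N f i \<beta>"
      using periodic_lattice_shift[OF periodic_mderiv[OF f], of \<beta> "vertex p N i" z]
      by (simp add: mderiv_shift vertex_data_def vertex_shift[OF N])
  qed
  then show ?thesis by (rule fun_cong)
qed

lemma periodic_HB:
  assumes N: "\<And>k. N $ k > 0" and f: "periodic f"
  shows "periodic (HB m p N f)"
proof (rule periodicI)
  fix x z
  have x: "x \<in> cell p N (cell_index p N x)" by (rule mem_cell_cell_index[OF N])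
  then have "x + lattice_shift z \<in> cell p N (cell_index p N x + cells_shift N z)"
    by (simp add: cell_shift[OF N])
  then show "HB m p N f (x + lattice_shift z) = HB m p N f x"
    using HB_eq_cell_poly[OF N x] HB_eq_cell_poly[OF N, of "x + lattice_shift z" p] cell_poly_shift[OF N f]
    by metis
qed

lemma HB_spaceD:
  assumes "\<And>k. N $ k > 0" "F \<in> HB_space m p N"
  shows "periodic F" "HB m p N F = F"
  using assms by (auto simp: HB_space_def HB_idem periodic_HB)

text \<open>The contribution of one block to the semi-inner product of two fields.\<close>

definition period_inner :: "nat \<Rightarrow> (real^3 \<Rightarrow> 'a::euclidean_space) \<Rightarrow> (real^3 \<Rightarrow> 'a) \<Rightarrow> real" where
  "period_inner m F G = (LINT x:cbox 0 (vec (2 * pi))|lebesgue. mderiv (\<lambda>_. m + 1) F x \<bullet> mderiv (\<lambda>_. m + 1) G x)"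

lemma HB_inner_eq: "HB_inner m S F G = (\<Sum>a\<in>S. period_inner m (F a) (G a))"
  by (simp add: HB_inner_def period_inner_def mderiv_def)

lemma period_inner_cells:
  assumes N: "\<And>k. N $ k > 0"
    and F: "periodic F" "\<And>j. tensor_poly (2 * m + 1) (u j)" "\<And>j x. x \<in> cell p N j \<Longrightarrow> F x = u j x"
    and G: "periodic G" "\<And>j. tensor_poly (2 * m + 1) (w j)" "\<And>j x. x \<in> cell p N j \<Longrightarrow> G x = w j x"
  shows "period_inner m F G
    = (\<Sum>r\<in>cells N. \<Sum>i\<in>corners r. corner_sign (i - r) * concomitant3 (m + 1) m (vertex p N i) (u r) (w r))"
proof -
  let ?D = "mderiv (\<lambda>_::3. m + 1)"
  have "period_inner m F G = (\<Sum>r\<in>cells N. integral (cell p N r) (\<lambda>x. ?D (u r) x \<bullet> ?D (w r) x))"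
    unfolding period_inner_def
  proof (rule integral_box_piecewise[OF N])
    show "periodic (\<lambda>x. ?D F x \<bullet> ?D G x)"
      using periodic_mderiv[OF F(1)] periodic_mderiv[OF G(1)] unfolding periodic_def by metis
    show "continuous_on (cell p N j) (\<lambda>x. ?D (u j) x \<bullet> ?D (w j) x)" for j
      by (intro continuous_on_inner continuous_on_tensor_poly[OF tensor_poly_mderiv[OF F(2)]]
          continuous_on_tensor_poly[OF tensor_poly_mderiv[OF G(2)]])
    fix j x assume x: "x \<in> interior (cell p N j)"
    have "?D F x = ?D (u j) x" "?D G x = ?D (w j) x"
      using F(3)[OF subsetD[OF interior_subset]] G(3)[OF subsetD[OF interior_subset]]
      by (intro mderiv_local[OF open_interior _ x]; blast)+
    then show "?D F x \<bullet> ?D G x = ?D (u j) x \<bullet> ?D (w j) x" by simp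
  qed
  also have "\<dots> = (\<Sum>r\<in>cells N. \<Sum>i\<in>corners r. corner_sign (i - r) * concomitant3 (m + 1) m (vertex p N i) (u r) (w r))"
    by (intro sum.cong refl integral_cell N F(2) G(2))
  finally show ?thesis .
qed

text \<open>The summands of the skew form in which some derivative of \<open>v\<close> has order at most \<open>m\<close> vanish at \<open>x\<close>. The others
  are the summands of the boundary form, with \<open>\<kappa>\<close> shifted by \<open>m + 1\<close> in each direction.\<close>

lemma concomitant3_half:
  assumes "\<And>\<kappa> k. \<kappa> k \<le> m \<Longrightarrow> mderiv \<kappa> v x = 0"
  shows "concomitant3 (m + 1) m x v w = (-1) ^ (3 * (m + 1)) * concomitant3 0 (2 * m + 1) x v w"
proof -
  let ?t = "\<lambda>\<kappa>::3 \<Rightarrow> nat. (\<Prod>k\<in>UNIV. (-1) ^ \<kappa> k) * (mderiv \<kappa> v x \<bullet> mderiv (\<lambda>k. 2 * m + 1 - \<kappa> k) w x)"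
  have "concomitant3 0 (2 * m + 1) x v w = (\<Sum>\<kappa>\<in>{\<kappa>\<in>multi_indices (2 * m + 1). \<forall>k. m < \<kappa> k}. ?t \<kappa>)"
    unfolding concomitant3_def add_0
  proof (rule sum.mono_neutral_right[OF finite_multi_indices])
    show "\<forall>\<kappa>\<in>multi_indices (2 * m + 1) - {\<kappa>\<in>multi_indices (2 * m + 1). \<forall>k. m < \<kappa> k}. ?t \<kappa> = 0"
    proof
      fix \<kappa> assume "\<kappa> \<in> multi_indices (2 * m + 1) - {\<kappa>\<in>multi_indices (2 * m + 1). \<forall>k. m < \<kappa> k}"
      then obtain k where "\<kappa> k \<le> m" by (auto simp: not_less)
      then show "?t \<kappa> = 0" by (simp add: assms)
    qed
  qed auto
  also have "\<dots> = (\<Sum>\<kappa>\<in>multi_indices m. (-1) ^ (3 * (m + 1)) * ((\<Prod>k\<in>UNIV. (-1) ^ \<kappa> k)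
     * (mderiv (\<lambda>k. m + 1 + \<kappa> k) v x \<bullet> mderiv (\<lambda>k. m - \<kappa> k) w x)))"
  proof (rule sum.reindex_bij_witness[where j = "\<lambda>\<kappa> k. \<kappa> k - (m + 1)" and i = "\<lambda>\<kappa> k. m + 1 + \<kappa> k"])
    fix \<kappa> assume \<kappa>: "\<kappa> \<in> {\<kappa> \<in> multi_indices (2 * m + 1). \<forall>k. m < \<kappa> k}"
    define l where "l k = \<kappa> k - (m + 1)" for k
    have \<kappa>l: "\<kappa> = (\<lambda>k. m + 1 + l k)"
    proof
      fix k
      have "m < \<kappa> k" using \<kappa> by simp
      then show "\<kappa> k = m + 1 + l k" by (simp add: l_def)
    qed
    have "(\<Prod>k\<in>(UNIV :: 3 set). (-1::real) ^ (m + 1)) = (-1) ^ (3 * (m + 1))"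
      unfolding prod_constant power_mult[symmetric] by (simp add: mult.commute)
    then have "(\<Prod>k\<in>UNIV. (-1::real) ^ \<kappa> k) = (-1) ^ (3 * (m + 1)) * (\<Prod>k\<in>UNIV. (-1) ^ l k)"
      unfolding \<kappa>l power_add[of _ "m + 1"] prod.distrib by (simp only:)
    moreover have "(\<lambda>k. 2 * m + 1 - \<kappa> k) = (\<lambda>k. m - l k)" unfolding \<kappa>l by (auto simp: fun_eq_iff)
    ultimately show "(-1) ^ (3 * (m + 1)) * ((\<Prod>k\<in>UNIV. (-1) ^ (\<kappa> k - (m + 1)))
     * (mderiv (\<lambda>k. m + 1 + (\<kappa> k - (m + 1))) v x \<bullet> mderiv (\<lambda>k. m - (\<kappa> k - (m + 1))) w x)) = ?t \<kappa>"
      unfolding l_def[symmetric] \<kappa>l[symmetric] by simp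
  next
    fix \<kappa> assume "\<kappa> \<in> {\<kappa> \<in> multi_indices (2 * m + 1). \<forall>k. m < \<kappa> k}"
    then have bound: "m < \<kappa> k" "\<kappa> k \<le> 2 * m + 1" for k by (auto simp: multi_indices_def)
    show "(\<lambda>k. m + 1 + (\<kappa> k - (m + 1))) = \<kappa>"
    proof
      fix k show "m + 1 + (\<kappa> k - (m + 1)) = \<kappa> k" using bound[of k] by linarith
    qed
    show "(\<lambda>k. \<kappa> k - (m + 1)) \<in> multi_indices m"
      unfolding multi_indices_def
    proof (intro CollectI allI)
      fix k show "\<kappa> k - (m + 1) \<le> m" using bound[of k] by linarith
    qed
  qed (auto simp: multi_indices_def)
  finally have "concomitant3 0 (2 * m + 1) x v w = (-1) ^ (3 * (m + 1)) * concomitant3 (m + 1) m x v w"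
    by (simp add: concomitant3_def sum_distrib_left)
  then show ?thesis by (simp add: power_mult_distrib[symmetric] mult.assoc[symmetric] power_add[symmetric])
qed

lemma tensor_poly_scale: "tensor_poly d f \<Longrightarrow> tensor_poly d (\<lambda>x. r *\<^sub>R f x)"
  by (rule tensor_poly_bounded_linear[OF bounded_linear_scaleR_right])

text \<open>The signed sum of the polynomials of the eight cells around a vertex is a jump in all three directions.
  A derivative with order at most \<open>m\<close> in some direction agrees on cells that are neighbours in that direction,
  so it has no such jump. This allows passing from the boundary form, which involves only the vertex data
  of \<open>f\<close>, to the skew form, in which the point is immaterial.\<close>

lemma concomitant3_vertex_jump:
  fixes D :: "int^3 \<Rightarrow> (3 \<Rightarrow> nat) \<Rightarrow> 'a::euclidean_space" and p :: "real^3" and N :: "nat^3" and m :: nat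
  assumes N: "\<And>k. N $ k > 0" and f: "tensor_poly (2 * m + 1) f"
  defines "u \<equiv> cell_poly m p N D"
  shows "(\<Sum>\<sigma>\<in>corners 0. corner_sign \<sigma> * concomitant3 (m + 1) m (vertex p N i) (u (i - \<sigma>)) f)
       = (-1) ^ (3 * (m + 1)) * (\<Sum>\<sigma>\<in>corners 0. corner_sign \<sigma> * concomitant3 0 (2 * m + 1) (vertex p N i) (u (i - \<sigma>)) f)"
proof -
  define v where "v = (\<lambda>x. \<Sum>\<sigma>\<in>corners 0. corner_sign \<sigma> *\<^sub>R u (i - \<sigma>) x)"
  have tp: "tensor_poly (2 * m + 1) (u j)" for j unfolding u_def by (rule tensor_poly_cell_poly[OF N])
  note tps = tensor_poly_scale[OF tp]
  have conc: "(\<Sum>\<sigma>\<in>corners 0. corner_sign \<sigma> * concomitant3 a n x (u (i - \<sigma>)) f) = concomitant3 a n x v f" for a n x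
    unfolding v_def by (simp add: concomitant3_sum_left[OF tps] concomitant3_scale(1)[OF tp f])
  have "mderiv \<kappa> v (vertex p N i) = 0" if "\<kappa> k \<le> m" for \<kappa> k
  proof -
    have "mderiv \<kappa> v (vertex p N i) = (\<Sum>\<sigma>\<in>corners 0. corner_sign \<sigma> *\<^sub>R mderiv \<kappa> (u (i - \<sigma>)) (vertex p N i))"
      unfolding v_def by (simp add: mderiv_sum[OF tps] mderiv_bounded_linear[OF bounded_linear_scaleR_right tp])
    also have "\<dots> = 0"
    proof (rule sum_corner_sign_cancel[where k = k])
      fix \<sigma> :: "int^3" assume \<sigma>: "\<sigma> \<in> corners 0" "\<sigma> $ k = 0"
      show "mderiv \<kappa> (u (i - (\<sigma> + axis k 1))) (vertex p N i) = mderiv \<kappa> (u (i - \<sigma>)) (vertex p N i)"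
        unfolding u_def
        by (rule mderiv_cell_poly_neighbour[OF N]) (use \<sigma> that in \<open>auto simp: axis_def vertex_node\<close>)
    qed
    finally show ?thesis .
  qed
  then show ?thesis unfolding conc by (rule concomitant3_half)
qed

text \<open>The boundary terms of all cells are collected at the vertices. The interpolant of \<open>G\<close> enters through its
  data there, so each \<open>f i\<close> can be any polynomial with the same data at the vertex \<open>i\<close>, whatever \<open>G\<close> does
  elsewhere.\<close>

theorem period_inner_HB:
  assumes N: "\<And>k. N $ k > 0" and F: "periodic F" "HB m p N F = F" and G: "periodic G"
    and f: "\<And>i. tensor_poly (2 * m + 1) (f i)"
      "\<And>i \<beta>. \<beta> \<in> multi_indices m \<Longrightarrow> mderiv \<beta> (f i) (vertex p N i) = mderiv \<beta> G (vertex p N i)"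
  shows "period_inner m F (HB m p N G) = (-1) ^ (3 * (m + 1)) * (\<Sum>i\<in>cells N. \<Sum>\<sigma>\<in>corners 0.
     corner_sign \<sigma> * concomitant3 0 (2 * m + 1) 0 (cell_poly m p N (vertex_data p N F) (i - \<sigma>)) (f i))"
proof -
  define u where "u = cell_poly m p N (vertex_data p N F)"
  define w where "w = cell_poly m p N (vertex_data p N G)"
  define B where "B r i = (\<Sum>\<kappa>\<in>multi_indices m. (\<Prod>k\<in>UNIV. (-1) ^ \<kappa> k)
     * (mderiv (\<lambda>k. m + 1 + \<kappa> k) (u r) (vertex p N i) \<bullet> mderiv (\<lambda>k. m - \<kappa> k) G (vertex p N i)))" for r i
  have tu: "tensor_poly (2 * m + 1) (u j)" and tw: "tensor_poly (2 * m + 1) (w j)" for j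
    unfolding u_def w_def by (rule tensor_poly_cell_poly[OF N])+
  have Bw: "concomitant3 (m + 1) m (vertex p N i) (u r) (w r) = B r i" if "i \<in> corners r" for i r
    unfolding concomitant3_def B_def w_def
    by (intro sum.cong refl, subst mderiv_cell_poly_vertex[OF N that])
       (auto simp: multi_indices_def vertex_data_def)
  have Bf: "B r i = concomitant3 (m + 1) m (vertex p N i) (u r) (f i)" for r i
    unfolding concomitant3_def B_def
    by (intro sum.cong refl, subst f(2)) (auto simp: multi_indices_def)
  have B_shift: "B (r + cells_shift N z) (i + cells_shift N z) = B r i" for r i z
  proof -
    have "mderiv \<alpha> (u (r + cells_shift N z)) (x + lattice_shift z) = mderiv \<alpha> (u r) x" for \<alpha> x
    proof -
      have "(\<lambda>x. u (r + cells_shift N z) (x + lattice_shift z)) = u r"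
        unfolding u_def using cell_poly_shift[OF N F(1)] by (rule ext)
      then show ?thesis
        using fun_cong[OF mderiv_shift[of \<alpha> "u (r + cells_shift N z)" "lattice_shift z"], of x] by simp
    qed
    then show ?thesis
      unfolding B_def vertex_shift[OF N]
      by (simp add: periodic_lattice_shift[OF periodic_mderiv[OF G]])
  qed
  have "period_inner m F (HB m p N G)
      = (\<Sum>r\<in>cells N. \<Sum>i\<in>corners r. corner_sign (i - r) * concomitant3 (m + 1) m (vertex p N i) (u r) (w r))"
  proof (rule period_inner_cells[OF N F(1) tu _ periodic_HB[OF N G] tw])
    fix j x assume x: "x \<in> cell p N j"
    show "F x = u j x" unfolding u_def using HB_eq_cell_poly[OF N x, of m F] F(2) by simp
    show "HB m p N G x = w j x" unfolding w_def by (rule HB_eq_cell_poly[OF N x])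
  qed
  also have "\<dots> = (\<Sum>r\<in>cells N. \<Sum>i\<in>corners r. corner_sign (i - r) * B r i)"
    by (intro sum.cong refl arg_cong2[of _ _ _ _ "(*)"] Bw)
  also have "\<dots> = (\<Sum>r\<in>cells N. \<Sum>\<sigma>\<in>corners 0. corner_sign \<sigma> * B r (r + \<sigma>))"
    by (subst sum_corners) simp
  also have "\<dots> = (\<Sum>\<sigma>\<in>corners 0. corner_sign \<sigma> * (\<Sum>r\<in>cells N. B r (r + \<sigma>)))"
    unfolding sum_distrib_left by (rule sum.swap)
  also have "\<dots> = (\<Sum>\<sigma>\<in>corners 0. corner_sign \<sigma> * (\<Sum>i\<in>cells N. B (i - \<sigma>) i))"
  proof (rule sum.cong[OF refl])
    fix \<sigma> :: "int^3"
    have "B (r + cells_shift N z) (r + cells_shift N z + \<sigma>) = B r (r + \<sigma>)" for r z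
      using B_shift[of r z "r + \<sigma>"] by (simp add: algebra_simps)
    from sum_cells_shift[OF N this, of "- \<sigma>"]
    show "corner_sign \<sigma> * (\<Sum>r\<in>cells N. B r (r + \<sigma>)) = corner_sign \<sigma> * (\<Sum>i\<in>cells N. B (i - \<sigma>) i)"
      by simp
  qed
  also have "\<dots> = (\<Sum>i\<in>cells N. \<Sum>\<sigma>\<in>corners 0. corner_sign \<sigma> * concomitant3 (m + 1) m (vertex p N i) (u (i - \<sigma>)) (f i))"
    unfolding sum_distrib_left Bf by (rule sum.swap)
  also have "\<dots> = (\<Sum>i\<in>cells N. (-1) ^ (3 * (m + 1)) * (\<Sum>\<sigma>\<in>corners 0. corner_sign \<sigma> *
      concomitant3 0 (2 * m + 1) (vertex p N i) (u (i - \<sigma>)) (f i)))"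
    unfolding u_def by (intro sum.cong refl concomitant3_vertex_jump N f(1))
  also have "\<dots> = (-1) ^ (3 * (m + 1)) * (\<Sum>i\<in>cells N. \<Sum>\<sigma>\<in>corners 0. corner_sign \<sigma> *
      concomitant3 0 (2 * m + 1) 0 (u (i - \<sigma>)) (f i))"
    unfolding sum_distrib_left[symmetric]
    by (intro sum.cong refl arg_cong2[of _ _ _ _ "(*)"] concomitant3_const tu f(1))
  finally show ?thesis unfolding u_def .
qed


section \<open>Adjointness of the evolution operators\<close>

text \<open>Transposes are kept, because \<open>op_V\<close> is written with them.\<close>

declare transpose_matrix_vector [simp del]

lemma op_W_alt: "op_W P w a = (\<lambda>x. \<Sum>b\<in>W_blocks P.
    (\<Sum>k\<in>UNIV. A_mat P k a b *v pd k (w b) x) + M_mat P a b *v w b x)"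
  by (simp add: op_W_def fun_eq_iff)

lemma op_V_alt: "op_V P v b = (\<lambda>x. \<Sum>a\<in>V_blocks P.
    (\<Sum>k\<in>UNIV. transpose (A_mat P k a b) *v pd k (v a) x) + (- transpose (M_mat P a b)) *v v a x)"
  by (simp add: op_V_def fun_eq_iff matrix_vector_mult_minus)

lemma tensor_poly_matrix: "tensor_poly d f \<Longrightarrow> tensor_poly d (\<lambda>x. A *v f x)" for A :: "real^3^3"
  by (rule tensor_poly_bounded_linear[OF matrix_vector_mul_bounded_linear])

lemma tensor_poly_op_W:
  "(\<And>b. b \<in> W_blocks P \<Longrightarrow> tensor_poly d (w b)) \<Longrightarrow> tensor_poly d (op_W P w a)"
  unfolding op_W_alt by (intro tensor_poly_sum tensor_poly_add tensor_poly_matrix tensor_poly_pd)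

lemma tensor_poly_op_V:
  "(\<And>a. a \<in> V_blocks P \<Longrightarrow> tensor_poly d (v a)) \<Longrightarrow> tensor_poly d (op_V P v b)"
  unfolding op_V_alt by (intro tensor_poly_sum tensor_poly_add tensor_poly_matrix tensor_poly_pd)

lemma concomitant3_matrix:
  fixes A :: "real^3^3"
  assumes "tensor_poly d v" "tensor_poly d w"
  shows "concomitant3 a n x v (\<lambda>x. A *v w x) = concomitant3 a n x (\<lambda>x. transpose A *v v x) w"
  by (rule concomitant3_adjoint[symmetric, OF matrix_vector_mul_bounded_linear matrix_vector_mul_bounded_linear _ assms])
     (simp add: transpose_matrix_vector dot_lmul_matrix)

lemma concomitant3_matrix_pd:
  fixes A :: "real^3^3"
  assumes "tensor_poly n v" "tensor_poly n w"
  shows "concomitant3 0 n x v (\<lambda>x. A *v pd k w x) = - concomitant3 0 n x (\<lambda>x. transpose A *v pd k v x) w"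
proof -
  have "concomitant3 0 n x v (\<lambda>x. A *v pd k w x) = concomitant3 0 n x (\<lambda>x. transpose A *v v x) (pd k w)"
    using assms by (intro concomitant3_matrix tensor_poly_pd)
  also have "\<dots> = - concomitant3 0 n x (pd k (\<lambda>x. transpose A *v v x)) w"
    using concomitant3_pd[OF tensor_poly_matrix[OF assms(1)] assms(2)] by simp
  also have "pd k (\<lambda>x. transpose A *v v x) = (\<lambda>x. transpose A *v pd k v x)"
    using assms(1) by (intro pd_bounded_linear matrix_vector_mul_bounded_linear)
  finally show ?thesis .
qed

text \<open>Derivatives are skew for the form and a matrix moves to the other argument as its transpose. The
  zeroth-order part of \<open>op_V\<close> has the opposite sign, so \<open>- op_V\<close> is the formal adjoint of \<open>op_W\<close>.\<close>

lemma concomitant3_op_W: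
  assumes v: "\<And>a. a \<in> V_blocks P \<Longrightarrow> tensor_poly n (v a)"
    and w: "\<And>b. b \<in> W_blocks P \<Longrightarrow> tensor_poly n (w b)"
  shows "(\<Sum>a\<in>V_blocks P. concomitant3 0 n x (v a) (op_W P w a)) = - (\<Sum>b\<in>W_blocks P. concomitant3 0 n x (op_V P v b) (w b))"
proof -
  define c where "c a b = (\<Sum>k\<in>UNIV. concomitant3 0 n x (v a) (\<lambda>x. A_mat P k a b *v pd k (w b) x))
     + concomitant3 0 n x (v a) (\<lambda>x. M_mat P a b *v w b x)" for a b
  have W: "concomitant3 0 n x (v a) (op_W P w a) = (\<Sum>b\<in>W_blocks P. c a b)" for a
  proof -
    have "concomitant3 0 n x (v a) (op_W P w a) = (\<Sum>b\<in>W_blocks P. concomitant3 0 n x (v a) (\<lambda>x.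
        (\<Sum>k\<in>UNIV. A_mat P k a b *v pd k (w b) x) + M_mat P a b *v w b x))"
      unfolding op_W_alt
      by (intro concomitant3_sum_right[where d = n] tensor_poly_sum tensor_poly_add tensor_poly_matrix tensor_poly_pd w)
    also have "\<dots> = (\<Sum>b\<in>W_blocks P. c a b)"
    proof (rule sum.cong[OF refl])
      fix b assume b: "b \<in> W_blocks P"
      have t: "tensor_poly n (\<lambda>x. A_mat P k a b *v pd k (w b) x)" for k
        by (intro tensor_poly_matrix tensor_poly_pd w b)
      show "concomitant3 0 n x (v a) (\<lambda>x. (\<Sum>k\<in>UNIV. A_mat P k a b *v pd k (w b) x) + M_mat P a b *v w b x) = c a b"
        unfolding c_def
        by (subst concomitant3_add_right[OF tensor_poly_sum[OF t] tensor_poly_matrix[OF w[OF b]]])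
           (simp add: concomitant3_sum_right[OF t])
    qed
    finally show ?thesis .
  qed
  have V: "concomitant3 0 n x (op_V P v b) (w b) = (\<Sum>a\<in>V_blocks P. - c a b)" if b: "b \<in> W_blocks P" for b
  proof -
    have "concomitant3 0 n x (op_V P v b) (w b) = (\<Sum>a\<in>V_blocks P. concomitant3 0 n x (\<lambda>x.
        (\<Sum>k\<in>UNIV. transpose (A_mat P k a b) *v pd k (v a) x) + (- transpose (M_mat P a b)) *v v a x) (w b))"
      unfolding op_V_alt
      by (intro concomitant3_sum_left[where d = n] tensor_poly_sum tensor_poly_add tensor_poly_matrix tensor_poly_pd v)
    also have "\<dots> = (\<Sum>a\<in>V_blocks P. - c a b)"
    proof (rule sum.cong[OF refl])
      fix a assume a: "a \<in> V_blocks P"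
      have t: "tensor_poly n (\<lambda>x. transpose (A_mat P k a b) *v pd k (v a) x)" for k
        by (intro tensor_poly_matrix tensor_poly_pd v a)
      have m: "concomitant3 0 n x (\<lambda>x. (- transpose (M_mat P a b)) *v v a x) (w b)
          = - concomitant3 0 n x (v a) (\<lambda>x. M_mat P a b *v w b x)"
        using concomitant3_scale(1)[OF tensor_poly_matrix[OF v[OF a], of "transpose (M_mat P a b)"] w[OF b], of 0 n x "-1"]
        by (simp add: matrix_vector_mult_minus concomitant3_matrix[OF v[OF a] w[OF b]])
      show "concomitant3 0 n x (\<lambda>x. (\<Sum>k\<in>UNIV. transpose (A_mat P k a b) *v pd k (v a) x)
          + (- transpose (M_mat P a b)) *v v a x) (w b) = - c a b"
        unfolding c_def
        by (subst concomitant3_add_left[OF tensor_poly_sum[OF t] tensor_poly_matrix[OF v[OF a]]])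
           (simp add: concomitant3_sum_left[OF t] m concomitant3_matrix_pd[OF v[OF a] w[OF b]] sum_negf)
    qed
    finally show ?thesis .
  qed
  have "(\<Sum>b\<in>W_blocks P. concomitant3 0 n x (op_V P v b) (w b)) = - (\<Sum>b\<in>W_blocks P. \<Sum>a\<in>V_blocks P. c a b)"
    by (simp add: V sum_negf)
  then show ?thesis by (simp add: W) (rule sum.swap)
qed

text \<open>The skew symmetry of the form for odd \<open>n\<close> exchanges the roles of the two operators.\<close>

lemma concomitant3_op_V:
  assumes "odd n" "\<And>a. a \<in> V_blocks P \<Longrightarrow> tensor_poly n (v a)" "\<And>b. b \<in> W_blocks P \<Longrightarrow> tensor_poly n (w b)"
  shows "(\<Sum>b\<in>W_blocks P. concomitant3 0 n x (w b) (op_V P v b)) = - (\<Sum>a\<in>V_blocks P. concomitant3 0 n x (op_W P w a) (v a))"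
proof -
  have commute: "concomitant3 0 n x f g = - concomitant3 0 n x g f" for f g :: "real^3 \<Rightarrow> real^3"
    using concomitant3_commute[of n x f g] assms(1) by simp
  have "(\<Sum>b\<in>W_blocks P. concomitant3 0 n x (w b) (op_V P v b)) = - (\<Sum>b\<in>W_blocks P. concomitant3 0 n x (op_V P v b) (w b))"
    by (subst commute) (simp add: sum_negf)
  also have "\<dots> = (\<Sum>a\<in>V_blocks P. concomitant3 0 n x (v a) (op_W P w a))"
    using concomitant3_op_W[OF assms(2,3), where x = x] by simp
  also have "\<dots> = - (\<Sum>a\<in>V_blocks P. concomitant3 0 n x (op_W P w a) (v a))"
    by (subst commute) (simp add: sum_negf)
  finally show ?thesis .
qed

text \<open>An odd number of operators changes sides, each with a minus sign.\<close>

lemma concomitant3_op_iterate: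
  assumes "odd n" and v: "\<And>a. a \<in> V_blocks P \<Longrightarrow> tensor_poly n (v a)"
    and w: "\<And>b. b \<in> W_blocks P \<Longrightarrow> tensor_poly n (w b)"
  shows "(\<Sum>a\<in>V_blocks P. concomitant3 0 n x (v a) (((\<lambda>F. op_W P (op_V P F)) ^^ l) (op_W P w) a))
       = - (\<Sum>b\<in>W_blocks P. concomitant3 0 n x (((\<lambda>F. op_V P (op_W P F)) ^^ l) (op_V P v) b) (w b))"
  using v
proof (induction l arbitrary: v)
  case 0
  then show ?case using concomitant3_op_W[OF 0 w] by simp
next
  case (Suc l)
  define u where "u = ((\<lambda>F. op_W P (op_V P F)) ^^ l) (op_W P w)"
  have u: "tensor_poly n (u a)" for a
    unfolding u_def
    by (induction l arbitrary: a) (auto intro: tensor_poly_op_W tensor_poly_op_V w)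
  have "(\<Sum>a\<in>V_blocks P. concomitant3 0 n x (v a) (op_W P (op_V P u) a))
      = - (\<Sum>b\<in>W_blocks P. concomitant3 0 n x (op_V P v b) (op_V P u b))"
    by (intro concomitant3_op_W Suc.prems tensor_poly_op_V u)
  also have "\<dots> = (\<Sum>a\<in>V_blocks P. concomitant3 0 n x (op_W P (op_V P v) a) (u a))"
    by (subst concomitant3_op_V[OF assms(1)]) (auto intro: tensor_poly_op_V Suc.prems u)
  also have "\<dots> = - (\<Sum>b\<in>W_blocks P.
      concomitant3 0 n x (((\<lambda>F. op_V P (op_W P F)) ^^ l) (op_V P (op_W P (op_V P v))) b) (w b))"
    unfolding u_def by (intro Suc.IH tensor_poly_op_W tensor_poly_op_V Suc.prems)
  finally have "(\<Sum>a\<in>V_blocks P. concomitant3 0 n x (v a) (op_W P (op_V P u) a)) = \<dots>" .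
  moreover have "((\<lambda>F. op_V P (op_W P F)) ^^ Suc l) (op_V P v)
      = ((\<lambda>F. op_V P (op_W P F)) ^^ l) (op_V P (op_W P (op_V P v)))"
    by (simp only: funpow_Suc_right o_apply)
  moreover have "((\<lambda>F. op_W P (op_V P F)) ^^ Suc l) (op_W P w) = op_W P (op_V P u)"
    by (simp add: u_def)
  ultimately show ?case by (simp only:)
qed

lemma tensor_poly_B_iterate:
  "(\<And>b. b \<in> W_blocks P \<Longrightarrow> tensor_poly d (w b))
    \<Longrightarrow> tensor_poly d (((\<lambda>F. op_W P (op_V P F)) ^^ l) (op_W P w) a)"
  by (induction l arbitrary: a) (auto intro: tensor_poly_op_W tensor_poly_op_V)

lemma tensor_poly_Bstar_iterate:
  "(\<And>a. a \<in> V_blocks P \<Longrightarrow> tensor_poly d (v a))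
    \<Longrightarrow> tensor_poly d (((\<lambda>F. op_V P (op_W P F)) ^^ l) (op_V P v) b)"
  by (induction l arbitrary: b) (auto intro: tensor_poly_op_W tensor_poly_op_V)

lemma evol_B_alt: "evol_B P dt q w a = (\<lambda>x. \<Sum>l=1..q. (2 * ((dt/2) ^ (2*l-1) / fact (2*l-1))) *\<^sub>R
    ((\<lambda>F. op_W P (op_V P F)) ^^ (l-1)) (op_W P w) a x)"
  by (simp add: evol_B_def scaleR_sum_right)

lemma evol_Bstar_alt: "evol_Bstar P dt q v b = (\<lambda>x. \<Sum>l=1..q. (- (2 * ((dt/2) ^ (2*l-1) / fact (2*l-1)))) *\<^sub>R
    ((\<lambda>F. op_V P (op_W P F)) ^^ (l-1)) (op_V P v) b x)"
  by (simp add: evol_Bstar_def scaleR_sum_right sum_negf)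

lemma tensor_poly_evol_B:
  "(\<And>b. b \<in> W_blocks P \<Longrightarrow> tensor_poly d (w b)) \<Longrightarrow> tensor_poly d (evol_B P dt q w a)"
  unfolding evol_B_alt by (intro tensor_poly_sum tensor_poly_scale tensor_poly_B_iterate)

lemma tensor_poly_evol_Bstar:
  "(\<And>a. a \<in> V_blocks P \<Longrightarrow> tensor_poly d (v a)) \<Longrightarrow> tensor_poly d (evol_Bstar P dt q v b)"
  unfolding evol_Bstar_alt by (intro tensor_poly_sum tensor_poly_scale tensor_poly_Bstar_iterate)

text \<open>The minus sign of the iterates is the one in the definition of \<open>evol_Bstar\<close>.\<close>

lemma concomitant3_evol:
  assumes "odd n" and v: "\<And>a. a \<in> V_blocks P \<Longrightarrow> tensor_poly n (v a)"
    and w: "\<And>b. b \<in> W_blocks P \<Longrightarrow> tensor_poly n (w b)"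
  shows "(\<Sum>a\<in>V_blocks P. concomitant3 0 n x (v a) (evol_B P dt q w a))
       = (\<Sum>b\<in>W_blocks P. concomitant3 0 n x (evol_Bstar P dt q v b) (w b))"
proof -
  define c where "c l = 2 * ((dt/2) ^ (2*l-1) / fact (2*l-1))" for l
  define c' where "c' l = - (2 * ((dt/2) ^ (2*l-1) / fact (2*l-1)))" for l
  define X where "X l = ((\<lambda>F. op_W P (op_V P F)) ^^ (l-1)) (op_W P w)" for l
  define Y where "Y l = ((\<lambda>F. op_V P (op_W P F)) ^^ (l-1)) (op_V P v)" for l
  have X: "tensor_poly n (X l a)" and Y: "tensor_poly n (Y l b)" for l a b
    unfolding X_def Y_def by (intro tensor_poly_B_iterate tensor_poly_Bstar_iterate v w; assumption)+
  have "(\<Sum>a\<in>V_blocks P. concomitant3 0 n x (v a) (evol_B P dt q w a))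
      = (\<Sum>a\<in>V_blocks P. \<Sum>l=1..q. c l * concomitant3 0 n x (v a) (X l a))"
    unfolding evol_B_alt c_def[symmetric] X_def[symmetric]
    by (intro sum.cong refl) (simp add: concomitant3_sum_right[OF tensor_poly_scale[OF X]] concomitant3_scale(2)[OF v X])
  also have "\<dots> = (\<Sum>l=1..q. c l * (\<Sum>a\<in>V_blocks P. concomitant3 0 n x (v a) (X l a)))"
    unfolding sum_distrib_left by (rule sum.swap)
  also have "\<dots> = (\<Sum>l=1..q. c' l * (\<Sum>b\<in>W_blocks P. concomitant3 0 n x (Y l b) (w b)))"
    unfolding X_def Y_def c_def c'_def by (intro sum.cong refl) (simp add: concomitant3_op_iterate[OF assms])
  also have "\<dots> = (\<Sum>b\<in>W_blocks P. \<Sum>l=1..q. c' l * concomitant3 0 n x (Y l b) (w b))"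
    unfolding sum_distrib_left by (rule sum.swap)
  also have "\<dots> = (\<Sum>b\<in>W_blocks P. concomitant3 0 n x (evol_Bstar P dt q v b) (w b))"
    unfolding evol_Bstar_alt c'_def[symmetric] Y_def[symmetric]
    by (intro sum.cong refl) (simp add: concomitant3_sum_left[OF tensor_poly_scale[OF Y]] concomitant3_scale(1)[OF Y w])
  finally show ?thesis .
qed

lemma op_W_local:
  assumes "open S" "\<And>b x. b \<in> W_blocks P \<Longrightarrow> x \<in> S \<Longrightarrow> w b x = w' b x" "x \<in> S"
  shows "op_W P w a x = op_W P w' a x"
proof -
  have "pd k (w b) x = pd k (w' b) x" if "b \<in> W_blocks P" for k b
    using assms(2)[OF that] by (rule pd_local[OF assms(1) _ assms(3)])
  then show ?thesis unfolding op_W_def by (intro sum.cong refl) (simp add: assms(2,3))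
qed

lemma op_V_local:
  assumes "open S" "\<And>a x. a \<in> V_blocks P \<Longrightarrow> x \<in> S \<Longrightarrow> v a x = v' a x" "x \<in> S"
  shows "op_V P v b x = op_V P v' b x"
proof -
  have "pd k (v a) x = pd k (v' a) x" if "a \<in> V_blocks P" for k a
    using assms(2)[OF that] by (rule pd_local[OF assms(1) _ assms(3)])
  then show ?thesis unfolding op_V_def by (intro sum.cong refl) (simp add: assms(2,3))
qed

text \<open>Used in the interior of a cell for an interpolant and the polynomial of that cell, and with \<open>S = UNIV\<close>
  for fields that agree on the blocks of the state.\<close>

lemma evol_B_local:
  assumes S: "open S" and w: "\<And>b x. b \<in> W_blocks P \<Longrightarrow> x \<in> S \<Longrightarrow> w b x = w' b x" and x: "x \<in> S"
  shows "evol_B P dt q w a x = evol_B P dt q w' a x"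
proof -
  have "((\<lambda>F. op_W P (op_V P F)) ^^ l) (op_W P w) a x = ((\<lambda>F. op_W P (op_V P F)) ^^ l) (op_W P w') a x"
    if "x \<in> S" for l a x
    using that
  proof (induction l arbitrary: a x)
    case 0
    then show ?case using op_W_local[OF S w] by simp
  next
    case (Suc l)
    then show ?case by (auto intro!: op_W_local[OF S] op_V_local[OF S])
  qed
  then show ?thesis using x by (simp add: evol_B_alt)
qed

lemma evol_Bstar_local:
  assumes S: "open S" and v: "\<And>a x. a \<in> V_blocks P \<Longrightarrow> x \<in> S \<Longrightarrow> v a x = v' a x" and x: "x \<in> S"
  shows "evol_Bstar P dt q v b x = evol_Bstar P dt q v' b x"
proof -
  have "((\<lambda>F. op_V P (op_W P F)) ^^ l) (op_V P v) b x = ((\<lambda>F. op_V P (op_W P F)) ^^ l) (op_V P v') b x"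
    if "x \<in> S" for l b x
    using that
  proof (induction l arbitrary: b x)
    case 0
    then show ?case using op_V_local[OF S v] by simp
  next
    case (Suc l)
    then show ?case by (auto intro!: op_W_local[OF S] op_V_local[OF S])
  qed
  then show ?thesis using x by (simp add: evol_Bstar_alt)
qed

lemma op_W_shift: "op_W P (\<lambda>b x. w b (x + c)) = (\<lambda>a x. op_W P w a (x + c))"
  unfolding op_W_alt[abs_def] pd_shift ..

lemma op_V_shift: "op_V P (\<lambda>a x. v a (x + c)) = (\<lambda>b x. op_V P v b (x + c))"
  unfolding op_V_alt[abs_def] pd_shift ..

lemma evol_B_shift: "evol_B P dt q (\<lambda>b x. w b (x + c)) = (\<lambda>a x. evol_B P dt q w a (x + c))"
proof -
  have "((\<lambda>F. op_W P (op_V P F)) ^^ l) (op_W P (\<lambda>b x. w b (x + c)))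
      = (\<lambda>a x. ((\<lambda>F. op_W P (op_V P F)) ^^ l) (op_W P w) a (x + c))" for l
    by (induction l) (simp_all only: funpow.simps o_apply id_apply op_W_shift op_V_shift)
  then show ?thesis by (simp add: evol_B_alt[abs_def])
qed

lemma evol_Bstar_shift: "evol_Bstar P dt q (\<lambda>a x. v a (x + c)) = (\<lambda>b x. evol_Bstar P dt q v b (x + c))"
proof -
  have "((\<lambda>F. op_V P (op_W P F)) ^^ l) (op_V P (\<lambda>a x. v a (x + c)))
      = (\<lambda>b x. ((\<lambda>F. op_V P (op_W P F)) ^^ l) (op_V P v) b (x + c))" for l
    by (induction l) (simp_all only: funpow.simps o_apply id_apply op_W_shift op_V_shift)
  then show ?thesis by (simp add: evol_Bstar_alt[abs_def])
qed

lemma evol_Bstar_eq_shifted: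
  assumes "\<And>a x. a \<in> V_blocks P \<Longrightarrow> v' a (x + c) = v a x"
  shows "evol_Bstar P dt q v' b (x + c) = evol_Bstar P dt q v b x"
proof -
  have "evol_Bstar P dt q v' b (x + c) = evol_Bstar P dt q (\<lambda>a x. v' a (x + c)) b x"
    unfolding evol_Bstar_shift ..
  also have "\<dots> = evol_Bstar P dt q v b x"
    by (rule evol_Bstar_local[OF open_UNIV]) (simp_all add: assms)
  finally show ?thesis .
qed

lemma evol_B_eq_shifted:
  assumes "\<And>b x. b \<in> W_blocks P \<Longrightarrow> w' b (x + c) = w b x"
  shows "evol_B P dt q w' a (x + c) = evol_B P dt q w a x"
proof -
  have "evol_B P dt q w' a (x + c) = evol_B P dt q (\<lambda>b x. w' b (x + c)) a x"
    unfolding evol_B_shift ..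
  also have "\<dots> = evol_B P dt q w a x"
    by (rule evol_B_local[OF open_UNIV]) (simp_all add: assms)
  finally show ?thesis .
qed

lemma periodic_evol_B:
  "(\<And>b. b \<in> W_blocks P \<Longrightarrow> periodic (W b)) \<Longrightarrow> periodic (evol_B P dt q W a)"
  by (rule periodicI) (rule evol_B_eq_shifted, rule periodic_lattice_shift)

lemma periodic_evol_Bstar:
  "(\<And>a. a \<in> V_blocks P \<Longrightarrow> periodic (V a)) \<Longrightarrow> periodic (evol_Bstar P dt q V b)"
  by (rule periodicI) (rule evol_Bstar_eq_shifted, rule periodic_lattice_shift)

lemma vertex_interior_dual_cell:
  assumes "\<And>k. N $ k > 0"
  shows "vertex p N i \<in> interior (cell (dual p N) N (i - 1))"
    and "vertex (dual p N) N i \<in> interior (cell p N i)"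
proof -
  have h: "spacing N $ k > 0" for k by (rule spacing_pos) (rule assms)
  have dual: "dual p N $ k = p $ k + spacing N $ k / 2" for k by (simp add: dual_def)
  show "vertex p N i \<in> interior (cell (dual p N) N (i - 1))"
    unfolding cell_def interior_cbox mem_box_cart
  proof
    fix k
    show "vertex (dual p N) N (i - 1) $ k < vertex p N i $ k \<and>
        vertex p N i $ k < vertex (dual p N) N (\<chi> k. (i - 1) $ k + 1) $ k"
      using h[of k] by (simp add: vertex_nth dual algebra_simps)
  qed
  show "vertex (dual p N) N i \<in> interior (cell p N i)"
    unfolding cell_def interior_cbox mem_box_cart
  proof
    fix k
    show "vertex p N i $ k < vertex (dual p N) N i $ k \<and>
        vertex (dual p N) N i $ k < vertex p N (\<chi> k. i $ k + 1) $ k"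
      using h[of k] by (simp add: vertex_nth dual algebra_simps)
  qed
qed

lemma period_inner_commute: "period_inner m F G = period_inner m G F"
  by (simp add: period_inner_def inner_commute)

text \<open>Both sides become sums over the vertices of one grid of the skew form of a jump with a polynomial. Moving
  the operator is \<open>concomitant3_evol\<close>. Moving the jump is summation by parts: shift the summation over vertices
  by the corner \<open>\<sigma>\<close>, then reflect the corners. The reflection costs a minus sign, which cancels that of
  the skew symmetry.\<close>

theorem HB_inner_adjoint:
  assumes N: "\<And>k. N $ k > 0"
    and V: "\<And>a. a \<in> V_blocks P \<Longrightarrow> V a \<in> HB_space m p N"
    and W: "\<And>b. b \<in> W_blocks P \<Longrightarrow> W b \<in> HB_space m (dual p N) N"
  shows "HB_inner m (V_blocks P) V (HB_field m p N (evol_B P dt q W))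
       = HB_inner m (W_blocks P) (HB_field m (dual p N) N (evol_Bstar P dt q V)) W"
proof -
  define p' where "p' = dual p N"
  define v where "v j a = cell_poly m p N (vertex_data p N (V a)) j" for j a
  define w where "w j b = cell_poly m p' N (vertex_data p' N (W b)) j" for j b
  \<comment> \<open>The form for primal cell \<open>i\<close> and dual cell \<open>j\<close>.\<close>
  define E where "E i j = (\<Sum>b\<in>W_blocks P. concomitant3 0 (2 * m + 1) 0 (evol_Bstar P dt q (v i) b) (w j b))" for i j
  let ?K = "(-1 :: real) ^ (3 * (m + 1))"
  note V' = HB_spaceD[OF N V] and W' = HB_spaceD[OF N W, folded p'_def]
  have tv: "tensor_poly (2 * m + 1) (v j a)" and tw: "tensor_poly (2 * m + 1) (w j b)" for j a b
    unfolding v_def w_def by (rule tensor_poly_cell_poly[OF N])+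
  have Vv: "V a x = v j a x" if "a \<in> V_blocks P" "x \<in> interior (cell p N j)" for a j x
    using HB_eq_cell_poly[OF N, of x p j m "V a"] V'(2)[OF that(1)] subsetD[OF interior_subset that(2)]
    by (simp add: v_def)
  have Ww: "W b x = w j b x" if "b \<in> W_blocks P" "x \<in> interior (cell p' N j)" for b j x
    using HB_eq_cell_poly[OF N, of x p' j m "W b"] W'(2)[OF that(1)] subsetD[OF interior_subset that(2)]
    by (simp add: w_def)
  have E_shift: "E (i + cells_shift N z) (j + cells_shift N z) = E i j" for i j z
    unfolding E_def
  proof (rule sum.cong[OF refl])
    fix b assume b: "b \<in> W_blocks P"
    let ?f = "evol_Bstar P dt q (v (i + cells_shift N z)) b" and ?g = "w (j + cells_shift N z) b"
    have "concomitant3 0 (2 * m + 1) 0 ?f ?g = concomitant3 0 (2 * m + 1) (0 + lattice_shift z) ?f ?g"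
      by (intro concomitant3_const tensor_poly_evol_Bstar tv tw)
    also have "\<dots> = concomitant3 0 (2 * m + 1) 0 (\<lambda>x. ?f (x + lattice_shift z)) (\<lambda>x. ?g (x + lattice_shift z))"
      by (simp add: concomitant3_def mderiv_shift)
    also have "(\<lambda>x. ?f (x + lattice_shift z)) = evol_Bstar P dt q (v i) b"
    proof
      fix x show "?f (x + lattice_shift z) = evol_Bstar P dt q (v i) b x"
        by (rule evol_Bstar_eq_shifted) (simp add: v_def cell_poly_shift[OF N V'(1)])
    qed
    also have "(\<lambda>x. ?g (x + lattice_shift z)) = w j b"
      using cell_poly_shift[OF N W'(1)[OF b]] by (simp add: w_def fun_eq_iff)
    finally show "concomitant3 0 (2 * m + 1) 0 ?f ?g = concomitant3 0 (2 * m + 1) 0 (evol_Bstar P dt q (v i) b) (w j b)" .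
  qed
  \<comment> \<open>The primal vertex \<open>i\<close> is the centre of the dual cell \<open>i - 1\<close>.\<close>
  have "period_inner m (V a) (HB m p N (evol_B P dt q W a)) = ?K * (\<Sum>i\<in>cells N. \<Sum>\<sigma>\<in>corners 0.
      corner_sign \<sigma> * concomitant3 0 (2 * m + 1) 0 (v (i - \<sigma>) a) (evol_B P dt q (w (i - 1)) a))"
    if a: "a \<in> V_blocks P" for a
    unfolding v_def
  proof (rule period_inner_HB[OF N V'(1)[OF a] V'(2)[OF a]])
    show "periodic (evol_B P dt q W a)" by (intro periodic_evol_B W'(1))
    fix i \<beta>
    show "mderiv \<beta> (evol_B P dt q (w (i - 1)) a) (vertex p N i) = mderiv \<beta> (evol_B P dt q W a) (vertex p N i)"
      using vertex_interior_dual_cell(1)[OF N, of p i] unfolding p'_def[symmetric]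
      by (intro mderiv_local[OF open_interior] evol_B_local[OF open_interior] Ww[symmetric])
  qed (intro tensor_poly_evol_B tw)
  then have "HB_inner m (V_blocks P) V (HB_field m p N (evol_B P dt q W))
      = (\<Sum>a\<in>V_blocks P. ?K * (\<Sum>i\<in>cells N. \<Sum>\<sigma>\<in>corners 0.
          corner_sign \<sigma> * concomitant3 0 (2 * m + 1) 0 (v (i - \<sigma>) a) (evol_B P dt q (w (i - 1)) a)))"
    by (simp add: HB_inner_eq HB_field_def)
  also have "\<dots> = ?K * (\<Sum>i\<in>cells N. \<Sum>\<sigma>\<in>corners 0. corner_sign \<sigma> *
      (\<Sum>a\<in>V_blocks P. concomitant3 0 (2 * m + 1) 0 (v (i - \<sigma>) a) (evol_B P dt q (w (i - 1)) a)))"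
    unfolding sum_distrib_left by (subst sum.swap, intro sum.cong refl, rule sum.swap)
  also have "\<dots> = ?K * (\<Sum>i\<in>cells N. \<Sum>\<sigma>\<in>corners 0. corner_sign \<sigma> * E (i - \<sigma>) (i - 1))"
    unfolding E_def by (subst concomitant3_evol) (use tv tw in auto)
  also have "\<dots> = ?K * (\<Sum>\<sigma>\<in>corners 0. corner_sign \<sigma> * (\<Sum>i\<in>cells N. E (i - \<sigma>) (i - 1)))"
    unfolding sum_distrib_left by (subst sum.swap) simp
  also have "\<dots> = ?K * (\<Sum>\<sigma>\<in>corners 0. corner_sign \<sigma> * (\<Sum>i\<in>cells N. E i (i - (1 - \<sigma>))))"
  proof -
    have "(\<Sum>i\<in>cells N. E (i - \<sigma>) (i - 1)) = (\<Sum>i\<in>cells N. E i (i - (1 - \<sigma>)))" for \<sigma>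
    proof -
      have "E (i + cells_shift N z - \<sigma>) (i + cells_shift N z - 1) = E (i - \<sigma>) (i - 1)" for i z
        using E_shift[of "i - \<sigma>" z "i - 1"] by (simp add: algebra_simps)
      from sum_cells_shift[where h = "\<lambda>i. E (i - \<sigma>) (i - 1)", OF N this, of \<sigma>]
      show ?thesis by (simp add: algebra_simps)
    qed
    then show ?thesis by simp
  qed
  also have "\<dots> = - ?K * (\<Sum>\<sigma>\<in>corners 0. corner_sign \<sigma> * (\<Sum>i\<in>cells N. E i (i - \<sigma>)))"
    by (subst sum_corners_flip) simp
  also have "\<dots> = ?K * (\<Sum>i\<in>cells N. \<Sum>\<sigma>\<in>corners 0. corner_sign \<sigma> *
      (\<Sum>b\<in>W_blocks P. concomitant3 0 (2 * m + 1) 0 (w (i - \<sigma>) b) (evol_Bstar P dt q (v i) b)))"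
  proof -
    have "E i j = - (\<Sum>b\<in>W_blocks P. concomitant3 0 (2 * m + 1) 0 (w j b) (evol_Bstar P dt q (v i) b))" for i j
      unfolding E_def
      by (subst concomitant3_commute) (simp add: sum_negf)
    then show ?thesis unfolding sum_distrib_left[of "corner_sign _"] by (subst sum.swap) (simp add: sum_negf sum_distrib_left)
  qed
  also have "\<dots> = (\<Sum>b\<in>W_blocks P. ?K * (\<Sum>i\<in>cells N. \<Sum>\<sigma>\<in>corners 0.
          corner_sign \<sigma> * concomitant3 0 (2 * m + 1) 0 (w (i - \<sigma>) b) (evol_Bstar P dt q (v i) b)))"
    unfolding sum_distrib_left
    by (rule sym, subst sum.swap, intro sum.cong refl, rule sum.swap)
  also have "\<dots> = (\<Sum>b\<in>W_blocks P. period_inner m (W b) (HB m p' N (evol_Bstar P dt q V b)))"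
  proof (rule sum.cong[OF refl])
    fix b assume b: "b \<in> W_blocks P"
    show "?K * (\<Sum>i\<in>cells N. \<Sum>\<sigma>\<in>corners 0.
          corner_sign \<sigma> * concomitant3 0 (2 * m + 1) 0 (w (i - \<sigma>) b) (evol_Bstar P dt q (v i) b))
        = period_inner m (W b) (HB m p' N (evol_Bstar P dt q V b))"
      unfolding w_def
    proof (rule period_inner_HB[OF N W'(1)[OF b] W'(2)[OF b], symmetric])
      show "periodic (evol_Bstar P dt q V b)" by (intro periodic_evol_Bstar V'(1))
      fix i \<beta>
      show "mderiv \<beta> (evol_Bstar P dt q (v i) b) (vertex p' N i) = mderiv \<beta> (evol_Bstar P dt q V b) (vertex p' N i)"
        using vertex_interior_dual_cell(2)[OF N, of p i] unfolding p'_def[symmetric]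
        by (intro mderiv_local[OF open_interior] evol_Bstar_local[OF open_interior] Vv[symmetric])
    qed (intro tensor_poly_evol_Bstar tv)
  qed
  also have "\<dots> = HB_inner m (W_blocks P) (HB_field m (dual p N) N (evol_Bstar P dt q V)) W"
    unfolding HB_inner_eq HB_field_def p'_def by (intro sum.cong refl period_inner_commute)
  finally show ?thesis .
qed


section \<open>Conserved quantities\<close>

text \<open>A class of functions that contains the interpolants, is closed under addition, and on which the integrals
  in the semi-inner product exist, so that it is additive.\<close>

definition piecewise :: "nat \<Rightarrow> real^3 \<Rightarrow> nat^3 \<Rightarrow> (real^3 \<Rightarrow> 'a::real_normed_vector) \<Rightarrow> bool" where
  "piecewise m p N F \<longleftrightarrow> periodic F
     \<and> (\<exists>u. (\<forall>j. tensor_poly (2 * m + 1) (u j)) \<and> (\<forall>j. \<forall>x\<in>cell p N j. F x = u j x))"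

lemma piecewise_HB:
  assumes "\<And>k. N $ k > 0" "periodic F"
  shows "piecewise m p N (HB m p N F)"
  unfolding piecewise_def
  using periodic_HB[OF assms] tensor_poly_cell_poly[OF assms(1)] HB_eq_cell_poly[OF assms(1)] by metis

lemma piecewise_add: "piecewise m p N F \<Longrightarrow> piecewise m p N G \<Longrightarrow> piecewise m p N (\<lambda>x. F x + G x)"
proof -
  assume "piecewise m p N F" "piecewise m p N G"
  then obtain u w where *: "periodic F" "periodic G"
    "\<And>j. tensor_poly (2 * m + 1) (u j)" "\<And>j x. x \<in> cell p N j \<Longrightarrow> F x = u j x"
    "\<And>j. tensor_poly (2 * m + 1) (w j)" "\<And>j x. x \<in> cell p N j \<Longrightarrow> G x = w j x"
    unfolding piecewise_def by metis
  show ?thesis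
    unfolding piecewise_def
  proof (intro conjI exI[of _ "\<lambda>j x. u j x + w j x"] allI ballI)
    show "periodic (\<lambda>x. F x + G x)" using *(1,2) by (simp add: periodic_def)
    show "tensor_poly (2 * m + 1) (\<lambda>x. u j x + w j x)" for j by (intro tensor_poly_add *)
  qed (simp add: *)
qed

lemma period_inner_add_left:
  assumes N: "\<And>k. N $ k > 0"
    and "piecewise m p N F" "piecewise m p N G" "piecewise m p N H"
  shows "period_inner m (\<lambda>x. F x + G x) H = period_inner m F H + period_inner m G H"
proof -
  obtain u v w where *: "periodic F" "periodic G" "periodic H"
    "\<And>j. tensor_poly (2 * m + 1) (u j)" "\<And>j x. x \<in> cell p N j \<Longrightarrow> F x = u j x"
    "\<And>j. tensor_poly (2 * m + 1) (v j)" "\<And>j x. x \<in> cell p N j \<Longrightarrow> G x = v j x"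
    "\<And>j. tensor_poly (2 * m + 1) (w j)" "\<And>j x. x \<in> cell p N j \<Longrightarrow> H x = w j x"
    using assms(2-4) unfolding piecewise_def by metis
  have per: "periodic (\<lambda>x. F x + G x)" using *(1,2) by (simp add: periodic_def)
  have "period_inner m (\<lambda>x. F x + G x) H = (\<Sum>r\<in>cells N. \<Sum>i\<in>corners r. corner_sign (i - r) *
      concomitant3 (m + 1) m (vertex p N i) (\<lambda>x. u r x + v r x) (w r))"
    by (rule period_inner_cells[OF N per tensor_poly_add[OF *(4) *(6)] _ *(3,8,9)]) (simp_all add: *)
  also have "\<dots> = (\<Sum>r\<in>cells N. \<Sum>i\<in>corners r. corner_sign (i - r) *
        concomitant3 (m + 1) m (vertex p N i) (u r) (w r))
      + (\<Sum>r\<in>cells N. \<Sum>i\<in>corners r. corner_sign (i - r) * concomitant3 (m + 1) m (vertex p N i) (v r) (w r))"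
    by (simp add: concomitant3_add_left[OF *(4,6)] distrib_left sum.distrib)
  also have "\<dots> = period_inner m F H + period_inner m G H"
    using period_inner_cells[OF N *(1,4,5) *(3,8,9)] period_inner_cells[OF N *(2,6,7) *(3,8,9)] by simp
  finally show ?thesis .
qed

lemma HB_inner_commute: "HB_inner m S F G = HB_inner m S G F"
  by (simp add: HB_inner_eq period_inner_commute)

lemma HB_inner_sum_left:
  assumes N: "\<And>k. N $ k > 0"
    and pw: "\<And>a. a \<in> S \<Longrightarrow> piecewise m p N (F a)" "\<And>a. a \<in> S \<Longrightarrow> piecewise m p N (G a)"
      "\<And>a. a \<in> S \<Longrightarrow> piecewise m p N (H a)"
    and E: "\<And>a x. a \<in> S \<Longrightarrow> E a x = F a x + G a x"
  shows "HB_inner m S E H = HB_inner m S F H + HB_inner m S G H"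
proof -
  have "period_inner m (E a) (H a) = period_inner m (F a) (H a) + period_inner m (G a) (H a)" if "a \<in> S" for a
  proof -
    have "E a = (\<lambda>x. F a x + G a x)" using E[OF that] by (rule ext)
    then show ?thesis using period_inner_add_left[OF N pw[OF that]] by simp
  qed
  then show ?thesis by (simp add: HB_inner_eq sum.distrib)
qed

lemma HB_norm_square: "(HB_norm m S F)\<^sup>2 = HB_inner m S F F"
proof -
  have "period_inner m (F a) (F a) \<ge> 0" for a
    unfolding period_inner_def set_lebesgue_integral_def by (rule Bochner_Integration.integral_nonneg) simp
  then show ?thesis by (simp add: HB_norm_def HB_inner_eq sum_nonneg)
qed

text \<open>Since \<open>T = B - A\<close>, this is \<open>4 \<langle>A, B\<rangle> = |A + B|\<^sup>2 - |B - A|\<^sup>2\<close>.\<close>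

lemma HB_norm_polarize:
  assumes N: "\<And>k. N $ k > 0"
    and a: "\<And>c. c \<in> S \<Longrightarrow> piecewise m p N (A c)" and t: "\<And>c. c \<in> S \<Longrightarrow> piecewise m p N (T c)"
    and b: "\<And>c x. c \<in> S \<Longrightarrow> B c x = A c x + T c x"
  shows "1/4 * (HB_norm m S (\<lambda>c x. A c x + B c x))\<^sup>2 - 1/4 * (HB_norm m S T)\<^sup>2 = HB_inner m S A B"
proof -
  let ?I = "HB_inner m S"
  have pb: "piecewise m p N (B c)" if "c \<in> S" for c
  proof -
    have "B c = (\<lambda>x. A c x + T c x)" using b[OF that] by (rule ext)
    then show ?thesis using piecewise_add[OF a[OF that] t[OF that]] by simp
  qed
  define C where "C = (\<lambda>c x. A c x + B c x)"
  have pc: "piecewise m p N (C c)" if "c \<in> S" for c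
    unfolding C_def using that by (intro piecewise_add a pb)
  have B: "?I B H = ?I A H + ?I T H" if "\<And>c. c \<in> S \<Longrightarrow> piecewise m p N (H c)" for H
    by (rule HB_inner_sum_left[OF N]) (auto simp: b intro: a t that)
  have C: "?I C H = ?I A H + ?I B H" if "\<And>c. c \<in> S \<Longrightarrow> piecewise m p N (H c)" for H
    by (rule HB_inner_sum_left[OF N]) (auto simp: C_def intro: a pb that)
  have "?I C C = ?I A C + ?I B C" "?I C A = ?I A A + ?I B A" "?I C B = ?I A B + ?I B B"
    by (intro C pc a pb; assumption)+
  moreover have "?I B A = ?I A A + ?I T A" "?I B B = ?I A B + ?I T B" "?I B T = ?I A T + ?I T T"
    by (intro B a pb t; assumption)+
  ultimately have "?I C C - ?I T T = 4 * ?I A B"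
    using HB_inner_commute[of m S C A] HB_inner_commute[of m S C B] HB_inner_commute[of m S A B]
      HB_inner_commute[of m S T A] HB_inner_commute[of m S T B] by simp
  then show ?thesis by (simp add: HB_norm_square C_def)
qed

theorem theorem3:
  fixes P :: sellmeier and N :: "nat^3" and p :: "real^3" and m q :: nat and dt :: real
    and V W :: "real \<Rightarrow> field"
  assumes "permittivity P > 0" and "permeability P > 0"
    and "\<And>k. N $ k > 0" and "dt > 0" and "q \<ge> 1"
    and "\<And>(n::nat) a. a \<in> V_blocks P \<Longrightarrow> V (real n * dt) a \<in> HB_space m p N"
    and "\<And>(n::nat) b. b \<in> W_blocks P \<Longrightarrow>
           W ((real n - 1/2) * dt) b \<in> HB_space m (dual p N) N"
    and "\<And>(n::nat) a x. a \<in> V_blocks P \<Longrightarrow>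
           V ((real n + 1) * dt) a x - V (real n * dt) a x
           = HB_field m p N (evol_B P dt q
               (HB_field m (dual p N) N (W ((real n + 1/2) * dt)))) a x"
    and "\<And>(n::nat) b x. b \<in> W_blocks P \<Longrightarrow>
           W ((real n + 1/2) * dt) b x - W ((real n - 1/2) * dt) b x
           = - HB_field m (dual p N) N (evol_Bstar P dt q
               (HB_field m p N (V (real n * dt)))) b x"
  shows "(\<exists>C. \<forall>n::nat.
            (HB_norm m (V_blocks P) (V (real n * dt)))\<^sup>2
            + 1/4 * (HB_norm m (W_blocks P)
                (\<lambda>b x. W ((real n + 1/2) * dt) b x + W ((real n - 1/2) * dt) b x))\<^sup>2
            - 1/4 * (HB_norm m (W_blocks P)
                (HB_field m (dual p N) N (evol_Bstar P dt q (V (real n * dt)))))\<^sup>2 = C)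
       \<and> (\<exists>C. \<forall>n::nat.
            (HB_norm m (W_blocks P) (W ((real n + 1/2) * dt)))\<^sup>2
            + 1/4 * (HB_norm m (V_blocks P)
                (\<lambda>a x. V ((real n + 1) * dt) a x + V (real n * dt) a x))\<^sup>2
            - 1/4 * (HB_norm m (V_blocks P)
                (HB_field m p N (evol_B P dt q (W ((real n + 1/2) * dt)))))\<^sup>2 = C)"
proof -
  note N = assms(3)
  let ?I = "HB_inner m (V_blocks P)" and ?J = "HB_inner m (W_blocks P)"
  define v where "v n = V (real n * dt)" for n :: nat
  define w where "w n = W ((real n - 1/2) * dt)" for n :: nat
  define S where "S n = HB_field m p N (evol_B P dt q (w (Suc n)))" for n
  define T where "T n = HB_field m (dual p N) N (evol_Bstar P dt q (v n))" for n
  have v_Suc: "V ((real n + 1) * dt) = v (Suc n)" for n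
    by (simp add: v_def add.commute)
  have w_Suc: "W ((real n + 1/2) * dt) = w (Suc n)" for n
  proof -
    have "real (Suc n) - 1/2 = real n + 1/2" by simp
    then show ?thesis by (simp only: w_def)
  qed
  have v: "v n a \<in> HB_space m p N" if "a \<in> V_blocks P" for n a
    using assms(6)[OF that] by (simp add: v_def)
  have w: "w n b \<in> HB_space m (dual p N) N" if "b \<in> W_blocks P" for n b
    using assms(7)[OF that] by (simp add: w_def)
  note v' = HB_spaceD[OF N v] and w' = HB_spaceD[OF N w]
  have "evol_B P dt q (HB_field m (dual p N) N (w n)) = evol_B P dt q (w n)" for n
    by (intro ext evol_B_local[OF open_UNIV]) (simp_all add: HB_field_def w')
  then have step_v: "v (Suc n) a x = v n a x + S n a x" if "a \<in> V_blocks P" for n a x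
    using assms(8)[OF that, of n x] unfolding v_Suc w_Suc v_def[symmetric]
    by (simp add: S_def diff_eq_eq add.commute)
  have "evol_Bstar P dt q (HB_field m p N (v n)) = evol_Bstar P dt q (v n)" for n
    by (intro ext evol_Bstar_local[OF open_UNIV]) (simp_all add: HB_field_def v')
  then have step_w: "w n b x = w (Suc n) b x + T n b x" if "b \<in> W_blocks P" for n b x
    using assms(9)[OF that, of n x] unfolding w_Suc w_def[symmetric] v_def[symmetric]
    by (simp add: T_def diff_eq_eq)
  have pv: "piecewise m p N (v n a)" if "a \<in> V_blocks P" for n a
    using piecewise_HB[OF N v'(1)[OF that], of m p n] v'(2)[OF that] by simp
  have pw: "piecewise m (dual p N) N (w n b)" if "b \<in> W_blocks P" for n b
    using piecewise_HB[OF N w'(1)[OF that], of m "dual p N" n] w'(2)[OF that] by simp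
  have pS: "piecewise m p N (S n a)" for n a
    unfolding S_def HB_field_def by (intro piecewise_HB N periodic_evol_B w'(1))
  have pT: "piecewise m (dual p N) N (T n b)" for n b
    unfolding T_def HB_field_def by (intro piecewise_HB N periodic_evol_Bstar v'(1))
  have adj: "?I (v k) (S n) = ?J (T k) (w (Suc n))" for k n
    unfolding S_def T_def by (rule HB_inner_adjoint[OF N v w])
  have I_Suc: "?I (v (Suc n)) H = ?I (v n) H + ?I (S n) H"
    if "\<And>a. a \<in> V_blocks P \<Longrightarrow> piecewise m p N (H a)" for n H
    by (rule HB_inner_sum_left[OF N pv pS that step_v])
  have J_Suc: "?J (w n) H = ?J (w (Suc n)) H + ?J (T n) H"
    if "\<And>b. b \<in> W_blocks P \<Longrightarrow> piecewise m (dual p N) N (H b)" for n H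
    by (rule HB_inner_sum_left[OF N pw pT that step_w])
  note I_sym = HB_inner_commute[of m "V_blocks P"] and J_sym = HB_inner_commute[of m "W_blocks P"]
  \<comment> \<open>The two conserved quantities after polarization.\<close>
  define Q where "Q n = ?I (v n) (v n) + ?J (w (Suc n)) (w n)" for n
  define R where "R n = ?J (w (Suc n)) (w (Suc n)) + ?I (v n) (v (Suc n))" for n
  have "Q (Suc n) = Q n" for n
    using I_Suc[of "v (Suc n)" n, OF pv] I_Suc[of "v n" n, OF pv] I_sym[of "v n" "v (Suc n)"]
      J_Suc[of "w (Suc n)" n, OF pw] J_Suc[of "w (Suc n)" "Suc n", OF pw]
      J_sym[of "w n" "w (Suc n)"] adj[of "Suc n" n] adj[of n n]
      I_sym[of "S n" "v n"] I_sym[of "S n" "v (Suc n)"]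
    unfolding Q_def by linarith
  then have Q: "Q n = Q 0" for n by (induction n) auto
  have "R (Suc n) = R n" for n
    using I_Suc[of "v (Suc n)" "Suc n", OF pv] I_Suc[of "v (Suc n)" n, OF pv]
      I_sym[of "v (Suc n)" "v (Suc (Suc n))"]
      J_Suc[of "w (Suc n)" "Suc n", OF pw] J_Suc[of "w (Suc (Suc n))" "Suc n", OF pw]
      J_sym[of "w (Suc n)" "w (Suc (Suc n))"] adj[of "Suc n" "Suc n"] adj[of "Suc n" n]
      I_sym[of "S n" "v (Suc n)"] I_sym[of "S (Suc n)" "v (Suc n)"]
    unfolding R_def by linarith
  then have R: "R n = R 0" for n by (induction n) auto
  have polarize_w: "1/4 * (HB_norm m (W_blocks P) (\<lambda>b x. w (Suc n) b x + w n b x))\<^sup>2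
      - 1/4 * (HB_norm m (W_blocks P) (T n))\<^sup>2 = ?J (w (Suc n)) (w n)" for n
    by (rule HB_norm_polarize[OF N pw pT step_w])
  have polarize_v: "1/4 * (HB_norm m (V_blocks P) (\<lambda>a x. v n a x + v (Suc n) a x))\<^sup>2
      - 1/4 * (HB_norm m (V_blocks P) (S n))\<^sup>2 = ?I (v n) (v (Suc n))" for n
    by (rule HB_norm_polarize[OF N pv pS step_v])
  have "(HB_norm m (V_blocks P) (V (real n * dt)))\<^sup>2
      + 1/4 * (HB_norm m (W_blocks P)
          (\<lambda>b x. W ((real n + 1/2) * dt) b x + W ((real n - 1/2) * dt) b x))\<^sup>2
      - 1/4 * (HB_norm m (W_blocks P)
          (HB_field m (dual p N) N (evol_Bstar P dt q (V (real n * dt)))))\<^sup>2 = Q 0" for n :: nat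
    using polarize_w[of n] Q[of n]
    unfolding w_Suc w_def[symmetric] v_def[symmetric]
    by (simp add: Q_def HB_norm_square[of m "V_blocks P"] T_def)
  moreover have "(HB_norm m (W_blocks P) (W ((real n + 1/2) * dt)))\<^sup>2
      + 1/4 * (HB_norm m (V_blocks P)
          (\<lambda>a x. V ((real n + 1) * dt) a x + V (real n * dt) a x))\<^sup>2
      - 1/4 * (HB_norm m (V_blocks P)
          (HB_field m p N (evol_B P dt q (W ((real n + 1/2) * dt)))))\<^sup>2 = R 0" for n :: nat
    using polarize_v[of n] R[of n]
    unfolding v_Suc w_Suc v_def[symmetric]
    by (simp add: R_def HB_norm_square[of m "W_blocks P"] S_def add.commute[of "v (Suc n) _ _"])
  ultimately show ?thesis by blast
qed

end
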